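(* Let $n\ge 3$, let $M$ be a Riemann surface, and let $f,\hat f:M\to S^n$ be two distinct smooth immersions, with $f(p)\neq\hat f(p)$ for all $p\in M$. Suppose that (i) $f$ and $\hat f$ envelop a common 2-sphere congruence $S$, and (ii) $f$ and $\hat f$ both induce the given conformal structure of $M$ (so they are conformal at corresponding points $f(p)$, $\hat f(p)$). Then, besides trivial cases, locally the pair $(f,\hat f)$ must be among either of the following two classes: 1. a Darboux pair of isothermic surfaces; 2. an S-Willmore surface with its dual surface. In the first case, the correspondence $f(p)\mapsto\hat f(p)$ between the two surfaces is orientation preserving. In the second case, the correspondence is anti-conformal.
   Context: **Sphere congruences and envelopes.** A 2-sphere congruence is a smooth assignment $p\mapsto S(p)$ of a round 2-sphere $S(p)\subset S^n$ to each $p\in M$. An immersion $f$ envelops it if $f(p)\in S(p)$ and $df(T_pM)=T_{f(p)}S(p)$ for all $p$. **Trivial pairs.** The pair $(f,\hat f)$ is trivial if $f$ and $\hat f$ are congruent up to Möbius transforms, i.e. $\hat f=T\circ f$ for a Möbius transformation $T$ of $S^n$ (possibly orientation reversing). **Orientation.** $M$ carries the orientation of its complex structure. Orient $S(p)$ so that $df_p:T_pM\to T_{f(p)}S(p)$ preserves orientation. The correspondence is orientation preserving if $d\hat f_p:T_pM\to T_{\hat f(p)}S(p)$ also preserves orientation for all $p$. It is anti-conformal if $d\hat f_p$ reverses orientation for all $p$. **Light-cone model.** $\mathbb R^{n+1,1}$ is Minkowski space with inner product $\langle\cdot,\cdot\rangle$, extended complex bilinearly. Points of $S^n$ are the isotropic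 lines. Round $k$-spheres correspond to space-like $(n-k)$-dimensional subspaces, equivalently to their orthogonal complements of signature $(k+1,1)$; a point lies on the sphere if its isotropic line lies in that complement. For a conformal immersion $f:M\to S^n$ and a local complex coordinate $z$, the canonical lift $Y$ is the map into the forward light cone that spans $f$ and satisfies $|dY|^2=|dz|^2$, i.e. $\langle Y_z,Y_z\rangle=0$ and $\langle Y_z,Y_{\bar z}\rangle=\frac12$. Set $V=\mathrm{span}\{Y,dY,Y_{z\bar z}\}$. This is a bundle of signature $(3,1)$, independent of the choices made. Let $V^\perp$ be its orthogonal complement in $M\times\mathbb R^{n+1,1}$, and let $D$ be the normal connection on $V^\perp$ (derivative followed by orthogonal projection to $V^\perp$). Let $N\in\Gamma(V)$ be the section with $\langle N,N\rangle=0$, $\langle N,Y\rangle=-1$, $\langle N,Y_z\rangle=0$. The equation $$Y_{zz}+\tfrac{s}{2}Y=\kappa$$ defines the complex function $s$ (Schwarzian) and the section $\kappa\in\Gamma(V^\perp\otimes\mathbb C)$ (Hopf differential). Both depend on $f$ and $z$. Write $\hat\kappa$ for the Hopf differential of $\hat f$. **Isothermic surfaces and Darboux pairs.** $f$ is isothermic if around each point there is a complex coordinate $z$ in which $\kappa$ is real valued (i.e. a section of $V^\perp$). A Darboux pair of isothermic surfaces is a pair $f,\hat f$ of immersions that envelop a common 2-sphere congruence, induce the same conformal structure, and are both isothermic with corresponding curvature lines: around each point there is one complex coordinate $z$ in which $\kappa$ and $\hat\kappa$ are both real valued. (The pair is then said to envelop a conformal Ribaucour sphere congruence.) **Willmore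 and S-Willmore surfaces; duals.** $f$ is Willmore if $D_{\bar z}D_{\bar z}\kappa+\frac12\bar s\,\kappa=0$. $f$ is S-Willmore if it is Willmore and $\kappa$ and $D_{\bar z}\kappa$ are linearly dependent over $\mathbb C$ at every point. A surface $\hat f$ is a dual surface of an S-Willmore surface $f$ if locally there is a complex function $\mu$ with $D_{\bar z}\kappa+\frac{\bar\mu}{2}\kappa=0$ such that $\hat f$ is the map spanned by $$\hat Y=\tfrac{|\mu|^2}{2}Y+\bar\mu Y_z+\mu Y_{\bar z}+N.$$ *)

theory Defs
  imports "HOL-Analysis.Analysis"
begin

subsection \<open>Smooth maps on Riemann surfaces\<close>

text \<open>Only meant for open sets \<open>T\<close>.\<close>

primrec Ck_on ::
  "nat \<Rightarrow> 'a::real_normed_vector set \<Rightarrow> ('a \<Rightarrow> 'b::real_normed_vector) \<Rightarrow> bool" where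
  "Ck_on 0 T g \<longleftrightarrow> continuous_on T g"
| "Ck_on (Suc k) T g \<longleftrightarrow>
     (\<forall>x\<in>T. g differentiable (at x)) \<and>
     (\<forall>v. Ck_on k T (\<lambda>x. frechet_derivative g (at x) v))"

definition smooth_on ::
  "'a::real_normed_vector set \<Rightarrow> ('a \<Rightarrow> 'b::real_normed_vector) \<Rightarrow> bool" where
  "smooth_on T g \<longleftrightarrow> (\<forall>k. Ck_on k T g)"

type_synonym 'm atlas = "('m set \<times> ('m \<Rightarrow> complex)) set"

text \<open>A connected Hausdorff space (the Hausdorff property is the sort of \<open>'m\<close>) with a
  holomorphic atlas. Second countability is not required; by Rado's theorem it is automatic.\<close>

definition riemann_surface :: "('m::t2_space) atlas \<Rightarrow> bool" where
  "riemann_surface A \<longleftrightarrow>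
     connected (UNIV :: 'm set) \<and>
     (\<Union>(W, \<phi>)\<in>A. W) = UNIV \<and>
     (\<forall>(W, \<phi>)\<in>A. open W \<and> open (\<phi> ` W) \<and> homeomorphism W (\<phi> ` W) \<phi> (inv_into W \<phi>)) \<and>
     (\<forall>(W, \<phi>)\<in>A. \<forall>(V, \<psi>)\<in>A. (\<psi> \<circ> inv_into W \<phi>) holomorphic_on \<phi> ` (W \<inter> V))"

text \<open>Local complex coordinates: the charts of the maximal holomorphic atlas. Being injective
  and holomorphic, \<open>z\<close> is automatically biholomorphic onto an open subset of the plane.\<close>

definition coordinate :: "('m::t2_space) atlas \<Rightarrow> 'm set \<Rightarrow> ('m \<Rightarrow> complex) \<Rightarrow> bool" where
  "coordinate A V z \<longleftrightarrow> open V \<and> inj_on z V \<and>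
     (\<forall>(W, \<phi>)\<in>A. (z \<circ> inv_into W \<phi>) holomorphic_on \<phi> ` (W \<inter> V))"

definition smooth_map_on ::
  "('m::t2_space) atlas \<Rightarrow> 'm set \<Rightarrow> ('m \<Rightarrow> 'b::real_normed_vector) \<Rightarrow> bool" where
  "smooth_map_on A U g \<longleftrightarrow>
     (\<forall>(W, \<phi>)\<in>A. smooth_on (\<phi> ` (W \<inter> U)) (g \<circ> inv_into W \<phi>))"

text \<open>The differential at \<open>p\<close>, with \<open>T\<^sub>pM\<close> identified with the complex plane by the chart
  \<open>(W, \<phi>)\<close>.\<close>

definition diff_at ::
  "'m set \<Rightarrow> ('m \<Rightarrow> complex) \<Rightarrow> ('m \<Rightarrow> 'b::real_normed_vector) \<Rightarrow> 'm \<Rightarrow> complex \<Rightarrow> 'b" where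
  "diff_at W \<phi> g p = frechet_derivative (g \<circ> inv_into W \<phi>) (at (\<phi> p))"

text \<open>Immersions into the unit sphere of \<open>real^'n\<close>; for \<open>S\<^sup>n\<close> one has \<open>CARD('n) = n + 1\<close>.\<close>

definition immersion_on ::
  "('m::t2_space) atlas \<Rightarrow> 'm set \<Rightarrow> ('m \<Rightarrow> real^'n) \<Rightarrow> bool" where
  "immersion_on A U f \<longleftrightarrow>
     f ` U \<subseteq> sphere 0 1 \<and> smooth_map_on A U f \<and>
     (\<forall>(W, \<phi>)\<in>A. \<forall>p\<in>W \<inter> U. inj (diff_at W \<phi> f p))"

text \<open>The induced metric is a positive multiple of the squared modulus of the coordinate
  differential.\<close>

definition induces_conformal_structure_on ::
  "('m::t2_space) atlas \<Rightarrow> 'm set \<Rightarrow> ('m \<Rightarrow> real^'n) \<Rightarrow> bool" where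
  "induces_conformal_structure_on A U f \<longleftrightarrow>
     (\<forall>(W, \<phi>)\<in>A. \<forall>p\<in>W \<inter> U. \<exists>l>0. \<forall>v. norm (diff_at W \<phi> f p v) = l * cmod v)"

subsection \<open>Sphere congruences, envelopes, orientation\<close>

text \<open>A round 2-sphere is given by its centre, its radius and the 3-dimensional linear subspace
  parallel to its affine hull.\<close>

datatype ('n::finite) sphere2 =
  Sphere2 (centre: "real^'n") (radius: real) (dirs: "(real^'n) set")

definition points :: "('n::finite) sphere2 \<Rightarrow> (real^'n) set" where
  "points \<Sigma> = {x. x - centre \<Sigma> \<in> dirs \<Sigma> \<and> norm (x - centre \<Sigma>) = radius \<Sigma>}"

definition tangent_plane :: "('n::finite) sphere2 \<Rightarrow> real^'n \<Rightarrow> (real^'n) set" where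
  "tangent_plane \<Sigma> x = {v \<in> dirs \<Sigma>. v \<bullet> (x - centre \<Sigma>) = 0}"

definition round_2sphere_in_Sn :: "('n::finite) sphere2 \<Rightarrow> bool" where
  "round_2sphere_in_Sn \<Sigma> \<longleftrightarrow>
     radius \<Sigma> > 0 \<and> subspace (dirs \<Sigma>) \<and> dim (dirs \<Sigma>) = 3 \<and> points \<Sigma> \<subseteq> sphere 0 1"

definition sphere_congruence_on ::
  "('m::t2_space) atlas \<Rightarrow> 'm set \<Rightarrow> ('m \<Rightarrow> ('n::finite) sphere2) \<Rightarrow> bool" where
  "sphere_congruence_on A U S \<longleftrightarrow>
     (\<forall>p\<in>U. round_2sphere_in_Sn (S p)) \<and>
     smooth_map_on A U (\<lambda>p. centre (S p)) \<and>
     smooth_map_on A U (\<lambda>p. radius (S p)) \<and>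
     (\<forall>p\<in>U. \<exists>V (e :: 3 \<Rightarrow> 'm \<Rightarrow> real^'n). open V \<and> p \<in> V \<and> V \<subseteq> U \<and>
        (\<forall>i. smooth_map_on A V (e i)) \<and>
        (\<forall>q\<in>V. dirs (S q) = span (range (\<lambda>i. e i q))))"

definition envelops_on ::
  "('m::t2_space) atlas \<Rightarrow> 'm set \<Rightarrow> ('m \<Rightarrow> real^'n) \<Rightarrow> ('m \<Rightarrow> ('n::finite) sphere2) \<Rightarrow> bool" where
  "envelops_on A U f S \<longleftrightarrow>
     (\<forall>p\<in>U. f p \<in> points (S p)) \<and>
     (\<forall>(W, \<phi>)\<in>A. \<forall>p\<in>W \<inter> U. range (diff_at W \<phi> f p) = tangent_plane (S p) (f p))"

text \<open>The outward radial vector followed by the image of the positive basis of \<open>T\<^sub>pM\<close>.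
  With the outward-normal-first convention, the orientation of \<open>S p\<close> for which the differential
  of \<open>f\<close> at \<open>p\<close> preserves orientation is the one induced by the orientation of \<open>dirs (S p)\<close>
  given by this basis.\<close>

definition adapted_basis ::
  "('m \<Rightarrow> ('n::finite) sphere2) \<Rightarrow> 'm set \<Rightarrow> ('m \<Rightarrow> complex) \<Rightarrow> ('m \<Rightarrow> real^'n) \<Rightarrow> 'm
     \<Rightarrow> (real^'n)^3" where
  "adapted_basis S W \<phi> f p =
     vector [f p - centre (S p), diff_at W \<phi> f p 1, diff_at W \<phi> f p \<i>]"

definition base_change :: "real^3^3 \<Rightarrow> (real^'n)^3 \<Rightarrow> (real^'n)^3 \<Rightarrow> bool" where
  "base_change P a b \<longleftrightarrow> (\<forall>j. b $ j = (\<Sum>i\<in>UNIV. (P $ i $ j) *\<^sub>R (a $ i)))"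

definition orientation_preserving_on ::
  "('m::t2_space) atlas \<Rightarrow> 'm set \<Rightarrow> ('m \<Rightarrow> ('n::finite) sphere2) \<Rightarrow>
     ('m \<Rightarrow> real^'n) \<Rightarrow> ('m \<Rightarrow> real^'n) \<Rightarrow> bool" where
  "orientation_preserving_on A U S f fh \<longleftrightarrow>
     (\<forall>(W, \<phi>)\<in>A. \<forall>p\<in>W \<inter> U.
        \<exists>P. base_change P (adapted_basis S W \<phi> f p) (adapted_basis S W \<phi> fh p) \<and> det P > 0)"

definition anticonformal_on ::
  "('m::t2_space) atlas \<Rightarrow> 'm set \<Rightarrow> ('m \<Rightarrow> ('n::finite) sphere2) \<Rightarrow>
     ('m \<Rightarrow> real^'n) \<Rightarrow> ('m \<Rightarrow> real^'n) \<Rightarrow> bool" where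
  "anticonformal_on A U S f fh \<longleftrightarrow>
     (\<forall>(W, \<phi>)\<in>A. \<forall>p\<in>W \<inter> U.
        \<exists>P. base_change P (adapted_basis S W \<phi> f p) (adapted_basis S W \<phi> fh p) \<and> det P < 0)"

subsection \<open>The light-cone model\<close>

text \<open>Used for both the real Minkowski space \<open>real^'n \<times> real\<close> and, as the complex bilinear
  extension, for its complexification \<open>complex^'n \<times> complex\<close>.\<close>

type_synonym ('k, 'n) mink_vec = "('k, 'n) vec \<times> 'k"

definition mink :: "('k::comm_ring_1, 'n::finite) mink_vec \<Rightarrow> ('k, 'n) mink_vec \<Rightarrow> 'k" where
  "mink v w = (\<Sum>i\<in>UNIV. fst v $ i * fst w $ i) - snd v * snd w"

definition cscale :: "complex \<Rightarrow> (complex, 'n::finite) mink_vec \<Rightarrow> (complex, 'n) mink_vec"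
    (infixr "*\<^sub>C" 75) where
  "c *\<^sub>C w = (c *s fst w, c * snd w)"

definition cpx :: "(real, 'n::finite) mink_vec \<Rightarrow> (complex, 'n) mink_vec" where
  "cpx v = ((\<chi> i. complex_of_real (fst v $ i)), complex_of_real (snd v))"

text \<open>A point \<open>x\<close> of the sphere is the isotropic line through \<open>(x, 1)\<close>. Moebius
  transformations, orientation reversing ones included, are induced by the linear isometries of
  Minkowski space.\<close>

definition moebius :: "(real^('n::finite) \<Rightarrow> real^'n) \<Rightarrow> bool" where
  "moebius T \<longleftrightarrow>
     (\<exists>L :: (real, 'n) mink_vec \<Rightarrow> (real, 'n) mink_vec. linear L \<and> (\<forall>v w. mink (L v) (L w) = mink v w) \<and>
        (\<forall>x\<in>sphere 0 1. T x \<in> sphere 0 1 \<and> (\<exists>c. c \<noteq> 0 \<and> L (x, 1) = c *\<^sub>R (T x, 1))))"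

definition trivial_pair :: "('m \<Rightarrow> real^'n) \<Rightarrow> ('m \<Rightarrow> real^('n::finite)) \<Rightarrow> bool" where
  "trivial_pair f fh \<longleftrightarrow> (\<exists>T. moebius T \<and> (\<forall>p. fh p = T (f p)))"

definition dz ::
  "(complex \<Rightarrow> (complex, 'n::finite) mink_vec) \<Rightarrow> complex \<Rightarrow> (complex, 'n) mink_vec" where
  "dz F \<zeta> = (1/2) *\<^sub>C (frechet_derivative F (at \<zeta>) 1 - \<i> *\<^sub>C frechet_derivative F (at \<zeta>) \<i>)"

definition dzbar ::
  "(complex \<Rightarrow> (complex, 'n::finite) mink_vec) \<Rightarrow> complex \<Rightarrow> (complex, 'n) mink_vec" where
  "dzbar F \<zeta> = (1/2) *\<^sub>C (frechet_derivative F (at \<zeta>) 1 + \<i> *\<^sub>C frechet_derivative F (at \<zeta>) \<i>)"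

text \<open>All objects along a surface are expressed in a coordinate \<open>z\<close> on \<open>V\<close>, hence are functions
  on the plane of which only the values on \<open>z ` V\<close> matter. Given that \<open>Y\<close> is real, the last two
  equations say that the metric induced by \<open>Y\<close> is \<open>|dz|\<^sup>2\<close>.\<close>

definition canonical_lift ::
  "('m \<Rightarrow> real^('n::finite)) \<Rightarrow> 'm set \<Rightarrow> ('m \<Rightarrow> complex) \<Rightarrow> (complex \<Rightarrow> (real, 'n) mink_vec) \<Rightarrow> bool" where
  "canonical_lift f V z Y \<longleftrightarrow>
     smooth_on (z ` V) Y \<and>
     (\<forall>p\<in>V. \<exists>l>0. Y (z p) = l *\<^sub>R (f p, 1)) \<and>
     (\<forall>\<zeta>\<in>z ` V. mink (dz (cpx \<circ> Y) \<zeta>) (dz (cpx \<circ> Y) \<zeta>) = 0 \<and>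
                mink (dz (cpx \<circ> Y) \<zeta>) (dzbar (cpx \<circ> Y) \<zeta>) = 1/2)"

definition VC :: "(complex \<Rightarrow> (real, 'n::finite) mink_vec) \<Rightarrow> complex \<Rightarrow> ((complex, 'n) mink_vec) set" where
  "VC Y \<zeta> = {a *\<^sub>C cpx (Y \<zeta>) + b *\<^sub>C dz (cpx \<circ> Y) \<zeta> + c *\<^sub>C dzbar (cpx \<circ> Y) \<zeta>
              + d *\<^sub>C dzbar (dz (cpx \<circ> Y)) \<zeta> | a b c d. True}"

definition VC_perp ::
  "(complex \<Rightarrow> (real, 'n::finite) mink_vec) \<Rightarrow> complex \<Rightarrow> ((complex, 'n) mink_vec) set" where
  "VC_perp Y \<zeta> = {w. \<forall>v\<in>VC Y \<zeta>. mink w v = 0}"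

definition proj_perp ::
  "(complex \<Rightarrow> (real, 'n::finite) mink_vec) \<Rightarrow> complex \<Rightarrow> (complex, 'n) mink_vec \<Rightarrow> (complex, 'n) mink_vec" where
  "proj_perp Y \<zeta> w = (THE u. u \<in> VC_perp Y \<zeta> \<and> w - u \<in> VC Y \<zeta>)"

definition Dzbar ::
  "(complex \<Rightarrow> (real, 'n::finite) mink_vec) \<Rightarrow> (complex \<Rightarrow> (complex, 'n) mink_vec) \<Rightarrow>
     complex \<Rightarrow> (complex, 'n) mink_vec" where
  "Dzbar Y \<psi> \<zeta> = proj_perp Y \<zeta> (dzbar \<psi> \<zeta>)"

text \<open>\<open>s\<close> and \<open>\<kappa>\<close> are the Schwarzian and the Hopf differential of \<open>f\<close> with respect to \<open>z\<close>. For a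
  conformal immersion and every coordinate on \<open>V\<close> there are such \<open>Y\<close>, \<open>s\<close>, \<open>\<kappa>\<close>, and their values
  on \<open>z ` V\<close> are unique.\<close>

definition lift_data ::
  "('m::t2_space) atlas \<Rightarrow> ('m \<Rightarrow> real^('n::finite)) \<Rightarrow> 'm set \<Rightarrow> ('m \<Rightarrow> complex) \<Rightarrow>
     (complex \<Rightarrow> (real, 'n) mink_vec) \<Rightarrow> (complex \<Rightarrow> complex) \<Rightarrow> (complex \<Rightarrow> (complex, 'n) mink_vec) \<Rightarrow> bool" where
  "lift_data A f V z Y s \<kappa> \<longleftrightarrow>
     coordinate A V z \<and> canonical_lift f V z Y \<and>
     (\<forall>\<zeta>\<in>z ` V. \<kappa> \<zeta> \<in> VC_perp Y \<zeta> \<and>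
        dz (dz (cpx \<circ> Y)) \<zeta> + (s \<zeta> / 2) *\<^sub>C cpx (Y \<zeta>) = \<kappa> \<zeta>)"

definition is_N :: "(complex \<Rightarrow> (real, 'n::finite) mink_vec) \<Rightarrow> complex \<Rightarrow> (real, 'n) mink_vec \<Rightarrow> bool" where
  "is_N Y \<zeta> N \<longleftrightarrow> cpx N \<in> VC Y \<zeta> \<and> mink N N = 0 \<and> mink N (Y \<zeta>) = -1 \<and>
     mink (cpx N) (dz (cpx \<circ> Y) \<zeta>) = 0"

subsection \<open>The two classes of pairs\<close>

definition darboux_pair_on ::
  "('m::t2_space) atlas \<Rightarrow> ('m \<Rightarrow> real^('n::finite)) \<Rightarrow> ('m \<Rightarrow> real^'n) \<Rightarrow> 'm set \<Rightarrow> bool" where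
  "darboux_pair_on A f fh U \<longleftrightarrow>
     immersion_on A U f \<and> immersion_on A U fh \<and>
     (\<exists>S. sphere_congruence_on A U S \<and> envelops_on A U f S \<and> envelops_on A U fh S) \<and>
     induces_conformal_structure_on A U f \<and> induces_conformal_structure_on A U fh \<and>
     (\<forall>p\<in>U. \<exists>V z Y s \<kappa> Yh sh \<kappa>h. p \<in> V \<and> V \<subseteq> U \<and>
        lift_data A f V z Y s \<kappa> \<and> lift_data A fh V z Yh sh \<kappa>h \<and>
        (\<forall>\<zeta>\<in>z ` V. \<kappa> \<zeta> \<in> range cpx \<and> \<kappa>h \<zeta> \<in> range cpx))"

definition willmore_on ::
  "('m::t2_space) atlas \<Rightarrow> ('m \<Rightarrow> real^('n::finite)) \<Rightarrow> 'm set \<Rightarrow> bool" where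
  "willmore_on A f U \<longleftrightarrow>
     (\<forall>V z Y s \<kappa>. V \<subseteq> U \<longrightarrow> lift_data A f V z Y s \<kappa> \<longrightarrow>
        (\<forall>\<zeta>\<in>z ` V. Dzbar Y (Dzbar Y \<kappa>) \<zeta> + (cnj (s \<zeta>) / 2) *\<^sub>C \<kappa> \<zeta> = 0))"

definition s_willmore_on ::
  "('m::t2_space) atlas \<Rightarrow> ('m \<Rightarrow> real^('n::finite)) \<Rightarrow> 'm set \<Rightarrow> bool" where
  "s_willmore_on A f U \<longleftrightarrow>
     willmore_on A f U \<and>
     (\<forall>V z Y s \<kappa>. V \<subseteq> U \<longrightarrow> lift_data A f V z Y s \<kappa> \<longrightarrow>
        (\<forall>\<zeta>\<in>z ` V. \<exists>a b. (a, b) \<noteq> (0, 0) \<and> a *\<^sub>C \<kappa> \<zeta> + b *\<^sub>C Dzbar Y \<kappa> \<zeta> = 0))"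

definition dual_surface_on ::
  "('m::t2_space) atlas \<Rightarrow> ('m \<Rightarrow> real^('n::finite)) \<Rightarrow> ('m \<Rightarrow> real^'n) \<Rightarrow> 'm set \<Rightarrow> bool" where
  "dual_surface_on A f fh U \<longleftrightarrow>
     (\<forall>p\<in>U. \<exists>V z Y s \<kappa> N (\<mu> :: complex \<Rightarrow> complex). p \<in> V \<and> V \<subseteq> U \<and>
        lift_data A f V z Y s \<kappa> \<and>
        (\<forall>\<zeta>\<in>z ` V. is_N Y \<zeta> (N \<zeta>) \<and> Dzbar Y \<kappa> \<zeta> + (cnj (\<mu> \<zeta>) / 2) *\<^sub>C \<kappa> \<zeta> = 0) \<and>
        (\<forall>q\<in>V. \<exists>c::real. c \<noteq> 0 \<and>
           complex_of_real ((cmod (\<mu> (z q)))\<^sup>2 / 2) *\<^sub>C cpx (Y (z q))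
             + cnj (\<mu> (z q)) *\<^sub>C dz (cpx \<circ> Y) (z q) + \<mu> (z q) *\<^sub>C dzbar (cpx \<circ> Y) (z q)
             + cpx (N (z q))
           = cpx (c *\<^sub>R (fh q, 1))))"

end

theory Submission
  imports Defs "HOL-Complex_Analysis.Complex_Analysis"
begin

text \<open>Let \<open>Y\<close> be the canonical lift of \<open>f\<close> in a coordinate \<open>z\<close>, let \<open>Z\<close> be the lift of the second
  surface with \<open>\<langle>Y, Z\<rangle> = -1\<close>, and put \<open>\<mu> = 2 \<langle>Y\<^sub>z, Z\<rangle>\<close> and \<open>P = Y\<^sub>z + (\<mu>/2) Y\<close>. Since both surfaces envelop
  the same spheres, \<open>Z\<^sub>z = (\<mu>/2) Z + \<rho> P + \<theta> Q\<close> with \<open>Q\<close> the conjugate of \<open>P\<close>. Conformality of the second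
  surface means \<open>\<rho> \<theta> = 0\<close>, and exactly one of \<open>\<rho>\<close>, \<open>\<theta>\<close> is nonzero because it is immersed; as the surface
  is connected, the same one is nonzero everywhere. All further equations express that the mixed second
  derivatives of \<open>Y\<close> and \<open>Z\<close> are real.

  If \<open>\<rho> = 0\<close>, then \<open>\<theta> dz\<^sup>2\<close> is a holomorphic quadratic differential without zeros. In a coordinate in which
  \<open>\<theta> = 1\<close>, both Hopf differentials are real: this is a Darboux pair.

  If \<open>\<theta> = 0\<close>, then at each point either \<open>\<rho>\<close> is real or the sphere is the central sphere of \<open>f\<close>. The
  imaginary part of \<open>\<rho>\<close> solves a linear elliptic first-order system, so by a Carleman estimate it vanishes
  identically as soon as it vanishes on an open set. If it does vanish identically, \<open>\<rho> Y - Z\<close> spans a fixed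
  line, and the reflection in it maps \<open>f\<close> to the second surface: the pair is trivial. Otherwise the spheres are
  central on a dense set, hence everywhere, and the second surface is a dual of the S-Willmore surface \<open>f\<close>.

  The reflection of the ambient Euclidean space exchanging the two points of contact maps one tangent plane of
  the sphere to the other and reverses the orientation of the sphere; relative to it, \<open>\<rho>\<close> and \<open>\<theta>\<close> are the complex
  linear and antilinear parts of the correspondence.\<close>

subsection \<open>Calculus of smooth maps\<close>

text \<open>Smooth surfaces need not be analytic, so a pair could a priori be trivial over one open
  set and dual over another; excluding this mixture is what forces a unique continuation theorem.
  The equation for the imaginary part of \<open>rho\<close> contains the derivative of
  \<open>rho\<close>, so a combination with that derivative becomes a second unknown. After this, a
  pointwise bound of the antiholomorphic derivatives by the unknowns is all that the estimate needs.

  Real \<open>rho\<close> or a central sphere: if \<open>theta = 0\<close>, the mixed second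
  derivative of Z equals \<open>rho\<close> times that of Y modulo the Minkowski space of the
  sphere, and both derivatives are real.

  Frames depend on the coordinate. A coordinate change with derivative c multiplies
  \<open>rho\<close> by |c|^2 and \<open>theta\<close> by c^2. Vanishing of either one and reality
  of \<open>rho\<close> are therefore properties of points of the surface, connectedness applies to
  them, and every conclusion is reached on the whole surface. The mirror of the trivial case is
  likewise constant on the whole surface, which matches the global notion
  \<open>trivial_pair\<close>.\<close>

lemma frechet_derivative_cong_open:
  assumes "open T" "x \<in> T" "\<And>y. y \<in> T \<Longrightarrow> f y = g y"
  shows "frechet_derivative f (at x) = frechet_derivative g (at x)"
proof -
  have "(f has_derivative D) (at x) \<longleftrightarrow> (g has_derivative D) (at x)" for D
    using has_derivative_transform_within_open[OF _ assms(1,2)] assms(3) by metis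
  then show ?thesis
    unfolding frechet_derivative_def by simp
qed

lemma Ck_on_cong:
  assumes "open T" "\<And>x. x \<in> T \<Longrightarrow> f x = g x" "Ck_on k T f"
  shows "Ck_on k T g"
  using assms(2,3)
proof (induction k arbitrary: f g)
  case 0
  then show ?case by (simp cong: continuous_on_cong)
next
  case (Suc k)
  have "g differentiable (at x)" if "x \<in> T" for x
  proof -
    have "(f has_derivative frechet_derivative f (at x)) (at x)"
      using Suc.prems(2) that frechet_derivative_works by auto
    from has_derivative_transform_within_open[OF this assms(1) that] Suc.prems(1)
    show ?thesis by (auto simp: differentiable_def)
  qed
  moreover have "Ck_on k T (\<lambda>x. frechet_derivative g (at x) v)" for v
    by (rule Suc.IH[of "\<lambda>x. frechet_derivative f (at x) v"])
      (use Suc.prems frechet_derivative_cong_open[OF assms(1) _ Suc.prems(1)] in auto)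
  ultimately show ?case by simp
qed

text \<open>Admits an explicit derivative \<open>g'\<close> in place of the term
  \<open>frechet_derivative\<close>; the closure properties below are proved through it by induction
  on the order.\<close>

lemma Ck_on_SucI:
  assumes "open T" "\<And>x. x \<in> T \<Longrightarrow> (g has_derivative g' x) (at x)"
    "\<And>v. Ck_on k T (\<lambda>x. g' x v)"
  shows "Ck_on (Suc k) T g"
proof -
  have "frechet_derivative g (at x) = g' x" if "x \<in> T" for x
    using frechet_derivative_at[OF assms(2)[OF that]] by simp
  then have "Ck_on k T (\<lambda>x. frechet_derivative g (at x) v)" for v
    by (intro Ck_on_cong[OF assms(1) _ assms(3)[of v]]) auto
  then show ?thesis
    using assms(2) by (auto simp: differentiable_def)
qed

lemma Ck_on_SucD:
  assumes "Ck_on (Suc k) T g"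
  shows "Ck_on k T g"
  using assms
proof (induction k arbitrary: g)
  case 0
  then show ?case
    by (auto intro!: differentiable_imp_continuous_on
        simp: differentiable_on_def differentiable_at_withinI)
qed auto

lemma Ck_on_Suc_has_derivative:
  "Ck_on (Suc k) T g \<Longrightarrow> x \<in> T \<Longrightarrow> (g has_derivative frechet_derivative g (at x)) (at x)"
  using frechet_derivative_works by auto

lemma Ck_on_subset:
  assumes "Ck_on k T g" "S \<subseteq> T"
  shows "Ck_on k S g"
  using assms(1)
  by (induction k arbitrary: g) (use assms(2) in \<open>auto intro: continuous_on_subset\<close>)

text \<open>Needed because a map read in an arbitrary coordinate is known to be smooth only chart by
  chart.\<close>

lemma Ck_on_local:
  assumes "\<And>x. x \<in> T \<Longrightarrow> \<exists>S. open S \<and> x \<in> S \<and> Ck_on k S g"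
  shows "Ck_on k T g"
  using assms
proof (induction k arbitrary: g)
  case 0
  have "continuous (at x) g" if "x \<in> T" for x
    using 0[OF that] by (auto simp: continuous_on_eq_continuous_at)
  then show ?case
    by (simp add: continuous_at_imp_continuous_on)
next
  case (Suc k)
  have "g differentiable (at x)" if "x \<in> T" for x
    using Suc.prems[OF that] by auto
  moreover have "Ck_on k T (\<lambda>x. frechet_derivative g (at x) v)" for v
    by (rule Suc.IH) (use Suc.prems in fastforce)
  ultimately show ?case by simp
qed

lemma Ck_on_const: "open T \<Longrightarrow> Ck_on k T (\<lambda>x. c)"
proof (induction k arbitrary: c)
  case (Suc k)
  then show ?case
    by (intro Ck_on_SucI[where g' = "\<lambda>x v. 0"]) auto
qed auto

lemma Ck_on_bounded_linear:
  assumes L: "bounded_linear L" and "open T" "Ck_on k T g"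
  shows "Ck_on k T (\<lambda>x. L (g x))"
  using assms(3)
proof (induction k arbitrary: g)
  case 0
  then show ?case
    using bounded_linear.continuous_on[OF L] by auto
next
  case (Suc k)
  show ?case
    by (rule Ck_on_SucI[OF \<open>open T\<close> bounded_linear.has_derivative[OF L Ck_on_Suc_has_derivative]])
      (use Suc in auto)
qed

lemma Ck_on_add:
  assumes "open T" "Ck_on k T f" "Ck_on k T g"
  shows "Ck_on k T (\<lambda>x. f x + g x)"
  using assms(2,3)
proof (induction k arbitrary: f g)
  case 0
  then show ?case by (auto intro: continuous_intros)
next
  case (Suc k)
  show ?case
    by (rule Ck_on_SucI[OF \<open>open T\<close> has_derivative_add[OF Ck_on_Suc_has_derivative
            Ck_on_Suc_has_derivative]])
      (use Suc in auto)
qed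

lemma Ck_on_bounded_bilinear:
  assumes B: "bounded_bilinear B" and "open T" "Ck_on k T f" "Ck_on k T g"
  shows "Ck_on k T (\<lambda>x. B (f x) (g x))"
  using assms(3,4)
proof (induction k arbitrary: f g)
  case 0
  then show ?case using bounded_bilinear.continuous_on[OF B] by auto
next
  case (Suc k)
  have "Ck_on k T f" "Ck_on k T g"
    using Suc.prems[THEN Ck_on_SucD] .
  then show ?case
    by (intro Ck_on_SucI[OF \<open>open T\<close> bounded_bilinear.FDERIV[OF B Ck_on_Suc_has_derivative
            Ck_on_Suc_has_derivative]] Ck_on_add[OF \<open>open T\<close>] Suc.IH)
      (use Suc.prems in auto)
qed

text \<open>The derivative of the inverse is a product of inverses with the derivative of
  \<open>g\<close>, so order k of the inverse itself yields order k + 1. The square root and the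
  exponential are treated the same way.\<close>

lemma Ck_on_inverse:
  fixes g :: "'a::real_normed_vector \<Rightarrow> real"
  assumes "open T" "Ck_on k T g" "\<And>x. x \<in> T \<Longrightarrow> g x \<noteq> 0"
  shows "Ck_on k T (\<lambda>x. inverse (g x))"
  using assms(2)
proof (induction k)
  case 0
  then show ?case using assms(3) by (auto intro!: continuous_intros)
next
  case (Suc k)
  have I: "Ck_on k T (\<lambda>x. inverse (g x))"
    by (rule Suc.IH[OF Ck_on_SucD[OF Suc.prems]])
  have "Ck_on k T (\<lambda>x. - (inverse (g x) * frechet_derivative g (at x) v * inverse (g x)))" for v
    using Ck_on_bounded_linear[OF bounded_linear_minus[OF bounded_linear_ident] \<open>open T\<close>
        Ck_on_bounded_bilinear[OF bounded_bilinear_mult \<open>open T\<close>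
          Ck_on_bounded_bilinear[OF bounded_bilinear_mult \<open>open T\<close> I] I]] Suc.prems
    by simp
  moreover have "((\<lambda>x. inverse (g x)) has_derivative
      (\<lambda>v. - (inverse (g x) * frechet_derivative g (at x) v * inverse (g x)))) (at x)"
    if "x \<in> T" for x
    using Deriv.has_derivative_inverse[OF assms(3)[OF that] Ck_on_Suc_has_derivative[OF Suc.prems that]] .
  ultimately show ?case
    by (intro Ck_on_SucI[OF \<open>open T\<close>])
qed

lemma Ck_on_sqrt:
  assumes "open T" "Ck_on k T g" "\<And>x. x \<in> T \<Longrightarrow> g x > 0"
  shows "Ck_on k T (\<lambda>x. sqrt (g x))"
  using assms(2)
proof (induction k)
  case 0
  then show ?case by (auto intro!: continuous_intros)
next
  case (Suc k)
  have I: "Ck_on k T (\<lambda>x. sqrt (g x))"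
    by (rule Suc.IH[OF Ck_on_SucD[OF Suc.prems]])
  have pos: "sqrt (g x) \<noteq> 0" if "x \<in> T" for x
    using assms(3)[OF that] by simp
  have 1: "Ck_on k T (\<lambda>x. frechet_derivative g (at x) v * (inverse (sqrt (g x)) * (1/2)))" for v
    using Ck_on_bounded_bilinear[OF bounded_bilinear_mult \<open>open T\<close> _
        Ck_on_bounded_bilinear[OF bounded_bilinear_mult \<open>open T\<close>
          Ck_on_inverse[OF \<open>open T\<close> I pos] Ck_on_const[OF \<open>open T\<close>]],
        of "\<lambda>x. frechet_derivative g (at x) v" "1/2"] Suc.prems
    by simp
  have 2: "((\<lambda>x. sqrt (g x)) has_derivative
      (\<lambda>v. frechet_derivative g (at x) v * (inverse (sqrt (g x)) * (1/2)))) (at x)"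
    if "x \<in> T" for x
    using has_derivative_real_sqrt[OF assms(3)[OF that]
        Ck_on_Suc_has_derivative[OF Suc.prems that]]
    by (simp add: field_simps)
  show ?case
    by (rule Ck_on_SucI[OF \<open>open T\<close> 2 1])
qed

lemma Ck_on_holomorphic:
  assumes "open T" "h holomorphic_on T"
  shows "Ck_on k T h"
  using assms(2)
proof (induction k arbitrary: h)
  case 0
  then show ?case by (simp add: holomorphic_on_imp_continuous_on)
next
  case (Suc k)
  have "(h has_derivative (\<lambda>v. deriv h x * v)) (at x)" if "x \<in> T" for x
    using holomorphic_derivI[OF Suc.prems \<open>open T\<close> that] by (simp add: has_field_derivative_def)
  moreover have "Ck_on k T (\<lambda>x. deriv h x * v)" for v
    by (rule Suc.IH) (intro holomorphic_intros holomorphic_deriv Suc.prems \<open>open T\<close>)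
  ultimately show ?case
    by (rule Ck_on_SucI[OF \<open>open T\<close>])
qed

lemma has_derivative_compose_holomorphic:
  fixes g :: "complex \<Rightarrow> 'b::real_normed_vector"
  assumes "(h has_field_derivative c) (at x)" "(g has_derivative g') (at (h x))"
  shows "((\<lambda>x. g (h x)) has_derivative (\<lambda>v. g' (c * v))) (at x)"
  using diff_chain_at[OF assms(1)[unfolded has_field_derivative_def] assms(2)]
  by (simp add: o_def)

lemma linear_complex_expand:
  assumes "linear (l :: complex \<Rightarrow> 'b::real_vector)"
  shows "l v = Re v *\<^sub>R l 1 + Im v *\<^sub>R l \<i>"
proof -
  have "l (Re v *\<^sub>R 1 + Im v *\<^sub>R \<i>) = Re v *\<^sub>R l 1 + Im v *\<^sub>R l \<i>"
    by (simp add: linear_add[OF assms] linear_scale[OF assms])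
  moreover have "Re v *\<^sub>R 1 + Im v *\<^sub>R \<i> = v"
    by (simp add: complex_eq_iff)
  ultimately show ?thesis
    by (simp only:)
qed

text \<open>The chain rule evaluates the derivative of \<open>g\<close> in the direction
  \<open>deriv h x * v\<close>, which moves with x, whereas \<open>Ck_on\<close> speaks of fixed
  directions. Expanding over the real basis 1, \<i> leaves two fixed directions with smooth
  coefficients.\<close>

lemma Ck_on_compose_holomorphic:
  fixes g :: "complex \<Rightarrow> 'b::real_normed_vector"
  assumes S: "open S" "h holomorphic_on S" "\<And>x. x \<in> S \<Longrightarrow> h x \<in> T" and g: "Ck_on k T g"
  shows "Ck_on k S (\<lambda>x. g (h x))"
  using g
proof (induction k arbitrary: g)
  case 0
  then show ?case
    using holomorphic_on_imp_continuous_on[OF S(2)] S(3)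
    by (auto intro: continuous_on_compose2[where g = g])
next
  case (Suc k)
  let ?D = "\<lambda>x. frechet_derivative g (at (h x))"
  have h: "(h has_field_derivative deriv h x) (at x)" if "x \<in> S" for x
    using holomorphic_derivI[OF S(2,1) that] .
  have lin: "linear (?D x)" if "x \<in> S" for x
    using Ck_on_Suc_has_derivative[OF Suc.prems S(3)[OF that]] has_derivative_linear by blast
  have d: "((\<lambda>x. g (h x)) has_derivative (\<lambda>v. ?D x (deriv h x * v))) (at x)" if "x \<in> S" for x
    using has_derivative_compose_holomorphic[OF h Ck_on_Suc_has_derivative[OF Suc.prems]] that S(3)
    by blast
  have dh: "Ck_on k S (\<lambda>x. deriv h x * v)" for v
    by (rule Ck_on_holomorphic[OF S(1)]) (intro holomorphic_intros holomorphic_deriv S)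
  have D: "Ck_on k S (\<lambda>x. ?D x w)" for w
    using Suc by auto
  have "Ck_on k S (\<lambda>x. ?D x (deriv h x * v))" for v
  proof (rule Ck_on_cong[OF S(1)])
    show "Ck_on k S (\<lambda>x. Re (deriv h x * v) *\<^sub>R ?D x 1 + Im (deriv h x * v) *\<^sub>R ?D x \<i>)"
      by (intro Ck_on_add S Ck_on_bounded_bilinear[OF bounded_bilinear_scaleR] D
          Ck_on_bounded_linear[OF bounded_linear_Re] Ck_on_bounded_linear[OF bounded_linear_Im] dh)
  qed (rule linear_complex_expand[OF lin, symmetric])
  with d show ?case
    by (rule Ck_on_SucI[OF S(1)])
qed

section \<open>Closure properties of smooth functions\<close>

named_theorems smooth_intros

lemma smooth_on_const [smooth_intros]: "open T \<Longrightarrow> smooth_on T (\<lambda>x. c)"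
  by (simp add: smooth_on_def Ck_on_const)

lemma smooth_on_bounded_linear:
  "bounded_linear L \<Longrightarrow> open T \<Longrightarrow> smooth_on T g \<Longrightarrow> smooth_on T (\<lambda>x. L (g x))"
  by (simp add: smooth_on_def Ck_on_bounded_linear)

lemma smooth_on_bounded_bilinear:
  "bounded_bilinear B \<Longrightarrow> open T \<Longrightarrow> smooth_on T f \<Longrightarrow> smooth_on T g \<Longrightarrow> smooth_on T (\<lambda>x. B (f x) (g x))"
  by (simp add: smooth_on_def Ck_on_bounded_bilinear)

lemma smooth_on_add [smooth_intros]:
  "open T \<Longrightarrow> smooth_on T f \<Longrightarrow> smooth_on T g \<Longrightarrow> smooth_on T (\<lambda>x. f x + g x)"
  by (simp add: smooth_on_def Ck_on_add)

lemmas smooth_on_minus [smooth_intros] =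
  smooth_on_bounded_linear[OF bounded_linear_minus[OF bounded_linear_ident]]
lemmas smooth_on_Re [smooth_intros] = smooth_on_bounded_linear[OF bounded_linear_Re]
lemmas smooth_on_Im [smooth_intros] = smooth_on_bounded_linear[OF bounded_linear_Im]
lemmas smooth_on_cnj [smooth_intros] = smooth_on_bounded_linear[OF bounded_linear_cnj]
lemmas smooth_on_of_real [smooth_intros] = smooth_on_bounded_linear[OF bounded_linear_of_real]
lemmas smooth_on_snd [smooth_intros] = smooth_on_bounded_linear[OF bounded_linear_snd]
lemmas smooth_on_mult [smooth_intros] = smooth_on_bounded_bilinear[OF bounded_bilinear_mult]
lemmas smooth_on_scaleR [smooth_intros] = smooth_on_bounded_bilinear[OF bounded_bilinear_scaleR]
lemmas smooth_on_inner [smooth_intros] = smooth_on_bounded_bilinear[OF bounded_bilinear_inner]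

lemma smooth_on_diff [smooth_intros]:
  "open T \<Longrightarrow> smooth_on T f \<Longrightarrow> smooth_on T g \<Longrightarrow> smooth_on T (\<lambda>x. f x - g x)"
  using smooth_on_add[OF _ _ smooth_on_minus, of T f g] by simp

lemma smooth_on_inverse [smooth_intros]:
  fixes g :: "'a::real_normed_vector \<Rightarrow> real"
  shows "open T \<Longrightarrow> smooth_on T g \<Longrightarrow> (\<And>x. x \<in> T \<Longrightarrow> g x \<noteq> 0) \<Longrightarrow> smooth_on T (\<lambda>x. inverse (g x))"
  by (simp add: smooth_on_def Ck_on_inverse)

lemma smooth_on_sqrt [smooth_intros]:
  "open T \<Longrightarrow> smooth_on T g \<Longrightarrow> (\<And>x. x \<in> T \<Longrightarrow> g x > 0) \<Longrightarrow> smooth_on T (\<lambda>x. sqrt (g x))"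
  by (simp add: smooth_on_def Ck_on_sqrt)

lemma smooth_on_Pair [smooth_intros]:
  assumes "open T" "smooth_on T f" "smooth_on T g"
  shows "smooth_on T (\<lambda>x. (f x, g x))"
proof -
  have "bounded_linear (\<lambda>x::'b. (x, 0::'c))" "bounded_linear (\<lambda>x::'c. (0::'b, x))"
    by (intro bounded_linear_Pair bounded_linear_ident bounded_linear_zero)+
  from smooth_on_add[OF assms(1) smooth_on_bounded_linear[OF this(1) assms(1,2)]
      smooth_on_bounded_linear[OF this(2) assms(1,3)]]
  show ?thesis by simp
qed

lemma smooth_on_compose_holomorphic:
  fixes g :: "complex \<Rightarrow> 'b::real_normed_vector"
  assumes "open S" "h holomorphic_on S" "\<And>x. x \<in> S \<Longrightarrow> h x \<in> T" "smooth_on T g"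
  shows "smooth_on S (\<lambda>x. g (h x))"
  using assms Ck_on_compose_holomorphic[of S h T] unfolding smooth_on_def by blast

lemma smooth_on_holomorphic: "open T \<Longrightarrow> h holomorphic_on T \<Longrightarrow> smooth_on T h"
  by (simp add: smooth_on_def Ck_on_holomorphic)

lemma smooth_on_cong:
  "open T \<Longrightarrow> (\<And>x. x \<in> T \<Longrightarrow> f x = g x) \<Longrightarrow> smooth_on T f \<Longrightarrow> smooth_on T g"
  unfolding smooth_on_def using Ck_on_cong by metis

lemma smooth_on_subset: "smooth_on T g \<Longrightarrow> S \<subseteq> T \<Longrightarrow> smooth_on S g"
  unfolding smooth_on_def using Ck_on_subset by metis

lemma smooth_on_local:
  assumes "\<And>x. x \<in> T \<Longrightarrow> \<exists>S. open S \<and> x \<in> S \<and> smooth_on S g"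
  shows "smooth_on T g"
  using assms unfolding smooth_on_def by (meson Ck_on_local)

lemma smooth_on_imp_Ck_on: "smooth_on T g \<Longrightarrow> Ck_on k T g"
  by (simp add: smooth_on_def)

lemma smooth_on_has_derivative:
  "smooth_on T g \<Longrightarrow> x \<in> T \<Longrightarrow> (g has_derivative frechet_derivative g (at x)) (at x)"
  using Ck_on_Suc_has_derivative smooth_on_imp_Ck_on by blast

lemma smooth_on_imp_differentiable: "smooth_on T g \<Longrightarrow> x \<in> T \<Longrightarrow> g differentiable (at x)"
  using smooth_on_has_derivative differentiable_def by blast

lemma smooth_on_imp_continuous_on: "smooth_on T g \<Longrightarrow> continuous_on T g"
  using smooth_on_imp_Ck_on[of T g 0] by simp

lemma smooth_on_frechet_derivative [smooth_intros]:
  "smooth_on T g \<Longrightarrow> smooth_on T (\<lambda>x. frechet_derivative g (at x) v)"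
  unfolding smooth_on_def by (metis Ck_on.simps(2))

subsection \<open>Integration over squares and the symmetry of second derivatives\<close>

definition square :: "real \<Rightarrow> (real \<times> real) set" where
  "square h = cbox (- h, - h) (h, h)"

text \<open>Real coordinates around the centre a, so that iterated integrals over a product of
  intervals apply to functions of a complex variable.\<close>

definition on_plane :: "complex \<Rightarrow> real \<times> real \<Rightarrow> complex" where
  "on_plane a p = a + Complex (fst p) (snd p)"

definition csquare :: "complex \<Rightarrow> real \<Rightarrow> complex set" where
  "csquare a h = on_plane a ` square h"

lemma mem_square: "(x, y) \<in> square h \<longleftrightarrow> \<bar>x\<bar> \<le> h \<and> \<bar>y\<bar> \<le> h"
  by (auto simp: square_def cbox_Pair_eq)

lemma mem_csquare: "\<zeta> \<in> csquare a h \<longleftrightarrow> \<bar>Re (\<zeta> - a)\<bar> \<le> h \<and> \<bar>Im (\<zeta> - a)\<bar> \<le> h"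
proof
  assume R: "\<bar>Re (\<zeta> - a)\<bar> \<le> h \<and> \<bar>Im (\<zeta> - a)\<bar> \<le> h"
  have "\<zeta> = on_plane a (Re (\<zeta> - a), Im (\<zeta> - a))"
    by (simp add: on_plane_def complex_eq_iff)
  with R show "\<zeta> \<in> csquare a h"
    unfolding csquare_def by (metis image_eqI mem_square)
qed (auto simp: csquare_def on_plane_def mem_square)

lemma continuous_on_on_plane: "continuous_on T (on_plane a)"
  unfolding on_plane_def Complex_eq by (intro continuous_intros)

lemma compact_csquare: "compact (csquare a h)"
  unfolding csquare_def square_def
  by (intro compact_continuous_image compact_cbox continuous_on_on_plane)

lemma continuous_on_square:
  "continuous_on (csquare a h) g \<Longrightarrow> continuous_on (square h) (\<lambda>p. g (on_plane a p))"
  by (rule continuous_on_compose2[OF _ continuous_on_on_plane]) (auto simp: csquare_def)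

lemma integrable_on_square:
  fixes g :: "complex \<Rightarrow> 'b::euclidean_space"
  shows "continuous_on (csquare a h) g \<Longrightarrow> (\<lambda>p. g (on_plane a p)) integrable_on square h"
  using continuous_on_square unfolding square_def by (intro integrable_continuous) auto

lemma on_plane_x_derivative:
  assumes "(g has_derivative g') (at (on_plane a (x, y)))"
  shows "((\<lambda>x. g (on_plane a (x, y))) has_vector_derivative g' 1) (at x within T)"
proof -
  have "((\<lambda>x. on_plane a (x, y)) has_derivative (\<lambda>v. v *\<^sub>R 1)) (at x)"
    unfolding on_plane_def Complex_eq by (auto intro!: derivative_eq_intros simp: scaleR_conv_of_real)
  from diff_chain_at[OF this assms] show ?thesis
    using has_derivative_linear[OF assms]
    by (auto simp: has_vector_derivative_def o_def linear_scale intro: has_derivative_at_withinI)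
qed

lemma on_plane_y_derivative:
  assumes "(g has_derivative g') (at (on_plane a (x, y)))"
  shows "((\<lambda>y. g (on_plane a (x, y))) has_vector_derivative g' \<i>) (at y within T)"
proof -
  have "((\<lambda>y. on_plane a (x, y)) has_derivative (\<lambda>v. v *\<^sub>R \<i>)) (at y)"
    unfolding on_plane_def Complex_eq by (auto intro!: derivative_eq_intros simp: scaleR_conv_of_real)
  from diff_chain_at[OF this assms] show ?thesis
    using has_derivative_linear[OF assms]
    by (auto simp: has_vector_derivative_def o_def linear_scale intro: has_derivative_at_withinI)
qed

lemma on_plane_in_csquare: "\<bar>x\<bar> \<le> h \<Longrightarrow> \<bar>y\<bar> \<le> h \<Longrightarrow> on_plane a (x, y) \<in> csquare a h"
  by (auto simp: mem_csquare on_plane_def)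

lemma integral_square_Fubini:
  fixes g :: "complex \<Rightarrow> 'b::euclidean_space"
  assumes "continuous_on (csquare a h) g"
  shows "integral (square h) (\<lambda>p. g (on_plane a p)) =
      integral {-h..h} (\<lambda>x. integral {-h..h} (\<lambda>y. g (on_plane a (x, y))))" (is "_ = ?A")
    and "integral (square h) (\<lambda>p. g (on_plane a p)) =
      integral {-h..h} (\<lambda>y. integral {-h..h} (\<lambda>x. g (on_plane a (x, y))))" (is "_ = ?B")
proof -
  have c: "continuous_on (cbox (-h, -h) (h, h)) (\<lambda>p. g (on_plane a p))"
    using continuous_on_square[OF assms] by (simp add: square_def)
  then show 1: "integral (square h) (\<lambda>p. g (on_plane a p)) = ?A"
    using integral_prod_continuous[of "-h" "-h" h h "\<lambda>p. g (on_plane a p)"]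
    by (simp add: square_def cbox_interval)
  have "?A = ?B"
    using integral_swap_continuous[of "-h" "-h" h h "\<lambda>x y. g (on_plane a (x, y))"] c
    by (simp add: cbox_interval case_prod_beta')
  with 1 show "integral (square h) (\<lambda>p. g (on_plane a p)) = ?B" by simp
qed

lemma integral_square_dx:
  fixes g :: "complex \<Rightarrow> 'b::euclidean_space"
  assumes "0 \<le> h" and g: "\<And>\<zeta>. \<zeta> \<in> csquare a h \<Longrightarrow> (g has_derivative g' \<zeta>) (at \<zeta>)"
    and c: "continuous_on (csquare a h) (\<lambda>\<zeta>. g' \<zeta> 1)"
  shows "integral (square h) (\<lambda>p. g' (on_plane a p) 1) =
      integral {-h..h} (\<lambda>y. g (on_plane a (h, y)) - g (on_plane a (-h, y)))"
proof -
  have "((\<lambda>x. g' (on_plane a (x, y)) 1) has_integral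
       g (on_plane a (h, y)) - g (on_plane a (-h, y))) {-h..h}" if "y \<in> {-h..h}" for y
    using that \<open>0 \<le> h\<close>
    by (intro fundamental_theorem_of_calculus on_plane_x_derivative g on_plane_in_csquare) auto
  then have "integral {-h..h} (\<lambda>x. g' (on_plane a (x, y)) 1) =
       g (on_plane a (h, y)) - g (on_plane a (-h, y))" if "y \<in> {-h..h}" for y
    using that by (metis integral_unique)
  then show ?thesis
    using integral_square_Fubini(2)[OF c] by (auto intro: integral_cong)
qed

lemma integral_square_dy:
  fixes g :: "complex \<Rightarrow> 'b::euclidean_space"
  assumes "0 \<le> h" and g: "\<And>\<zeta>. \<zeta> \<in> csquare a h \<Longrightarrow> (g has_derivative g' \<zeta>) (at \<zeta>)"
    and c: "continuous_on (csquare a h) (\<lambda>\<zeta>. g' \<zeta> \<i>)"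
  shows "integral (square h) (\<lambda>p. g' (on_plane a p) \<i>) =
      integral {-h..h} (\<lambda>x. g (on_plane a (x, h)) - g (on_plane a (x, -h)))"
proof -
  have "((\<lambda>y. g' (on_plane a (x, y)) \<i>) has_integral
       g (on_plane a (x, h)) - g (on_plane a (x, -h))) {-h..h}" if "x \<in> {-h..h}" for x
    using that \<open>0 \<le> h\<close>
    by (intro fundamental_theorem_of_calculus on_plane_y_derivative g on_plane_in_csquare) auto
  then have "integral {-h..h} (\<lambda>y. g' (on_plane a (x, y)) \<i>) =
       g (on_plane a (x, h)) - g (on_plane a (x, -h))" if "x \<in> {-h..h}" for x
    using that by (metis integral_unique)
  then show ?thesis
    using integral_square_Fubini(1)[OF c] by (auto intro: integral_cong)
qed

lemma csquare_nhds:
  assumes "open T" "a \<in> T"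
  obtains h where "0 < h" "csquare a h \<subseteq> T"
proof -
  obtain e where e: "0 < e" "ball a e \<subseteq> T"
    using assms openE by blast
  have "csquare a (e/3) \<subseteq> ball a e"
  proof
    fix \<zeta> assume "\<zeta> \<in> csquare a (e/3)"
    then have "\<bar>Re (\<zeta> - a)\<bar> \<le> e/3" "\<bar>Im (\<zeta> - a)\<bar> \<le> e/3"
      by (auto simp: mem_csquare)
    then have "cmod (\<zeta> - a) < e"
      using cmod_le[of "\<zeta> - a"] e by linarith
    then show "\<zeta> \<in> ball a e"
      by (simp add: dist_norm norm_minus_commute)
  qed
  then show ?thesis
    using that[of "e/3"] e by auto
qed

text \<open>Over every small square around a both mixed derivatives have the same integral, the
  alternating sum of \<open>g\<close> over the four corners. A nonzero difference at a, paired with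
  its own value at a, would be positive on a whole square.\<close>

lemma second_derivative_symmetric:
  fixes g :: "complex \<Rightarrow> 'b::euclidean_space"
  assumes T: "open T" "a \<in> T" and g: "Ck_on 2 T g"
  shows "frechet_derivative (\<lambda>\<zeta>. frechet_derivative g (at \<zeta>) 1) (at a) \<i> =
         frechet_derivative (\<lambda>\<zeta>. frechet_derivative g (at \<zeta>) \<i>) (at a) 1"
proof (rule ccontr)
  define gx where "gx = (\<lambda>\<zeta>. frechet_derivative g (at \<zeta>) 1)"
  define gy where "gy = (\<lambda>\<zeta>. frechet_derivative g (at \<zeta>) \<i>)"
  define k where "k \<zeta> = frechet_derivative gx (at \<zeta>) \<i> - frechet_derivative gy (at \<zeta>) 1" for \<zeta>
  assume "\<not> ?thesis"
  then have "k a \<noteq> 0"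
    by (simp add: k_def gx_def gy_def)
  define q where "q \<zeta> = k \<zeta> \<bullet> k a" for \<zeta>
  have C1: "Ck_on (Suc 0) T gx" "Ck_on (Suc 0) T gy" "Ck_on (Suc 0) T g"
    using g Ck_on_SucD[of "Suc 0" T g] by (auto simp: numeral_2_eq_2 gx_def gy_def)
  have cont: "continuous_on T (\<lambda>\<zeta>. frechet_derivative gx (at \<zeta>) \<i>)"
    "continuous_on T (\<lambda>\<zeta>. frechet_derivative gy (at \<zeta>) 1)"
    using C1 by auto
  then have "continuous_on T k"
    unfolding k_def by (intro continuous_intros)
  then have cq: "continuous_on T q"
    unfolding q_def by (intro continuous_intros)
  have "q a > 0"
    using \<open>k a \<noteq> 0\<close> by (simp add: q_def)
  have "open (T \<inter> q -` {0<..})"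
    by (rule continuous_open_preimage[OF cq T(1)]) auto
  then obtain h where h: "0 < h" "csquare a h \<subseteq> T \<inter> q -` {0<..}"
    using csquare_nhds[of "T \<inter> q -` {0<..}" a] T \<open>q a > 0\<close> by auto
  then have sub: "csquare a h \<subseteq> T" and pos: "\<And>\<zeta>. \<zeta> \<in> csquare a h \<Longrightarrow> q \<zeta> > 0"
    by auto
  have fd: "(u has_derivative frechet_derivative u (at \<zeta>)) (at \<zeta>)"
    if "Ck_on (Suc 0) T u" "\<zeta> \<in> csquare a h" for u :: "complex \<Rightarrow> 'b" and \<zeta>
    using Ck_on_Suc_has_derivative[OF that(1)] that(2) sub by auto
  have cg: "continuous_on (csquare a h) gx" "continuous_on (csquare a h) gy"
    using C1(1,2)[THEN Ck_on_SucD] continuous_on_subset[OF _ sub] by auto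
  have hx: "((\<lambda>x. gx (on_plane a (x, y))) has_integral
       g (on_plane a (h, y)) - g (on_plane a (-h, y))) {-h..h}" if "y \<in> {-h..h}" for y
    using that h(1) unfolding gx_def
    by (intro fundamental_theorem_of_calculus
        on_plane_x_derivative[OF fd[OF C1(3) on_plane_in_csquare]]) auto
  have hy: "((\<lambda>y. gy (on_plane a (x, y))) has_integral
       g (on_plane a (x, h)) - g (on_plane a (x, -h))) {-h..h}" if "x \<in> {-h..h}" for x
    using that h(1) unfolding gy_def
    by (intro fundamental_theorem_of_calculus
        on_plane_y_derivative[OF fd[OF C1(3) on_plane_in_csquare]]) auto
  note line = hx[THEN integral_unique] hy[THEN integral_unique]
  note int = hx[THEN has_integral_integrable] hy[THEN has_integral_integrable]
  have "integral (square h) (\<lambda>p. frechet_derivative gx (at (on_plane a p)) \<i>) =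
      (g (on_plane a (h, h)) - g (on_plane a (-h, h))) -
      (g (on_plane a (h, -h)) - g (on_plane a (-h, -h)))"
    using h(1) by (subst integral_square_dy[OF _ fd[OF C1(1)] continuous_on_subset[OF cont(1) sub]])
      (simp_all add: integral_diff int line)
  moreover have "integral (square h) (\<lambda>p. frechet_derivative gy (at (on_plane a p)) 1) =
      (g (on_plane a (h, h)) - g (on_plane a (h, -h))) -
      (g (on_plane a (-h, h)) - g (on_plane a (-h, -h)))"
    using h(1) by (subst integral_square_dx[OF _ fd[OF C1(2)] continuous_on_subset[OF cont(2) sub]])
      (simp_all add: integral_diff int line)
  ultimately have "integral (square h) (\<lambda>p. k (on_plane a p)) = 0"
    unfolding k_def
    by (subst integral_diff[OF integrable_on_square[OF continuous_on_subset[OF cont(1) sub]]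
          integrable_on_square[OF continuous_on_subset[OF cont(2) sub]]]) simp
  moreover have ck: "continuous_on (csquare a h) k"
    using \<open>continuous_on T k\<close> sub continuous_on_subset by blast
  ultimately have z: "integral (square h) (\<lambda>p. q (on_plane a p)) = 0"
    using integral_linear[OF integrable_on_square[OF ck] bounded_linear_inner_left[of "k a"]]
    by (simp add: q_def o_def)
  have "q (on_plane a p) = 0" if "p \<in> square h" for p
  proof -
    have "\<forall>p\<in>cbox (-h, -h) (h, h). q (on_plane a p) = 0"
    proof (subst integral_cbox_eq_0_iff[symmetric])
      show "continuous_on (cbox (-h, -h) (h, h)) (\<lambda>p. q (on_plane a p))"
        using continuous_on_square[of a h q] continuous_on_subset[OF cq sub]
        by (simp add: square_def)
      show "box (-h, -h) (h, h) \<noteq> {}"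
        using h(1) by (simp add: box_ne_empty Basis_prod_def)
      show "0 \<le> q (on_plane a p)" if "p \<in> cbox (-h, -h) (h, h)" for p
        using pos that by (force simp: csquare_def square_def less_imp_le)
    qed (use z in \<open>simp add: square_def\<close>)
    then show ?thesis using that by (simp add: square_def)
  qed
  from this[of "(0, 0)"] h(1) \<open>q a > 0\<close> show False
    by (simp add: mem_square on_plane_def Complex_eq)
qed

subsection \<open>The complexified Minkowski space\<close>

lemma mink_vec_eqI:
  fixes v w :: "('k, 'n::finite) mink_vec"
  shows "(\<And>i. fst v $ i = fst w $ i) \<Longrightarrow> snd v = snd w \<Longrightarrow> v = w"
  by (simp add: prod_eq_iff vec_eq_iff)

lemma mink_sym: "mink v w = mink w v"
  by (simp add: mink_def mult.commute)

lemma mink_add_left: "mink (u + v) w = mink u w + mink v w"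
  and mink_add_right: "mink w (u + v) = mink w u + mink w v"
  and mink_diff_left: "mink (u - v) w = mink u w - mink v w"
  and mink_diff_right: "mink w (u - v) = mink w u - mink w v"
  and mink_minus_left: "mink (- u) w = - mink u w"
  and mink_minus_right: "mink w (- u) = - mink w u"
  and mink_zero_left: "mink 0 w = 0"
  and mink_zero_right: "mink w 0 = 0"
  by (simp_all add: mink_def algebra_simps sum.distrib sum_subtractf sum_negf)

lemma mink_cscale_left: "mink (c *\<^sub>C u) w = c * mink u w"
  and mink_cscale_right: "mink w (c *\<^sub>C u) = c * mink w u"
  by (simp_all add: mink_def cscale_def algebra_simps sum_distrib_left)

lemma mink_scaleR_left:
  fixes u :: "('k::{real_normed_field}, 'n::finite) mink_vec"
  shows "mink (r *\<^sub>R u) w = r *\<^sub>R mink u w"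
  and mink_scaleR_right: "mink w (r *\<^sub>R u) = r *\<^sub>R mink w u"
  by (simp_all add: mink_def scaleR_diff_right scaleR_sum_right)

lemmas mink_simps = mink_add_left mink_add_right mink_diff_left mink_diff_right mink_minus_left
  mink_minus_right mink_zero_left mink_zero_right mink_cscale_left mink_cscale_right
  mink_scaleR_left mink_scaleR_right

lemma cscale_components [simp]:
  "fst (c *\<^sub>C u) $ i = c * fst u $ i" "snd (c *\<^sub>C u) = c * snd u"
  by (simp_all add: cscale_def)

lemma cscale_add_left: "(a + b) *\<^sub>C u = a *\<^sub>C u + b *\<^sub>C u"
  and cscale_add_right: "a *\<^sub>C (u + v) = a *\<^sub>C u + a *\<^sub>C v"
  and cscale_diff_left: "(a - b) *\<^sub>C u = a *\<^sub>C u - b *\<^sub>C u"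
  and cscale_diff_right: "a *\<^sub>C (u - v) = a *\<^sub>C u - a *\<^sub>C v"
  and cscale_minus_left: "(- a) *\<^sub>C u = - (a *\<^sub>C u)"
  and cscale_zero_left [simp]: "0 *\<^sub>C u = 0"
  and cscale_zero_right [simp]: "a *\<^sub>C 0 = 0"
  and cscale_one [simp]: "1 *\<^sub>C u = u"
  and cscale_cscale [simp]: "a *\<^sub>C (b *\<^sub>C u) = (a * b) *\<^sub>C u"
  by (rule mink_vec_eqI; simp add: algebra_simps)+

lemma cscale_of_real: "complex_of_real r *\<^sub>C u = r *\<^sub>R u"
proof (rule mink_vec_eqI)
  show "fst (complex_of_real r *\<^sub>C u) $ i = fst (r *\<^sub>R u) $ i" for i
    by (simp only: cscale_components fst_scaleR vector_scaleR_component)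
      (simp add: scaleR_conv_of_real)
qed (simp add: scaleR_conv_of_real)

lemma cscale_eq_0_iff: "a *\<^sub>C u = 0 \<longleftrightarrow> a = 0 \<or> u = 0"
  by (metis cscale_cscale cscale_one cscale_zero_left cscale_zero_right left_inverse)

definition cnjv :: "(complex, 'n::finite) mink_vec \<Rightarrow> (complex, 'n) mink_vec" where
  "cnjv v = ((\<chi> i. cnj (fst v $ i)), cnj (snd v))"

lemma cnjv_components [simp]: "fst (cnjv v) $ i = cnj (fst v $ i)" "snd (cnjv v) = cnj (snd v)"
  by (simp_all add: cnjv_def)

lemma cnjv_add: "cnjv (u + v) = cnjv u + cnjv v"
  and cnjv_diff: "cnjv (u - v) = cnjv u - cnjv v"
  and cnjv_minus: "cnjv (- u) = - cnjv u"
  and cnjv_cscale: "cnjv (c *\<^sub>C u) = cnj c *\<^sub>C cnjv u"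
  and cnjv_cnjv [simp]: "cnjv (cnjv u) = u"
  and cnjv_zero [simp]: "cnjv 0 = 0"
  by (rule mink_vec_eqI; simp)+

lemmas cnjv_simps = cnjv_add cnjv_diff cnjv_minus cnjv_cscale

lemma mink_cnjv: "mink (cnjv u) (cnjv v) = cnj (mink u v)"
  by (simp add: mink_def)

lemma mink_cnjv_left: "mink (cnjv u) v = cnj (mink u (cnjv v))"
  using mink_cnjv[of u "cnjv v"] by simp

lemma cpx_components [simp]:
  "fst (cpx v) $ i = complex_of_real (fst v $ i)" "snd (cpx v) = complex_of_real (snd v)"
  by (simp_all add: cpx_def)

lemma cnjv_cpx [simp]: "cnjv (cpx v) = cpx v"
  by (rule mink_vec_eqI) simp_all

lemma cpx_scaleR: "cpx (r *\<^sub>R v) = complex_of_real r *\<^sub>C cpx v"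
  by (rule mink_vec_eqI) simp_all

lemma cpx_add: "cpx (u + v) = cpx u + cpx v"
  by (rule mink_vec_eqI) simp_all

lemma cpx_diff: "cpx (u - v) = cpx u - cpx v"
  by (rule mink_vec_eqI) simp_all

lemma mink_cpx: "mink (cpx u) (cpx v) = complex_of_real (mink u v)"
  by (simp add: mink_def)

lemma range_cpx: "v \<in> range cpx \<longleftrightarrow> cnjv v = v"
proof
  assume r: "cnjv v = v"
  have "v = cpx ((\<chi> i. Re (fst v $ i)), Re (snd v))"
  proof (rule mink_vec_eqI)
    show "fst v $ i = fst (cpx ((\<chi> i. Re (fst v $ i)), Re (snd v))) $ i" for i
      using arg_cong[OF r, of "\<lambda>w. fst w $ i"] by (simp add: complex_eq_iff)
    show "snd v = snd (cpx ((\<chi> i. Re (fst v $ i)), Re (snd v)))"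
      using arg_cong[OF r, of snd] by (simp add: complex_eq_iff)
  qed
  then show "v \<in> range cpx" by blast
qed auto

lemma bounded_bilinear_mink:
  "bounded_bilinear (mink :: ('k::{real_normed_field,euclidean_space}, 'n::finite) mink_vec \<Rightarrow> _)"
  by (subst bilinear_conv_bounded_bilinear[symmetric])
    (simp add: bilinear_def linear_iff mink_simps del: split_paired_All)

lemma bounded_bilinear_cscale: "bounded_bilinear (cscale :: _ \<Rightarrow> (complex, 'n::finite) mink_vec \<Rightarrow> _)"
proof (subst bilinear_conv_bounded_bilinear[symmetric])
  have "(r *\<^sub>R c) *\<^sub>C u = r *\<^sub>R (c *\<^sub>C u)" "c *\<^sub>C (r *\<^sub>R u) = r *\<^sub>R (c *\<^sub>C u)"
    for r c and u :: "(complex, 'n) mink_vec"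
    by (rule mink_vec_eqI; simp)+
  then show "bilinear (cscale :: _ \<Rightarrow> (complex, 'n) mink_vec \<Rightarrow> _)"
    by (simp add: bilinear_def linear_iff cscale_add_left cscale_add_right del: split_paired_All)
qed

lemma bounded_linear_cpx: "bounded_linear cpx"
proof (subst linear_conv_bounded_linear[symmetric])
  show "linear cpx"
    by (rule linearI) (simp_all add: cpx_add cpx_scaleR cscale_of_real)
qed

lemma bounded_linear_cnjv: "bounded_linear cnjv"
proof (subst linear_conv_bounded_linear[symmetric])
  show "linear cnjv"
    by (rule linearI) (simp_all add: cnjv_add cnjv_cscale flip: cscale_of_real)
qed

lemmas smooth_on_mink [smooth_intros] = smooth_on_bounded_bilinear[OF bounded_bilinear_mink]
lemmas smooth_on_cscale [smooth_intros] = smooth_on_bounded_bilinear[OF bounded_bilinear_cscale]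
lemmas smooth_on_cpx [smooth_intros] = smooth_on_bounded_linear[OF bounded_linear_cpx]
lemmas smooth_on_cnjv [smooth_intros] = smooth_on_bounded_linear[OF bounded_linear_cnjv]

subsection \<open>Wirtinger derivatives\<close>

definition wz :: "(complex \<Rightarrow> complex) \<Rightarrow> complex \<Rightarrow> complex" where
  "wz g \<zeta> = (frechet_derivative g (at \<zeta>) 1 - \<i> * frechet_derivative g (at \<zeta>) \<i>) / 2"

definition wzbar :: "(complex \<Rightarrow> complex) \<Rightarrow> complex \<Rightarrow> complex" where
  "wzbar g \<zeta> = (frechet_derivative g (at \<zeta>) 1 + \<i> * frechet_derivative g (at \<zeta>) \<i>) / 2"

lemma dz_at: "(F has_derivative F') (at \<zeta>) \<Longrightarrow> dz F \<zeta> = (1/2) *\<^sub>C (F' 1 - \<i> *\<^sub>C F' \<i>)"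
  and dzbar_at: "(F has_derivative F') (at \<zeta>) \<Longrightarrow> dzbar F \<zeta> = (1/2) *\<^sub>C (F' 1 + \<i> *\<^sub>C F' \<i>)"
  by (simp_all add: dz_def dzbar_def frechet_derivative_at[symmetric])

lemma wz_at: "(g has_derivative g') (at \<zeta>) \<Longrightarrow> wz g \<zeta> = (g' 1 - \<i> * g' \<i>) / 2"
  and wzbar_at: "(g has_derivative g') (at \<zeta>) \<Longrightarrow> wzbar g \<zeta> = (g' 1 + \<i> * g' \<i>) / 2"
  by (simp_all add: wz_def wzbar_def frechet_derivative_at[symmetric])

lemma smooth_on_dz [smooth_intros]: "open T \<Longrightarrow> smooth_on T F \<Longrightarrow> smooth_on T (dz F)"
  and smooth_on_dzbar [smooth_intros]: "open T \<Longrightarrow> smooth_on T F \<Longrightarrow> smooth_on T (dzbar F)"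
  unfolding dz_def[abs_def] dzbar_def[abs_def] by (intro smooth_intros; assumption)+

lemma smooth_on_wz [smooth_intros]: "open T \<Longrightarrow> smooth_on T g \<Longrightarrow> smooth_on T (wz g)"
  and smooth_on_wzbar [smooth_intros]: "open T \<Longrightarrow> smooth_on T g \<Longrightarrow> smooth_on T (wzbar g)"
  unfolding wz_def[abs_def] wzbar_def[abs_def] divide_inverse by (intro smooth_intros; assumption)+

lemma dz_cong_open:
  assumes "open T" "\<zeta> \<in> T" "\<And>w. w \<in> T \<Longrightarrow> F w = G w"
  shows "dz F \<zeta> = dz G \<zeta>" "dzbar F \<zeta> = dzbar G \<zeta>"
  using frechet_derivative_cong_open[OF assms] by (simp_all add: dz_def dzbar_def)

lemma wz_cong_open:
  assumes "open T" "\<zeta> \<in> T" "\<And>w. w \<in> T \<Longrightarrow> f w = g w"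
  shows "wz f \<zeta> = wz g \<zeta>" "wzbar f \<zeta> = wzbar g \<zeta>"
  using frechet_derivative_cong_open[OF assms] by (simp_all add: wz_def wzbar_def)

section \<open>Product rules and commutation of the Wirtinger derivatives\<close>

lemma frechet_derivative_bounded_linear:
  assumes "bounded_linear L" "g differentiable (at x)"
  shows "frechet_derivative (\<lambda>x. L (g x)) (at x) = (\<lambda>v. L (frechet_derivative g (at x) v))"
  by (rule frechet_derivative_at[OF bounded_linear.has_derivative[OF assms(1)], symmetric])
    (use assms(2) frechet_derivative_works in blast)

lemma frechet_derivative_add:
  assumes "f differentiable (at x)" "g differentiable (at x)"
  shows "frechet_derivative (\<lambda>x. f x + g x) (at x) =
    (\<lambda>v. frechet_derivative f (at x) v + frechet_derivative g (at x) v)"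
  by (rule frechet_derivative_at[OF has_derivative_add, symmetric])
    (use assms frechet_derivative_works in blast)+

lemma frechet_derivative_bounded_bilinear:
  assumes "bounded_bilinear B" "f differentiable (at x)" "g differentiable (at x)"
  shows "frechet_derivative (\<lambda>x. B (f x) (g x)) (at x) =
    (\<lambda>v. B (f x) (frechet_derivative g (at x) v) + B (frechet_derivative f (at x) v) (g x))"
  by (rule frechet_derivative_at[OF bounded_bilinear.FDERIV[OF assms(1)], symmetric])
    (use assms(2,3) frechet_derivative_works in blast)+

lemma dz_add_raw:
  assumes F: "F differentiable (at \<zeta>)" and G: "G differentiable (at \<zeta>)"
  shows "dz (\<lambda>\<zeta>. F \<zeta> + G \<zeta>) \<zeta> = dz F \<zeta> + dz G \<zeta>"
    "dzbar (\<lambda>\<zeta>. F \<zeta> + G \<zeta>) \<zeta> = dzbar F \<zeta> + dzbar G \<zeta>"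
  by (rule mink_vec_eqI; simp add: dz_def dzbar_def frechet_derivative_add[OF F G] algebra_simps)+

lemma dz_cscale_raw:
  assumes f: "f differentiable (at \<zeta>)" and F: "F differentiable (at \<zeta>)"
  shows "dz (\<lambda>\<zeta>. f \<zeta> *\<^sub>C F \<zeta>) \<zeta> = wz f \<zeta> *\<^sub>C F \<zeta> + f \<zeta> *\<^sub>C dz F \<zeta>"
    "dzbar (\<lambda>\<zeta>. f \<zeta> *\<^sub>C F \<zeta>) \<zeta> = wzbar f \<zeta> *\<^sub>C F \<zeta> + f \<zeta> *\<^sub>C dzbar F \<zeta>"
  by (rule mink_vec_eqI; simp add: dz_def dzbar_def wz_def wzbar_def
      frechet_derivative_bounded_bilinear[OF bounded_bilinear_cscale f F] field_simps)+

lemma dz_cnjv_raw: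
  assumes F: "F differentiable (at \<zeta>)"
  shows "dz (\<lambda>\<zeta>. cnjv (F \<zeta>)) \<zeta> = cnjv (dzbar F \<zeta>)"
    "dzbar (\<lambda>\<zeta>. cnjv (F \<zeta>)) \<zeta> = cnjv (dz F \<zeta>)"
  by (rule mink_vec_eqI; simp add: dz_def dzbar_def 
      frechet_derivative_bounded_linear[OF bounded_linear_cnjv F] field_simps)+

lemma wz_mink_raw:
  assumes F: "F differentiable (at \<zeta>)" and G: "G differentiable (at \<zeta>)"
  shows "wz (\<lambda>\<zeta>. mink (F \<zeta>) (G \<zeta>)) \<zeta> = mink (dz F \<zeta>) (G \<zeta>) + mink (F \<zeta>) (dz G \<zeta>)"
    "wzbar (\<lambda>\<zeta>. mink (F \<zeta>) (G \<zeta>)) \<zeta> = mink (dzbar F \<zeta>) (G \<zeta>) + mink (F \<zeta>) (dzbar G \<zeta>)"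
  by (simp_all add: dz_def dzbar_def wz_def wzbar_def mink_simps
      frechet_derivative_bounded_bilinear[OF bounded_bilinear_mink F G] field_simps)

lemma wz_mult_raw:
  assumes f: "f differentiable (at \<zeta>)" and g: "g differentiable (at \<zeta>)"
  shows "wz (\<lambda>\<zeta>. f \<zeta> * g \<zeta>) \<zeta> = wz f \<zeta> * g \<zeta> + f \<zeta> * wz g \<zeta>"
    "wzbar (\<lambda>\<zeta>. f \<zeta> * g \<zeta>) \<zeta> = wzbar f \<zeta> * g \<zeta> + f \<zeta> * wzbar g \<zeta>"
  by (simp_all add: wz_def wzbar_def 
      frechet_derivative_bounded_bilinear[OF bounded_bilinear_mult f g] field_simps)

lemma wz_add_raw:
  assumes f: "f differentiable (at \<zeta>)" and g: "g differentiable (at \<zeta>)"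
  shows "wz (\<lambda>\<zeta>. f \<zeta> + g \<zeta>) \<zeta> = wz f \<zeta> + wz g \<zeta>"
    "wzbar (\<lambda>\<zeta>. f \<zeta> + g \<zeta>) \<zeta> = wzbar f \<zeta> + wzbar g \<zeta>"
  by (simp_all add: wz_def wzbar_def frechet_derivative_add[OF f g] field_simps)

lemma wz_cnj_raw:
  assumes f: "f differentiable (at \<zeta>)"
  shows "wz (\<lambda>\<zeta>. cnj (f \<zeta>)) \<zeta> = cnj (wzbar f \<zeta>)"
    "wzbar (\<lambda>\<zeta>. cnj (f \<zeta>)) \<zeta> = cnj (wz f \<zeta>)"
  by (simp_all add: wz_def wzbar_def frechet_derivative_bounded_linear[OF bounded_linear_cnj f]
      field_simps)

lemma wz_const [simp]: "wz (\<lambda>\<zeta>. c) \<zeta> = 0" "wzbar (\<lambda>\<zeta>. c) \<zeta> = 0"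
  by (simp_all add: wz_def wzbar_def frechet_derivative_const)

lemma wz_cmult:
  assumes "f differentiable (at \<zeta>)"
  shows "wz (\<lambda>\<zeta>. c * f \<zeta>) \<zeta> = c * wz f \<zeta>" "wzbar (\<lambda>\<zeta>. c * f \<zeta>) \<zeta> = c * wzbar f \<zeta>"
  using wz_mult_raw[OF _ assms, of "\<lambda>\<zeta>. c"] by simp_all

lemma dz_cmult:
  assumes "F differentiable (at \<zeta>)"
  shows "dz (\<lambda>\<zeta>. c *\<^sub>C F \<zeta>) \<zeta> = c *\<^sub>C dz F \<zeta>" "dzbar (\<lambda>\<zeta>. c *\<^sub>C F \<zeta>) \<zeta> = c *\<^sub>C dzbar F \<zeta>"
  using dz_cscale_raw[OF _ assms, of "\<lambda>\<zeta>. c"] by simp_all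

lemma wz_minus:
  assumes "f differentiable (at \<zeta>)"
  shows "wz (\<lambda>\<zeta>. - f \<zeta>) \<zeta> = - wz f \<zeta>" "wzbar (\<lambda>\<zeta>. - f \<zeta>) \<zeta> = - wzbar f \<zeta>"
  using wz_cmult[OF assms, of "-1"] by simp_all

lemma dz_minus:
  assumes "F differentiable (at \<zeta>)"
  shows "dz (\<lambda>\<zeta>. - F \<zeta>) \<zeta> = - dz F \<zeta>" "dzbar (\<lambda>\<zeta>. - F \<zeta>) \<zeta> = - dzbar F \<zeta>"
  using dz_cmult[OF assms, of "-1"] by (simp_all add: cscale_minus_left)

lemma wz_diff:
  assumes "f differentiable (at \<zeta>)" "g differentiable (at \<zeta>)"
  shows "wz (\<lambda>\<zeta>. f \<zeta> - g \<zeta>) \<zeta> = wz f \<zeta> - wz g \<zeta>"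
    "wzbar (\<lambda>\<zeta>. f \<zeta> - g \<zeta>) \<zeta> = wzbar f \<zeta> - wzbar g \<zeta>"
  using wz_add_raw[OF assms(1), of "\<lambda>\<zeta>. - g \<zeta>"] assms by (simp_all add: wz_minus)

lemma dz_diff:
  assumes "F differentiable (at \<zeta>)" "G differentiable (at \<zeta>)"
  shows "dz (\<lambda>\<zeta>. F \<zeta> - G \<zeta>) \<zeta> = dz F \<zeta> - dz G \<zeta>"
    "dzbar (\<lambda>\<zeta>. F \<zeta> - G \<zeta>) \<zeta> = dzbar F \<zeta> - dzbar G \<zeta>"
  using dz_add_raw[OF assms(1), of "\<lambda>\<zeta>. - G \<zeta>"] assms by (simp_all add: dz_minus)

lemma dz_dzbar_commute:
  assumes "open T" "\<zeta> \<in> T" "smooth_on T F"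
  shows "dzbar (dz F) \<zeta> = dz (dzbar F) \<zeta>"
proof -
  let ?X = "\<lambda>\<zeta>. frechet_derivative F (at \<zeta>) 1" and ?Y = "\<lambda>\<zeta>. frechet_derivative F (at \<zeta>) \<i>"
  have sX: "?X differentiable (at \<zeta>)" and sY: "?Y differentiable (at \<zeta>)"
    using smooth_on_imp_differentiable[OF smooth_on_frechet_derivative[OF assms(3)] assms(2)] by auto
  then have Y: "(\<lambda>\<zeta>. \<i> *\<^sub>C ?Y \<zeta>) differentiable (at \<zeta>)"
    by (intro smooth_on_imp_differentiable[OF _ assms(2)] smooth_intros assms)
  have fY: "frechet_derivative (\<lambda>\<zeta>. \<i> *\<^sub>C ?Y \<zeta>) (at \<zeta>) = (\<lambda>v. \<i> *\<^sub>C frechet_derivative ?Y (at \<zeta>) v)"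
    using frechet_derivative_bounded_bilinear[OF bounded_bilinear_cscale _ sY, of "\<lambda>x. \<i>"] by simp
  have 1: "dzbar (dz F) \<zeta> = (1/2) *\<^sub>C (dzbar ?X \<zeta> - \<i> *\<^sub>C dzbar ?Y \<zeta>)"
    unfolding dz_def[abs_def] using sX Y sY
    by (subst dz_cmult) (auto simp: dz_diff dz_cmult)
  have 2: "dz (dzbar F) \<zeta> = (1/2) *\<^sub>C (dz ?X \<zeta> + \<i> *\<^sub>C dz ?Y \<zeta>)"
    unfolding dzbar_def[abs_def] using sX Y sY
    by (subst dz_cmult) (auto simp: dz_add_raw dz_cmult intro: differentiable_add)
  have s: "frechet_derivative ?X (at \<zeta>) \<i> = frechet_derivative ?Y (at \<zeta>) 1"
    by (rule second_derivative_symmetric[OF assms(1,2) smooth_on_imp_Ck_on[OF assms(3)]])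
  show ?thesis
    unfolding 1 2 by (rule mink_vec_eqI; simp add: dz_def dzbar_def s field_simps)
qed

lemma wz_wzbar_commute:
  assumes "open T" "\<zeta> \<in> T" "smooth_on T g"
  shows "wzbar (wz g) \<zeta> = wz (wzbar g) \<zeta>"
proof -
  let ?X = "\<lambda>\<zeta>. frechet_derivative g (at \<zeta>) 1" and ?Y = "\<lambda>\<zeta>. frechet_derivative g (at \<zeta>) \<i>"
  have sX: "?X differentiable (at \<zeta>)" and sY: "?Y differentiable (at \<zeta>)"
    using smooth_on_imp_differentiable[OF smooth_on_frechet_derivative[OF assms(3)] assms(2)] by auto
  then have Y: "(\<lambda>\<zeta>. \<i> * ?Y \<zeta>) differentiable (at \<zeta>)"
    by (intro smooth_on_imp_differentiable[OF _ assms(2)] smooth_intros assms)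
  have 1: "wzbar (wz g) \<zeta> = (1/2) * (wzbar ?X \<zeta> - \<i> * wzbar ?Y \<zeta>)"
    using wz_cmult(2)[of "\<lambda>\<zeta>. ?X \<zeta> - \<i> * ?Y \<zeta>" \<zeta> "1/2"] sX Y sY
    by (simp add: wz_diff wz_cmult wz_def[of g, abs_def])
  have 2: "wz (wzbar g) \<zeta> = (1/2) * (wz ?X \<zeta> + \<i> * wz ?Y \<zeta>)"
    using wz_cmult(1)[of "\<lambda>\<zeta>. ?X \<zeta> + \<i> * ?Y \<zeta>" \<zeta> "1/2"] sX Y sY
    by (simp add: wz_add_raw wz_cmult wzbar_def[of g, abs_def])
  have s: "frechet_derivative ?X (at \<zeta>) \<i> = frechet_derivative ?Y (at \<zeta>) 1"
    by (rule second_derivative_symmetric[OF assms(1,2) smooth_on_imp_Ck_on[OF assms(3)]])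
  show ?thesis
    unfolding 1 2 by (simp add: wz_def wzbar_def s field_simps)
qed

subsection \<open>Unique continuation for the Cauchy-Riemann operator\<close>

lemma Ck_on_exp:
  fixes g :: "'a::real_normed_vector \<Rightarrow> real"
  assumes "open T" "Ck_on k T g"
  shows "Ck_on k T (\<lambda>x. exp (g x))"
  using assms(2)
proof (induction k)
  case 0
  then show ?case by (auto intro!: continuous_intros)
next
  case (Suc k)
  have I: "Ck_on k T (\<lambda>x. exp (g x))"
    by (rule Suc.IH[OF Ck_on_SucD[OF Suc.prems]])
  have 1: "Ck_on k T (\<lambda>x. exp (g x) * frechet_derivative g (at x) v)" for v
    using Ck_on_bounded_bilinear[OF bounded_bilinear_mult \<open>open T\<close> I] Suc.prems by simp
  have 2: "((\<lambda>x. exp (g x)) has_derivative (\<lambda>v. exp (g x) * frechet_derivative g (at x) v)) (at x)"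
    if "x \<in> T" for x
    using Ck_on_Suc_has_derivative[OF Suc.prems that]
    by (auto intro!: derivative_eq_intros)
  show ?case
    by (rule Ck_on_SucI[OF \<open>open T\<close> 2 1])
qed

lemma smooth_on_exp [smooth_intros]:
  fixes g :: "'a::real_normed_vector \<Rightarrow> real"
  shows "open T \<Longrightarrow> smooth_on T g \<Longrightarrow> smooth_on T (\<lambda>x. exp (g x))"
  by (simp add: smooth_on_def Ck_on_exp)

lemma wz_exp:
  assumes "smooth_on T \<Psi>" "\<zeta> \<in> T"
  shows "wz (\<lambda>\<zeta>. complex_of_real (exp (\<Psi> \<zeta>))) \<zeta> =
      wz (\<lambda>\<zeta>. complex_of_real (\<Psi> \<zeta>)) \<zeta> * complex_of_real (exp (\<Psi> \<zeta>))"
    and "wzbar (\<lambda>\<zeta>. complex_of_real (exp (\<Psi> \<zeta>))) \<zeta> =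
      cnj (wz (\<lambda>\<zeta>. complex_of_real (\<Psi> \<zeta>)) \<zeta>) * complex_of_real (exp (\<Psi> \<zeta>))"
proof -
  let ?D = "frechet_derivative \<Psi> (at \<zeta>)"
  have D: "(\<Psi> has_derivative ?D) (at \<zeta>)"
    by (rule smooth_on_has_derivative[OF assms])
  then have "((\<lambda>\<zeta>. exp (\<Psi> \<zeta>)) has_derivative (\<lambda>v. exp (\<Psi> \<zeta>) * ?D v)) (at \<zeta>)"
    by (auto intro!: derivative_eq_intros)
  from this[THEN bounded_linear.has_derivative[OF bounded_linear_of_real]]
    D[THEN bounded_linear.has_derivative[OF bounded_linear_of_real]]
  have E: "((\<lambda>\<zeta>. complex_of_real (exp (\<Psi> \<zeta>))) has_derivative (\<lambda>v. of_real (exp (\<Psi> \<zeta>) * ?D v))) (at \<zeta>)"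
    and P: "((\<lambda>\<zeta>. complex_of_real (\<Psi> \<zeta>)) has_derivative (\<lambda>v. of_real (?D v))) (at \<zeta>)"
    by auto
  show "wz (\<lambda>\<zeta>. complex_of_real (exp (\<Psi> \<zeta>))) \<zeta> =
      wz (\<lambda>\<zeta>. complex_of_real (\<Psi> \<zeta>)) \<zeta> * complex_of_real (exp (\<Psi> \<zeta>))"
    "wzbar (\<lambda>\<zeta>. complex_of_real (exp (\<Psi> \<zeta>))) \<zeta> =
      cnj (wz (\<lambda>\<zeta>. complex_of_real (\<Psi> \<zeta>)) \<zeta>) * complex_of_real (exp (\<Psi> \<zeta>))"
    unfolding wz_at[OF E] wzbar_at[OF E] wz_at[OF P] by (simp_all add: field_simps)
qed

text \<open>Plays the role of compact support: derivatives of such functions integrate to zero over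
  the square, and multiplication by a polynomial cutoff achieves it.\<close>

definition vanishes_on_boundary :: "complex \<Rightarrow> real \<Rightarrow> (complex \<Rightarrow> complex) \<Rightarrow> bool" where
  "vanishes_on_boundary a h v \<longleftrightarrow>
     (\<forall>\<zeta>\<in>csquare a h. \<bar>Re (\<zeta> - a)\<bar> = h \<or> \<bar>Im (\<zeta> - a)\<bar> = h \<longrightarrow> v \<zeta> = 0)"

lemma integral_square_wz_eq_0:
  assumes "0 \<le> h" "csquare a h \<subseteq> T" "smooth_on T g" "vanishes_on_boundary a h g"
  shows "((\<lambda>p. wz g (on_plane a p)) has_integral 0) (square h)"
    and "((\<lambda>p. wzbar g (on_plane a p)) has_integral 0) (square h)"
proof -
  let ?D = "\<lambda>\<zeta>. frechet_derivative g (at \<zeta>)"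
  have d: "(g has_derivative ?D \<zeta>) (at \<zeta>)" if "\<zeta> \<in> csquare a h" for \<zeta>
    using smooth_on_has_derivative[OF assms(3)] that assms(2) by auto
  have c: "continuous_on (csquare a h) (\<lambda>\<zeta>. ?D \<zeta> v)" for v
    using smooth_on_imp_continuous_on[OF smooth_on_frechet_derivative[OF assms(3)]]
      continuous_on_subset[OF _ assms(2)] by blast
  have b: "g (on_plane a (x, y)) = 0" if "\<bar>x\<bar> \<le> h" "\<bar>y\<bar> \<le> h" "\<bar>x\<bar> = h \<or> \<bar>y\<bar> = h" for x y
    using assms(4) that on_plane_in_csquare[of x h y a]
    by (auto simp: vanishes_on_boundary_def on_plane_def)
  have "integral (square h) (\<lambda>p. ?D (on_plane a p) 1) = 0"
    by (subst integral_square_dx[OF assms(1) d c])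
      (auto simp: b assms(1) intro!: integral_unique has_integral_is_0)
  then have ix: "((\<lambda>p. ?D (on_plane a p) 1) has_integral 0) (square h)"
    using integrable_integral[OF integrable_on_square[OF c]] by metis
  have "integral (square h) (\<lambda>p. ?D (on_plane a p) \<i>) = 0"
    by (subst integral_square_dy[OF assms(1) d c])
      (auto simp: b assms(1) intro!: integral_unique has_integral_is_0)
  then have iy: "((\<lambda>p. ?D (on_plane a p) \<i>) has_integral 0) (square h)"
    using integrable_integral[OF integrable_on_square[OF c]] by metis
  show "((\<lambda>p. wz g (on_plane a p)) has_integral 0) (square h)"
    using has_integral_divide[OF has_integral_diff[OF ix has_integral_mult_right[OF iy, of \<i>]], of 2]
    by (simp add: wz_def)
  show "((\<lambda>p. wzbar g (on_plane a p)) has_integral 0) (square h)"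
    using has_integral_divide[OF has_integral_add[OF ix has_integral_mult_right[OF iy, of \<i>]], of 2]
    by (simp add: wzbar_def)
qed

text \<open>In the inner product with weight exp \<Psi> the adjoint of \<open>wzbar\<close> is minus
  the operator \<open>D\<close>, and the commutator of the two is, up to sign, multiplication by
  \<open>L\<close>. Integration by parts therefore turns the integral into that of exp \<Psi> times
  the squared modulus of \<open>D\<close>, which is nonnegative.\<close>

lemma carleman_inequality:
  assumes "0 \<le> h" "open T" "csquare a h \<subseteq> T" and v: "smooth_on T v" "vanishes_on_boundary a h v"
    and \<Psi>: "smooth_on T \<Psi>"
  defines "L \<equiv> wzbar (wz (\<lambda>\<zeta>. complex_of_real (\<Psi> \<zeta>)))"
  shows "0 \<le> integral (square h) (\<lambda>p. exp (\<Psi> (on_plane a p)) *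
     ((cmod (wzbar v (on_plane a p)))\<^sup>2 - Re (L (on_plane a p)) * (cmod (v (on_plane a p)))\<^sup>2))"
proof -
  define E where "E \<zeta> = complex_of_real (exp (\<Psi> \<zeta>))" for \<zeta>
  define \<psi> where "\<psi> = wz (\<lambda>\<zeta>. complex_of_real (\<Psi> \<zeta>))"
  define D where "D \<zeta> = wz v \<zeta> + \<psi> \<zeta> * v \<zeta>" for \<zeta>
  define G where "G \<zeta> = E \<zeta> * (cnj (v \<zeta>) * wzbar v \<zeta>)" for \<zeta>
  define H where "H \<zeta> = E \<zeta> * (cnj (v \<zeta>) * D \<zeta>)" for \<zeta>
  have sE: "smooth_on T E" and s\<psi>: "smooth_on T \<psi>"
    unfolding E_def \<psi>_def by (intro smooth_intros assms)+
  then have sD: "smooth_on T D"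
    unfolding D_def by (intro smooth_intros assms)
  have sG: "smooth_on T G" and sH: "smooth_on T H"
    unfolding G_def H_def by (intro smooth_intros assms sE sD)+
  have vG: "vanishes_on_boundary a h G" "vanishes_on_boundary a h H"
    using v(2) by (auto simp: vanishes_on_boundary_def G_def H_def)
  \<comment> \<open>The integration by parts in pointwise form: the terms with \<open>G\<close> and
    \<open>H\<close> are the derivatives that integrate to zero.\<close>
  have id: "E \<zeta> * (of_real ((cmod (wzbar v \<zeta>))\<^sup>2) - L \<zeta> * of_real ((cmod (v \<zeta>))\<^sup>2))
      = E \<zeta> * of_real ((cmod (D \<zeta>))\<^sup>2) + (wz G \<zeta> - wzbar H \<zeta>)" if "\<zeta> \<in> T" for \<zeta>
  proof -
    have df: "f differentiable (at \<zeta>)" if "smooth_on T f" for f :: "complex \<Rightarrow> complex"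
      using smooth_on_imp_differentiable[OF that \<open>\<zeta> \<in> T\<close>] .
    have dv: "v differentiable (at \<zeta>)" "wz v differentiable (at \<zeta>)" "wzbar v differentiable (at \<zeta>)"
      "(\<lambda>\<zeta>. cnj (v \<zeta>)) differentiable (at \<zeta>)" "E differentiable (at \<zeta>)"
      "D differentiable (at \<zeta>)" "\<psi> differentiable (at \<zeta>)" "(\<lambda>\<zeta>. \<psi> \<zeta> * v \<zeta>) differentiable (at \<zeta>)"
      "(\<lambda>\<zeta>. cnj (v \<zeta>) * wzbar v \<zeta>) differentiable (at \<zeta>)"
      "(\<lambda>\<zeta>. cnj (v \<zeta>) * D \<zeta>) differentiable (at \<zeta>)"
      by (intro df smooth_intros assms sE s\<psi> sD)+
    have E1: "wz E \<zeta> = \<psi> \<zeta> * E \<zeta>" "wzbar E \<zeta> = cnj (\<psi> \<zeta>) * E \<zeta>"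
      using wz_exp[OF \<Psi> that] by (simp_all add: E_def[abs_def] \<psi>_def)
    have "wz G \<zeta> = \<psi> \<zeta> * E \<zeta> * (cnj (v \<zeta>) * wzbar v \<zeta>)
        + E \<zeta> * (cnj (wzbar v \<zeta>) * wzbar v \<zeta> + cnj (v \<zeta>) * wzbar (wz v) \<zeta>)"
      unfolding G_def[abs_def] using dv
      by (simp add: wz_mult_raw wz_cnj_raw E1 wz_wzbar_commute[OF \<open>open T\<close> that v(1)])
    moreover have "wzbar H \<zeta> = cnj (\<psi> \<zeta>) * E \<zeta> * (cnj (v \<zeta>) * D \<zeta>)
        + E \<zeta> * (cnj (wz v \<zeta>) * D \<zeta> + cnj (v \<zeta>) * (wzbar (wz v) \<zeta> + (L \<zeta> * v \<zeta> + \<psi> \<zeta> * wzbar v \<zeta>)))"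
    proof -
      have "wzbar D \<zeta> = wzbar (wz v) \<zeta> + (L \<zeta> * v \<zeta> + \<psi> \<zeta> * wzbar v \<zeta>)"
        unfolding D_def[abs_def] using dv by (simp add: wz_mult_raw wz_add_raw L_def \<psi>_def)
      then show ?thesis
        unfolding H_def[abs_def] using dv by (simp add: wz_mult_raw wz_cnj_raw E1)
    qed
    ultimately show ?thesis
      unfolding complex_norm_square D_def by (simp add: algebra_simps)
  qed
  have ct: "continuous_on (csquare a h) f" if "smooth_on T f" for f :: "complex \<Rightarrow> complex"
    using continuous_on_subset[OF smooth_on_imp_continuous_on[OF that] assms(3)] .
  let ?q = "\<lambda>\<zeta>. exp (\<Psi> \<zeta>) * (cmod (D \<zeta>))\<^sup>2"
  have cq: "continuous_on (csquare a h) ?q"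
    using continuous_on_subset[OF smooth_on_imp_continuous_on[OF \<Psi>] assms(3)] ct[OF sD]
    by (intro continuous_intros)
  have "((\<lambda>p. wz G (on_plane a p) - wzbar H (on_plane a p)) has_integral 0 - 0) (square h)"
    using integral_square_wz_eq_0[OF assms(1,3) sG vG(1)] integral_square_wz_eq_0[OF assms(1,3) sH vG(2)]
    by (intro has_integral_diff)
  from has_integral_linear[OF this bounded_linear_Re]
  have "((\<lambda>p. Re (wz G (on_plane a p) - wzbar H (on_plane a p))) has_integral 0) (square h)"
    by (simp add: o_def)
  from has_integral_add[OF integrable_integral[OF integrable_on_square[OF cq]] this]
  have "((\<lambda>p. ?q (on_plane a p) + Re (wz G (on_plane a p) - wzbar H (on_plane a p))) has_integral
      integral (square h) (\<lambda>p. ?q (on_plane a p))) (square h)"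
    by simp
  moreover have "?q \<zeta> + Re (wz G \<zeta> - wzbar H \<zeta>) =
      exp (\<Psi> \<zeta>) * ((cmod (wzbar v \<zeta>))\<^sup>2 - Re (L \<zeta>) * (cmod (v \<zeta>))\<^sup>2)" if "\<zeta> \<in> csquare a h" for \<zeta>
    using arg_cong[OF id, of \<zeta> Re] that assms(3) by (auto simp: E_def simp flip: of_real_power)
  ultimately have "((\<lambda>p. exp (\<Psi> (on_plane a p)) * ((cmod (wzbar v (on_plane a p)))\<^sup>2 -
        Re (L (on_plane a p)) * (cmod (v (on_plane a p)))\<^sup>2)) has_integral
      integral (square h) (\<lambda>p. ?q (on_plane a p))) (square h)"
    by (rule has_integral_eq[rotated]) (auto simp: csquare_def)
  moreover have "0 \<le> integral (square h) (\<lambda>p. ?q (on_plane a p))"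
    by (intro integral_nonneg integrable_on_square cq) auto
  ultimately show ?thesis
    by (simp add: integral_unique)
qed

text \<open>Away from the centre this radially decreasing weight is subharmonic, which is what lets zeros
  propagate outwards.\<close>

lemma gaussian_weight:
  fixes a :: complex and l t :: real
  defines "\<Psi> \<equiv> \<lambda>\<zeta>. t * exp (- l * ((Re (\<zeta> - a))\<^sup>2 + (Im (\<zeta> - a))\<^sup>2))"
  shows "smooth_on UNIV \<Psi>"
    and "wzbar (wz (\<lambda>\<zeta>. complex_of_real (\<Psi> \<zeta>))) \<zeta> =
      of_real (l * (l * (cmod (\<zeta> - a))\<^sup>2 - 1) * \<Psi> \<zeta>)"
proof -
  have sid: "smooth_on UNIV (\<lambda>\<zeta>. \<zeta> :: complex)"
    by (intro smooth_on_holomorphic holomorphic_intros) auto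
  show s: "smooth_on UNIV \<Psi>"
    unfolding \<Psi>_def power2_eq_square by (intro smooth_intros sid open_UNIV)
  have d: "(\<Psi> has_derivative (\<lambda>v. \<Psi> \<zeta> * (- l * (2 * Re (\<zeta> - a) * Re v + 2 * Im (\<zeta> - a) * Im v)))) (at \<zeta>)"
    for \<zeta>
    unfolding \<Psi>_def by (auto intro!: derivative_eq_intros simp: algebra_simps)
  have w: "wz (\<lambda>\<zeta>. complex_of_real (\<Psi> \<zeta>)) \<zeta> = (- of_real l * of_real (\<Psi> \<zeta>)) * cnj (\<zeta> - a)" for \<zeta>
    using wz_at[OF bounded_linear.has_derivative[OF bounded_linear_of_real d[of \<zeta>]]]
    by (simp add: complex_eq_iff algebra_simps)
  have df: "f differentiable (at \<zeta>)" if "smooth_on UNIV f" for f :: "complex \<Rightarrow> complex"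
    using smooth_on_imp_differentiable[OF that] by simp
  have bA: "wzbar (\<lambda>\<zeta>. complex_of_real (\<Psi> \<zeta>)) \<zeta> = cnj (wz (\<lambda>\<zeta>. complex_of_real (\<Psi> \<zeta>)) \<zeta>)"
    using wz_cnj_raw(2)[OF df, of "\<lambda>\<zeta>. complex_of_real (\<Psi> \<zeta>)"]
      smooth_on_of_real[OF open_UNIV s, where 'a = complex] by simp
  have bB: "wzbar (\<lambda>\<zeta>. cnj (\<zeta> - a)) \<zeta> = 1"
  proof -
    have "((\<lambda>\<zeta>. cnj (\<zeta> - a)) has_derivative cnj) (at \<zeta>)"
      by (auto intro!: derivative_eq_intros)
    from wzbar_at[OF this] show ?thesis by simp
  qed
  have bC: "wzbar (\<lambda>\<zeta>. (- of_real l * of_real (\<Psi> \<zeta>)) * cnj (\<zeta> - a)) \<zeta> =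
      (- of_real l * wzbar (\<lambda>\<zeta>. complex_of_real (\<Psi> \<zeta>)) \<zeta>) * cnj (\<zeta> - a) +
      (- of_real l * of_real (\<Psi> \<zeta>)) * wzbar (\<lambda>\<zeta>. cnj (\<zeta> - a)) \<zeta>"
    by (subst wz_mult_raw; (subst wz_cmult)?; (intro df smooth_intros open_UNIV s sid)?) simp
  have "wzbar (wz (\<lambda>\<zeta>. complex_of_real (\<Psi> \<zeta>))) \<zeta> =
     of_real l * of_real l * of_real (\<Psi> \<zeta>) * ((\<zeta> - a) * cnj (\<zeta> - a)) - of_real l * of_real (\<Psi> \<zeta>)"
    unfolding w[abs_def] bC bA bB by (simp add: algebra_simps)
  then show "wzbar (wz (\<lambda>\<zeta>. complex_of_real (\<Psi> \<zeta>))) \<zeta> =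
      of_real (l * (l * (cmod (\<zeta> - a))\<^sup>2 - 1) * \<Psi> \<zeta>)"
    unfolding complex_norm_square[symmetric] by (simp add: algebra_simps)
qed

section \<open>From the weighted inequality to the propagation of zeros\<close>

lemma csquare_dist_bound: "\<zeta> \<in> csquare a h \<Longrightarrow> (cmod (\<zeta> - a))\<^sup>2 \<le> 2 * h\<^sup>2"
proof -
  assume "\<zeta> \<in> csquare a h"
  then have "\<bar>Re (\<zeta> - a)\<bar> \<le> \<bar>h\<bar>" "\<bar>Im (\<zeta> - a)\<bar> \<le> \<bar>h\<bar>"
    by (auto simp: mem_csquare)
  then show ?thesis
    unfolding cmod_power2 abs_le_square_iff by linarith
qed

lemma ball_subset_csquare: "cmod (\<zeta> - a) \<le> h \<Longrightarrow> \<zeta> \<in> csquare a h"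
  using abs_Re_le_cmod[of "\<zeta> - a"] abs_Im_le_cmod[of "\<zeta> - a"] by (auto simp: mem_csquare)

lemma continuous_on_csquare_bounded:
  assumes "continuous_on (csquare a h) (g :: complex \<Rightarrow> real)"
  obtains B where "0 \<le> B" "\<And>\<zeta>. \<zeta> \<in> csquare a h \<Longrightarrow> g \<zeta> \<le> B"
proof -
  have "bounded (g ` csquare a h)"
    by (intro compact_imp_bounded compact_continuous_image assms compact_csquare)
  then obtain B where "\<And>\<zeta>. \<zeta> \<in> csquare a h \<Longrightarrow> norm (g \<zeta>) \<le> B"
    by (auto simp: bounded_iff)
  then have "g \<zeta> \<le> max B 0" if "\<zeta> \<in> csquare a h" for \<zeta>
    using that by force
  then show ?thesis
    using that[of "max B 0"] by auto
qed

lemma integral_square_eq_0D: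
  assumes "0 < h" and c: "continuous_on (csquare a h) (g :: complex \<Rightarrow> real)"
    and nn: "\<And>\<zeta>. \<zeta> \<in> csquare a h \<Longrightarrow> 0 \<le> g \<zeta>"
    and z: "integral (square h) (\<lambda>p. g (on_plane a p)) = 0" and "\<zeta> \<in> csquare a h"
  shows "g \<zeta> = 0"
proof -
  have "\<forall>p\<in>cbox (-h, -h) (h, h). g (on_plane a p) = 0"
  proof (subst integral_cbox_eq_0_iff[symmetric])
    show "continuous_on (cbox (-h, -h) (h, h)) (\<lambda>p. g (on_plane a p))"
      using continuous_on_square[OF c] by (simp add: square_def)
    show "box (-h, -h) (h, h) \<noteq> {}"
      using \<open>0 < h\<close> by (simp add: box_ne_empty Basis_prod_def)
    show "0 \<le> g (on_plane a p)" if "p \<in> cbox (-h, -h) (h, h)" for p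
      using nn that by (force simp: csquare_def square_def)
  qed (use z in \<open>simp add: square_def\<close>)
  then show ?thesis
    using \<open>\<zeta> \<in> csquare a h\<close> by (auto simp: csquare_def square_def)
qed

lemma exp_decay_imp_nonpos:
  assumes "0 < \<epsilon>" "\<And>t. t \<ge> t0 \<Longrightarrow> \<delta> \<le> A * exp (- t * \<epsilon>)"
  shows "\<delta> \<le> (0::real)"
proof (rule tendsto_lowerbound)
  have "filterlim (\<lambda>t. t * \<epsilon>) at_top at_top"
    using filterlim_at_top_mult_tendsto_pos[OF tendsto_const \<open>0 < \<epsilon>\<close> filterlim_ident] .
  then have "((\<lambda>t. exp (- (t * \<epsilon>))) \<longlongrightarrow> 0) at_top"
    by (intro filterlim_compose[OF exp_at_bot] filterlim_compose[OF filterlim_uminus_at_bot_at_top])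
  from tendsto_mult[OF tendsto_const[of A] this]
  show "((\<lambda>t. A * exp (- t * \<epsilon>)) \<longlongrightarrow> 0) at_top"
    by simp
  show "\<forall>\<^sub>F t in at_top. \<delta> \<le> A * exp (- t * \<epsilon>)"
    using eventually_ge_at_top[of t0] by eventually_elim (use assms(2) in auto)
qed simp

text \<open>Differentiating the cutoff adds the term \<open>wzbar \<xi> * u\<close>. Where \<xi> is
  bounded away from zero, this term is again controlled by \<open>\<xi> * u\<close>, so the
  differential inequality survives there with a larger constant.\<close>

lemma carleman_absorb:
  fixes u1 u2 :: "complex \<Rightarrow> complex"
  assumes T: "open T" "csquare a h \<subseteq> T" and u: "smooth_on T u1" "smooth_on T u2"
    and bound: "\<And>\<zeta>. \<zeta> \<in> csquare a h \<Longrightarrow>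
      (cmod (wzbar u1 \<zeta>))\<^sup>2 + (cmod (wzbar u2 \<zeta>))\<^sup>2 \<le> C * ((cmod (u1 \<zeta>))\<^sup>2 + (cmod (u2 \<zeta>))\<^sup>2)"
    and R: "0 \<le> R1" "R1 < h"
    and \<xi>: "smooth_on T \<xi>" "\<And>\<zeta>. cmod (\<zeta> - a) \<le> R1 \<Longrightarrow> m \<le> (cmod (\<xi> \<zeta>))\<^sup>2" "0 < m"
  obtains C1 where "\<And>\<zeta>. cmod (\<zeta> - a) \<le> R1 \<Longrightarrow>
      (cmod (wzbar (\<lambda>\<zeta>. \<xi> \<zeta> * u1 \<zeta>) \<zeta>))\<^sup>2 + (cmod (wzbar (\<lambda>\<zeta>. \<xi> \<zeta> * u2 \<zeta>) \<zeta>))\<^sup>2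
      \<le> C1 * ((cmod (\<xi> \<zeta> * u1 \<zeta>))\<^sup>2 + (cmod (\<xi> \<zeta> * u2 \<zeta>))\<^sup>2)"
proof -
  have "continuous_on (csquare a h) (\<lambda>\<zeta>. (cmod (wzbar \<xi> \<zeta>))\<^sup>2)"
    using continuous_on_subset[OF smooth_on_imp_continuous_on[OF smooth_on_wzbar[OF T(1) \<xi>(1)]] T(2)]
    by (intro continuous_intros)
  then obtain K where K: "0 \<le> K" "\<And>\<zeta>. \<zeta> \<in> csquare a h \<Longrightarrow> (cmod (wzbar \<xi> \<zeta>))\<^sup>2 \<le> K"
    using continuous_on_csquare_bounded by metis
  show ?thesis
  proof (rule that[of "2 * K / m + 2 * C"])
    fix \<zeta> assume \<zeta>: "cmod (\<zeta> - a) \<le> R1"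
    then have in_sq: "\<zeta> \<in> csquare a h"
      using R by (intro ball_subset_csquare) auto
    then have "\<zeta> \<in> T" using T by auto
    have df: "f differentiable (at \<zeta>)" if "smooth_on T f" for f :: "complex \<Rightarrow> complex"
      using smooth_on_imp_differentiable[OF that \<open>\<zeta> \<in> T\<close>] .
    have two: "(cmod (x + y))\<^sup>2 \<le> 2 * (cmod x)\<^sup>2 + 2 * (cmod y)\<^sup>2" for x y
    proof -
      have "(cmod (x + y))\<^sup>2 \<le> (cmod x + cmod y)\<^sup>2"
        by (intro power_mono norm_triangle_ineq) auto
      also have "\<dots> \<le> 2 * (cmod x)\<^sup>2 + 2 * (cmod y)\<^sup>2"
        using zero_le_power2[of "cmod x - cmod y"] by (simp add: power2_eq_square algebra_simps)
      finally show ?thesis .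
    qed
    define X where "X = (cmod (\<xi> \<zeta>))\<^sup>2"
    define U where "U = (cmod (u1 \<zeta>))\<^sup>2 + (cmod (u2 \<zeta>))\<^sup>2"
    have X: "m \<le> X" and "0 \<le> U"
      using \<xi>(2)[OF \<zeta>] by (auto simp: X_def U_def)
    have one: "(cmod (wzbar (\<lambda>\<zeta>. \<xi> \<zeta> * f \<zeta>) \<zeta>))\<^sup>2 \<le> 2 * (K * (cmod (f \<zeta>))\<^sup>2) + 2 * (X * (cmod (wzbar f \<zeta>))\<^sup>2)"
      if f: "smooth_on T f" for f
    proof -
      have "(cmod (wzbar (\<lambda>\<zeta>. \<xi> \<zeta> * f \<zeta>) \<zeta>))\<^sup>2 \<le>
          2 * ((cmod (wzbar \<xi> \<zeta>))\<^sup>2 * (cmod (f \<zeta>))\<^sup>2) + 2 * (X * (cmod (wzbar f \<zeta>))\<^sup>2)"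
        using two[of "wzbar \<xi> \<zeta> * f \<zeta>" "\<xi> \<zeta> * wzbar f \<zeta>"] wz_mult_raw(2)[OF df[OF \<xi>(1)] df[OF f]]
        by (simp add: X_def norm_mult power_mult_distrib)
      then show ?thesis
        using mult_right_mono[OF K(2)[OF in_sq], of "(cmod (f \<zeta>))\<^sup>2"] by auto
    qed
    have "(cmod (wzbar (\<lambda>\<zeta>. \<xi> \<zeta> * u1 \<zeta>) \<zeta>))\<^sup>2 + (cmod (wzbar (\<lambda>\<zeta>. \<xi> \<zeta> * u2 \<zeta>) \<zeta>))\<^sup>2
       \<le> 2 * (K * U) + 2 * (X * ((cmod (wzbar u1 \<zeta>))\<^sup>2 + (cmod (wzbar u2 \<zeta>))\<^sup>2))"
      using one[OF u(1)] one[OF u(2)] by (simp add: U_def algebra_simps)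
    also have "\<dots> \<le> 2 * (K * U) + 2 * (X * (C * U))"
      using bound[OF in_sq] X \<xi>(3) by (intro add_left_mono mult_left_mono) (auto simp: U_def)
    also have "K * U \<le> K / m * (X * U)"
    proof -
      have "1 \<le> X / m" using X \<xi>(3) by simp
      from mult_left_mono[OF this, of "K * U"] K(1) \<open>0 \<le> U\<close> show ?thesis by (simp add: mult_ac)
    qed
    then have "2 * (K * U) + 2 * (X * (C * U)) \<le> (2 * K / m + 2 * C) * (X * U)"
    proof -
      assume "K * U \<le> K / m * (X * U)"
      moreover have "(2 * K / m + 2 * C) * (X * U) = 2 * (K / m * (X * U)) + 2 * (X * (C * U))"
        by (simp add: algebra_simps)
      ultimately show ?thesis by simp
    qed
    also have "X * U = (cmod (\<xi> \<zeta> * u1 \<zeta>))\<^sup>2 + (cmod (\<xi> \<zeta> * u2 \<zeta>))\<^sup>2"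
      by (simp add: X_def U_def norm_mult power_mult_distrib algebra_simps)
    finally show "(cmod (wzbar (\<lambda>\<zeta>. \<xi> \<zeta> * u1 \<zeta>) \<zeta>))\<^sup>2 + (cmod (wzbar (\<lambda>\<zeta>. \<xi> \<zeta> * u2 \<zeta>) \<zeta>))\<^sup>2
      \<le> (2 * K / m + 2 * C) * ((cmod (\<xi> \<zeta> * u1 \<zeta>))\<^sup>2 + (cmod (\<xi> \<zeta> * u2 \<zeta>))\<^sup>2)" .
  qed
qed

text \<open>The cutoff makes the weighted inequality applicable, at the price of an error outside
  the disc of radius \<open>R1\<close>. For the weight exp (t e), which decreases with the distance
  from a, this error is at most of order exp (t E1), while mass inside the disc of radius
  \<open>R0\<close> counts with at least exp (t E0), where E0 > E1. Letting t grow forces that mass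
  to vanish.\<close>

theorem unique_continuation:
  fixes u1 u2 :: "complex \<Rightarrow> complex"
  assumes T: "open T" "csquare a h \<subseteq> T" and u: "smooth_on T u1" "smooth_on T u2"
    and bound: "\<And>\<zeta>. \<zeta> \<in> csquare a h \<Longrightarrow>
      (cmod (wzbar u1 \<zeta>))\<^sup>2 + (cmod (wzbar u2 \<zeta>))\<^sup>2 \<le> C * ((cmod (u1 \<zeta>))\<^sup>2 + (cmod (u2 \<zeta>))\<^sup>2)"
    and "0 < r" and zero: "\<And>\<zeta>. cmod (\<zeta> - a) < r \<Longrightarrow> u1 \<zeta> = 0 \<and> u2 \<zeta> = 0"
    and \<zeta>0: "cmod (\<zeta>0 - a) < h"
  shows "u1 \<zeta>0 = 0 \<and> u2 \<zeta>0 = 0"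
proof -
  have h: "0 < h" using \<zeta>0 norm_ge_zero[of "\<zeta>0 - a"] by linarith
  obtain R0 where R0: "cmod (\<zeta>0 - a) < R0" "R0 < h" using dense[OF \<zeta>0] by blast
  obtain R1 where R1: "R0 < R1" "R1 < h" using dense[OF R0(2)] by blast
  have R0p: "0 < R0" using R0 norm_ge_zero[of "\<zeta>0 - a"] by linarith
  \<comment> \<open>Vanishes on the sides of the square and is bounded below on the disc of radius
    \<open>R1 < h\<close>.\<close>
  define \<xi> where "\<xi> \<zeta> = complex_of_real ((h\<^sup>2 - (Re (\<zeta> - a))\<^sup>2) * (h\<^sup>2 - (Im (\<zeta> - a))\<^sup>2))" for \<zeta>
  have sid: "smooth_on T (\<lambda>\<zeta>. \<zeta> :: complex)"
    by (intro smooth_on_holomorphic holomorphic_intros T)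
  have s\<xi>: "smooth_on T \<xi>"
    unfolding \<xi>_def power2_eq_square by (intro smooth_intros sid T)
  define m where "m = ((h\<^sup>2 - R1\<^sup>2) * (h\<^sup>2 - R1\<^sup>2))\<^sup>2"
  have hR: "0 < h\<^sup>2 - R1\<^sup>2"
    using R1 R0p by (simp add: power_strict_mono)
  then have "0 < m" by (simp add: m_def)
  have m: "m \<le> (cmod (\<xi> \<zeta>))\<^sup>2" if "cmod (\<zeta> - a) \<le> R1" for \<zeta>
  proof -
    have "(Re (\<zeta> - a))\<^sup>2 \<le> R1\<^sup>2" "(Im (\<zeta> - a))\<^sup>2 \<le> R1\<^sup>2"
      using that abs_Re_le_cmod[of "\<zeta> - a"] abs_Im_le_cmod[of "\<zeta> - a"]
      by (auto simp: power2_le_iff_abs_le simp flip: abs_le_square_iff intro!: abs_le_square_iff[THEN iffD1])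
    then have "(h\<^sup>2 - R1\<^sup>2) * (h\<^sup>2 - R1\<^sup>2) \<le> (h\<^sup>2 - (Re (\<zeta> - a))\<^sup>2) * (h\<^sup>2 - (Im (\<zeta> - a))\<^sup>2)"
      using hR by (intro mult_mono) auto
    then have "m \<le> ((h\<^sup>2 - (Re (\<zeta> - a))\<^sup>2) * (h\<^sup>2 - (Im (\<zeta> - a))\<^sup>2))\<^sup>2"
      unfolding m_def using hR by (intro power_mono) auto
    then show ?thesis
      by (simp only: \<xi>_def norm_of_real power2_abs)
  qed
  define v1 where "v1 \<zeta> = \<xi> \<zeta> * u1 \<zeta>" for \<zeta>
  define v2 where "v2 \<zeta> = \<xi> \<zeta> * u2 \<zeta>" for \<zeta>
  have sv: "smooth_on T v1" "smooth_on T v2"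
    unfolding v1_def v2_def by (intro smooth_intros T s\<xi> u)+
  have "\<xi> \<zeta> = 0" if "\<bar>Re (\<zeta> - a)\<bar> = h \<or> \<bar>Im (\<zeta> - a)\<bar> = h" for \<zeta>
  proof -
    have "h\<^sup>2 - (Re (\<zeta> - a))\<^sup>2 = 0 \<or> h\<^sup>2 - (Im (\<zeta> - a))\<^sup>2 = 0"
      using that by (metis power2_abs diff_self)
    then show ?thesis
      by (simp only: \<xi>_def mult_eq_0_iff of_real_eq_0_iff)
  qed
  then have vb: "vanishes_on_boundary a h v1" "vanishes_on_boundary a h v2"
    by (auto simp: vanishes_on_boundary_def v1_def v2_def simp del: minus_complex.simps)
  define w where "w \<zeta> = (cmod (v1 \<zeta>))\<^sup>2 + (cmod (v2 \<zeta>))\<^sup>2" for \<zeta>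
  define b where "b \<zeta> = (cmod (wzbar v1 \<zeta>))\<^sup>2 + (cmod (wzbar v2 \<zeta>))\<^sup>2" for \<zeta>
  obtain C1 where C1: "\<And>\<zeta>. cmod (\<zeta> - a) \<le> R1 \<Longrightarrow> b \<zeta> \<le> C1 * w \<zeta>"
    using carleman_absorb[OF T u bound order_trans[OF less_imp_le[OF R0p] less_imp_le[OF R1(1)]]
        R1(2) s\<xi> m \<open>0 < m\<close>]
    unfolding b_def w_def v1_def[abs_def] v2_def[abs_def] by blast
  have ct: "continuous_on (csquare a h) f" if "smooth_on T f" for f :: "complex \<Rightarrow> complex"
    using continuous_on_subset[OF smooth_on_imp_continuous_on[OF that] T(2)] .
  have cw: "continuous_on (csquare a h) w" and cb: "continuous_on (csquare a h) b"
    unfolding w_def b_def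
    by (intro continuous_intros ct[OF sv(1)] ct[OF sv(2)] ct[OF smooth_on_wzbar[OF T(1) sv(1)]]
        ct[OF smooth_on_wzbar[OF T(1) sv(2)]])+
  have w0: "0 \<le> w \<zeta>" for \<zeta> by (simp add: w_def)
  obtain B where B: "0 \<le> B" "\<And>\<zeta>. \<zeta> \<in> csquare a h \<Longrightarrow> b \<zeta> \<le> B"
    using continuous_on_csquare_bounded[OF cb] by metis
  \<comment> \<open>Outside the disc of radius r, on which \<open>u1\<close> and \<open>u2\<close>
    vanish anyway, this value makes l |\<zeta> - a|^2 at least 2, so the factor l |\<zeta> - a|^2 -
    1 from \<open>gaussian_weight\<close> is at least 1 there.\<close>
  define l where "l = 2 / r\<^sup>2"
  have l: "0 < l" using \<open>0 < r\<close> by (simp add: l_def)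
  define e where "e \<zeta> = exp (- l * ((Re (\<zeta> - a))\<^sup>2 + (Im (\<zeta> - a))\<^sup>2))" for \<zeta>
  have e_eq: "e \<zeta> = exp (- l * (cmod (\<zeta> - a))\<^sup>2)" for \<zeta>
    by (simp only: e_def cmod_power2)
  \<comment> \<open>A lower bound of l e over the square, whose points have squared distance at most
    2 h^2 from a.\<close>
  define c where "c = l * exp (- l * (2 * h\<^sup>2))"
  have c: "0 < c" using l by (simp add: c_def)
  have sub: "t * c * w \<zeta> \<le> l * (l * (cmod (\<zeta> - a))\<^sup>2 - 1) * (t * e \<zeta>) * w \<zeta>"
    if "\<zeta> \<in> csquare a h" "0 \<le> t" for \<zeta> t
  proof (cases "cmod (\<zeta> - a) < r")
    case True
    then have "w \<zeta> = 0" using zero by (simp add: w_def v1_def v2_def)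
    then show ?thesis by simp
  next
    case False
    then have "r\<^sup>2 \<le> (cmod (\<zeta> - a))\<^sup>2"
      using \<open>0 < r\<close> by (intro power_mono) auto
    then have "l * r\<^sup>2 \<le> l * (cmod (\<zeta> - a))\<^sup>2"
      using l by (intro mult_left_mono) auto
    moreover have "l * r\<^sup>2 = 2" using \<open>0 < r\<close> by (simp add: l_def)
    ultimately have "1 \<le> l * (cmod (\<zeta> - a))\<^sup>2 - 1" by simp
    moreover have "exp (- l * (2 * h\<^sup>2)) \<le> e \<zeta>"
      unfolding e_eq using csquare_dist_bound[OF that(1)] l by simp
    ultimately have "1 * exp (- l * (2 * h\<^sup>2)) \<le> (l * (cmod (\<zeta> - a))\<^sup>2 - 1) * e \<zeta>"
      by (intro mult_mono) auto
    then have "t * l * (1 * exp (- l * (2 * h\<^sup>2))) * w \<zeta> \<le> t * l * ((l * (cmod (\<zeta> - a))\<^sup>2 - 1) * e \<zeta>) * w \<zeta>"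
      using l \<open>0 \<le> t\<close> w0 by (intro mult_right_mono mult_left_mono) auto
    then show ?thesis by (simp add: c_def mult_ac)
  qed
  \<comment> \<open>A continuous bump instead of the indicator of the disc of radius
    \<open>R0\<close>, so that only continuous functions are integrated.\<close>
  define \<eta> where "\<eta> \<zeta> = max 0 (1 - (cmod (\<zeta> - a))\<^sup>2 / R0\<^sup>2)" for \<zeta>
  define E0 where "E0 = exp (- l * R0\<^sup>2)"
  define E1 where "E1 = exp (- l * R1\<^sup>2)"
  define \<delta> where "\<delta> = integral (square h) (\<lambda>p. \<eta> (on_plane a p) * w (on_plane a p))"
  define ar where "ar = integral (square h) (\<lambda>p. 1 :: real)"
  have c\<eta>: "continuous_on (csquare a h) (\<lambda>\<zeta>. \<eta> \<zeta> * w \<zeta>)"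
    unfolding \<eta>_def by (intro continuous_intros cw) (use R0p in auto)
  have "E1 < E0"
    using R1 R0p l by (simp add: E0_def E1_def power_strict_mono)
  \<comment> \<open>The threshold makes t c exceed \<open>C1\<close> by at least 1: the zero order
    term then absorbs the bound \<open>C1 * w\<close> and still leaves \<open>- w\<close>.\<close>
  have key: "\<delta> \<le> (B * ar) * exp (- t * (E0 - E1))" if t: "t \<ge> max 0 ((C1 + 1) / c)" for t
  proof -
    have t0: "0 \<le> t" and "C1 + 1 \<le> t * c"
      using t c by (auto simp: pos_divide_le_eq)
    define q where "q \<zeta> = exp (t * e \<zeta>) * (b \<zeta> - t * c * w \<zeta>)" for \<zeta>
    have s\<Psi>: "smooth_on T (\<lambda>\<zeta>. t * e \<zeta>)" and
      L\<Psi>: "Re (wzbar (wz (\<lambda>\<zeta>. complex_of_real (t * e \<zeta>))) \<zeta>) = l * (l * (cmod (\<zeta> - a))\<^sup>2 - 1) * (t * e \<zeta>)" for \<zeta>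
      using smooth_on_subset[OF gaussian_weight(1)] gaussian_weight(2)[of t l a \<zeta>]
      by (auto simp: e_def simp del: of_real_mult)
    have ce: "continuous_on (csquare a h) (\<lambda>\<zeta>. t * e \<zeta>)"
      using continuous_on_subset[OF smooth_on_imp_continuous_on[OF s\<Psi>] T(2)] .
    have cq: "continuous_on (csquare a h) q"
      unfolding q_def by (intro continuous_intros ce cb cw)
    let ?Q = "\<lambda>v \<zeta>. exp (t * e \<zeta>) * ((cmod (wzbar v \<zeta>))\<^sup>2 -
        l * (l * (cmod (\<zeta> - a))\<^sup>2 - 1) * (t * e \<zeta>) * (cmod (v \<zeta>))\<^sup>2)"
    have cQ: "continuous_on (csquare a h) (?Q v)" if "smooth_on T v" for v
      by (intro continuous_intros ce ct[OF that] ct[OF smooth_on_wzbar[OF T(1) that]])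
    have pos: "0 \<le> integral (square h) (\<lambda>p. ?Q v (on_plane a p))"
      if "smooth_on T v" "vanishes_on_boundary a h v" for v
      using carleman_inequality[OF less_imp_le[OF h] T that s\<Psi>] unfolding L\<Psi> .
    have "0 \<le> integral (square h) (\<lambda>p. ?Q v1 (on_plane a p)) + integral (square h) (\<lambda>p. ?Q v2 (on_plane a p))"
      using pos[OF sv(1) vb(1)] pos[OF sv(2) vb(2)] by simp
    also have "\<dots> = integral (square h) (\<lambda>p. ?Q v1 (on_plane a p) + ?Q v2 (on_plane a p))"
      by (rule integral_add[symmetric]) (rule integrable_on_square[OF cQ[OF sv(1)]]
          integrable_on_square[OF cQ[OF sv(2)]])+
    also have "\<dots> \<le> integral (square h) (\<lambda>p. q (on_plane a p))"
    proof (rule integral_le)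
      show "(\<lambda>p. ?Q v1 (on_plane a p) + ?Q v2 (on_plane a p)) integrable_on square h"
        by (intro integrable_add integrable_on_square[OF cQ[OF sv(1)]] integrable_on_square[OF cQ[OF sv(2)]])
      show "(\<lambda>p. q (on_plane a p)) integrable_on square h"
        by (rule integrable_on_square[OF cq])
      fix p assume "p \<in> square h"
      then have p: "on_plane a p \<in> csquare a h" by (auto simp: csquare_def)
      let ?\<zeta> = "on_plane a p"
      have "?Q v1 ?\<zeta> + ?Q v2 ?\<zeta> = exp (t * e ?\<zeta>) * (b ?\<zeta> -
          l * (l * (cmod (?\<zeta> - a))\<^sup>2 - 1) * (t * e ?\<zeta>) * w ?\<zeta>)"
        by (simp add: b_def w_def algebra_simps)
      also have "\<dots> \<le> q ?\<zeta>"
        unfolding q_def using sub[OF p t0] by (intro mult_left_mono) auto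
      finally show "?Q v1 ?\<zeta> + ?Q v2 ?\<zeta> \<le> q ?\<zeta>" .
    qed
    also have "\<dots> \<le> integral (square h) (\<lambda>p. B * exp (t * E1) * 1 -
        exp (t * E0) * (\<eta> (on_plane a p) * w (on_plane a p)))"
    proof (rule integral_le)
      show "(\<lambda>p. q (on_plane a p)) integrable_on square h"
        by (rule integrable_on_square[OF cq])
      show "(\<lambda>p. B * exp (t * E1) * 1 - exp (t * E0) * (\<eta> (on_plane a p) * w (on_plane a p)))
          integrable_on square h"
        by (intro integrable_on_square[where g = "\<lambda>\<zeta>. B * exp (t * E1) * 1 - exp (t * E0) * (\<eta> \<zeta> * w \<zeta>)"]
            continuous_intros c\<eta>)
      fix p assume "p \<in> square h"
      then have p: "on_plane a p \<in> csquare a h" by (auto simp: csquare_def)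
      define \<zeta> where "\<zeta> = on_plane a p"
      have "q \<zeta> \<le> B * exp (t * E1) * 1 - exp (t * E0) * (\<eta> \<zeta> * w \<zeta>)"
      proof (cases "cmod (\<zeta> - a) \<le> R1")
        case True
        have "b \<zeta> - t * c * w \<zeta> \<le> (C1 - t * c) * w \<zeta>"
          using C1[OF True] by (simp add: algebra_simps)
        also have "\<dots> \<le> (-1) * w \<zeta>"
          using \<open>C1 + 1 \<le> t * c\<close> w0 by (intro mult_right_mono) auto
        finally have "q \<zeta> \<le> exp (t * e \<zeta>) * (- w \<zeta>)"
          unfolding q_def by (intro mult_left_mono) auto
        also have "exp (t * e \<zeta>) * (- w \<zeta>) \<le> - (exp (t * E0) * (\<eta> \<zeta> * w \<zeta>))"
        proof (cases "cmod (\<zeta> - a) \<le> R0")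
          case True
          then have "(cmod (\<zeta> - a))\<^sup>2 \<le> R0\<^sup>2" by (intro power_mono) auto
          then have "E0 \<le> e \<zeta>"
            using l by (simp add: E0_def e_eq)
          then have "exp (t * E0) \<le> exp (t * e \<zeta>)"
            using t0 by (simp add: mult_left_mono)
          moreover have "\<eta> \<zeta> * w \<zeta> \<le> 1 * w \<zeta>" "0 \<le> \<eta> \<zeta> * w \<zeta>"
            using w0 by (intro mult_right_mono mult_nonneg_nonneg; simp add: \<eta>_def)+
          ultimately have "exp (t * E0) * (\<eta> \<zeta> * w \<zeta>) \<le> exp (t * e \<zeta>) * (1 * w \<zeta>)"
            by - (rule mult_mono, auto)
          then show ?thesis by simp
        next
          case False
          then have "R0\<^sup>2 \<le> (cmod (\<zeta> - a))\<^sup>2" using R0p by (intro power_mono) auto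
          then have "\<eta> \<zeta> = 0" using R0p by (simp add: \<eta>_def)
          then show ?thesis using w0 by simp
        qed
        also have "\<dots> \<le> B * exp (t * E1) * 1 - exp (t * E0) * (\<eta> \<zeta> * w \<zeta>)"
          using B(1) by simp
        finally show ?thesis .
      next
        case False
        then have sq: "R1\<^sup>2 \<le> (cmod (\<zeta> - a))\<^sup>2" "R0\<^sup>2 \<le> (cmod (\<zeta> - a))\<^sup>2"
          using R0p R1 by (intro power_mono; simp)+
        have "\<eta> \<zeta> = 0" using sq R0p by (simp add: \<eta>_def)
        have "e \<zeta> \<le> E1" using sq l by (simp add: E1_def e_eq)
        then have "exp (t * e \<zeta>) \<le> exp (t * E1)"
          using t0 by (simp add: mult_left_mono)
        moreover have "b \<zeta> - t * c * w \<zeta> \<le> B"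
          using B(2)[OF p] t0 c w0[of \<zeta>] by (simp add: \<zeta>_def add_increasing2 diff_le_eq)
        ultimately have "q \<zeta> \<le> exp (t * E1) * B"
          unfolding q_def using B(1)
          by (meson exp_ge_zero mult_left_mono mult_right_mono order_trans)
        then show ?thesis
          using \<open>\<eta> \<zeta> = 0\<close> by (simp add: mult.commute)
      qed
      then show "q (on_plane a p) \<le> B * exp (t * E1) * 1 - exp (t * E0) * (\<eta> (on_plane a p) * w (on_plane a p))"
        by (simp add: \<zeta>_def)
    qed
    also have "\<dots> = B * exp (t * E1) * ar - exp (t * E0) * \<delta>"
    proof -
      have "(\<lambda>p. 1 :: real) integrable_on square h"
        using integrable_on_square[of a h "\<lambda>p. 1 :: real"] by simp
      from has_integral_diff[OF
          has_integral_mult_right[OF integrable_integral[OF this], of "B * exp (t * E1)"]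
          has_integral_mult_right[OF integrable_integral[OF integrable_on_square[OF c\<eta>]], of "exp (t * E0)"]]
      show ?thesis
        unfolding ar_def \<delta>_def by (rule integral_unique)
    qed
    finally have "exp (t * E0) * \<delta> \<le> B * ar * exp (t * E1)"
      by (simp add: mult_ac)
    then have "\<delta> \<le> B * ar * exp (t * E1) / exp (t * E0)"
      by (simp add: pos_le_divide_eq mult.commute)
    also have "\<dots> = (B * ar) * exp (- t * (E0 - E1))"
      by (simp add: exp_diff[symmetric] algebra_simps flip: times_divide_eq_right)
    finally show ?thesis .
  qed
  have "\<delta> \<le> 0"
    by (rule exp_decay_imp_nonpos[where \<epsilon> = "E0 - E1" and ?t0.0 = "max 0 ((C1 + 1) / c)"])
      (use \<open>E1 < E0\<close> in simp, erule key)
  have nn: "0 \<le> \<eta> \<zeta> * w \<zeta>" for \<zeta>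
    using w0 by (simp add: \<eta>_def)
  have "0 \<le> \<delta>"
    unfolding \<delta>_def by (intro integral_nonneg integrable_on_square[OF c\<eta>] nn)
  have in_sq: "\<zeta>0 \<in> csquare a h"
    using \<zeta>0 by (intro ball_subset_csquare) auto
  have "\<eta> \<zeta>0 * w \<zeta>0 = 0"
    using \<open>\<delta> \<le> 0\<close> \<open>0 \<le> \<delta>\<close> by (intro integral_square_eq_0D[OF h c\<eta> nn _ in_sq]) (simp add: \<delta>_def)
  moreover have "(cmod (\<zeta>0 - a))\<^sup>2 < R0\<^sup>2"
    using R0 by (intro power_strict_mono) auto
  then have "\<eta> \<zeta>0 \<noteq> 0"
    using R0p by (auto simp: \<eta>_def)
  ultimately have "v1 \<zeta>0 = 0" "v2 \<zeta>0 = 0"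
    by (auto simp: w_def add_nonneg_eq_0_iff)
  moreover have "\<xi> \<zeta>0 \<noteq> 0"
    using m[of \<zeta>0] R0 R1 \<open>0 < m\<close> by auto
  ultimately show ?thesis
    by (simp add: v1_def v2_def)
qed

subsection \<open>Canonical lifts\<close>

lemma wz_const_on:
  assumes "open T" "\<zeta> \<in> T" "\<And>w. w \<in> T \<Longrightarrow> g w = c"
  shows "wz g \<zeta> = 0" "wzbar g \<zeta> = 0"
  using wz_cong_open[OF assms(1,2), of g "\<lambda>_. c"] assms(3) by simp_all

lemma VC_memI:
  "cpx (Y \<zeta>) \<in> VC Y \<zeta>" "dz (cpx \<circ> Y) \<zeta> \<in> VC Y \<zeta>" "dzbar (cpx \<circ> Y) \<zeta> \<in> VC Y \<zeta>"
  "dzbar (dz (cpx \<circ> Y)) \<zeta> \<in> VC Y \<zeta>"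
proof -
  have "1 *\<^sub>C cpx (Y \<zeta>) + 0 *\<^sub>C dz (cpx \<circ> Y) \<zeta> + 0 *\<^sub>C dzbar (cpx \<circ> Y) \<zeta>
      + 0 *\<^sub>C dzbar (dz (cpx \<circ> Y)) \<zeta> \<in> VC Y \<zeta>"
    "0 *\<^sub>C cpx (Y \<zeta>) + 1 *\<^sub>C dz (cpx \<circ> Y) \<zeta> + 0 *\<^sub>C dzbar (cpx \<circ> Y) \<zeta>
      + 0 *\<^sub>C dzbar (dz (cpx \<circ> Y)) \<zeta> \<in> VC Y \<zeta>"
    "0 *\<^sub>C cpx (Y \<zeta>) + 0 *\<^sub>C dz (cpx \<circ> Y) \<zeta> + 1 *\<^sub>C dzbar (cpx \<circ> Y) \<zeta>
      + 0 *\<^sub>C dzbar (dz (cpx \<circ> Y)) \<zeta> \<in> VC Y \<zeta>"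
    "0 *\<^sub>C cpx (Y \<zeta>) + 0 *\<^sub>C dz (cpx \<circ> Y) \<zeta> + 0 *\<^sub>C dzbar (cpx \<circ> Y) \<zeta>
      + 1 *\<^sub>C dzbar (dz (cpx \<circ> Y)) \<zeta> \<in> VC Y \<zeta>"
    unfolding VC_def by blast+
  then show "cpx (Y \<zeta>) \<in> VC Y \<zeta>" "dz (cpx \<circ> Y) \<zeta> \<in> VC Y \<zeta>" "dzbar (cpx \<circ> Y) \<zeta> \<in> VC Y \<zeta>"
    "dzbar (dz (cpx \<circ> Y)) \<zeta> \<in> VC Y \<zeta>"
    by simp_all
qed

lemma VC_cscale: "u \<in> VC Y \<zeta> \<Longrightarrow> c *\<^sub>C u \<in> VC Y \<zeta>"
proof -
  assume "u \<in> VC Y \<zeta>"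
  then obtain a b e d where u: "u = a *\<^sub>C cpx (Y \<zeta>) + b *\<^sub>C dz (cpx \<circ> Y) \<zeta> + e *\<^sub>C dzbar (cpx \<circ> Y) \<zeta>
      + d *\<^sub>C dzbar (dz (cpx \<circ> Y)) \<zeta>"
    by (auto simp: VC_def)
  have "c *\<^sub>C u = (c * a) *\<^sub>C cpx (Y \<zeta>) + (c * b) *\<^sub>C dz (cpx \<circ> Y) \<zeta> + (c * e) *\<^sub>C dzbar (cpx \<circ> Y) \<zeta>
      + (c * d) *\<^sub>C dzbar (dz (cpx \<circ> Y)) \<zeta>"
    unfolding u by (simp add: cscale_add_right)
  then show ?thesis unfolding VC_def by blast
qed

lemma VC_add: "u \<in> VC Y \<zeta> \<Longrightarrow> v \<in> VC Y \<zeta> \<Longrightarrow> u + v \<in> VC Y \<zeta>"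
proof -
  assume "u \<in> VC Y \<zeta>" "v \<in> VC Y \<zeta>"
  then obtain a b e d a' b' e' d' where
    "u = a *\<^sub>C cpx (Y \<zeta>) + b *\<^sub>C dz (cpx \<circ> Y) \<zeta> + e *\<^sub>C dzbar (cpx \<circ> Y) \<zeta>
      + d *\<^sub>C dzbar (dz (cpx \<circ> Y)) \<zeta>"
    "v = a' *\<^sub>C cpx (Y \<zeta>) + b' *\<^sub>C dz (cpx \<circ> Y) \<zeta> + e' *\<^sub>C dzbar (cpx \<circ> Y) \<zeta>
      + d' *\<^sub>C dzbar (dz (cpx \<circ> Y)) \<zeta>"
    by (auto simp: VC_def)
  then have "u + v = (a + a') *\<^sub>C cpx (Y \<zeta>) + (b + b') *\<^sub>C dz (cpx \<circ> Y) \<zeta>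
      + (e + e') *\<^sub>C dzbar (cpx \<circ> Y) \<zeta> + (d + d') *\<^sub>C dzbar (dz (cpx \<circ> Y)) \<zeta>"
    by (simp add: cscale_add_left)
  then show ?thesis unfolding VC_def by blast
qed

lemma VC_minus: "u \<in> VC Y \<zeta> \<Longrightarrow> - u \<in> VC Y \<zeta>"
  using VC_cscale[of u Y \<zeta> "-1"] by (simp add: cscale_minus_left)

lemma VC_diff: "u \<in> VC Y \<zeta> \<Longrightarrow> v \<in> VC Y \<zeta> \<Longrightarrow> u - v \<in> VC Y \<zeta>"
  using VC_add[OF _ VC_minus, of u Y \<zeta> v] by simp

lemma VC_perp_iff:
  "w \<in> VC_perp Y \<zeta> \<longleftrightarrow> mink w (cpx (Y \<zeta>)) = 0 \<and> mink w (dz (cpx \<circ> Y) \<zeta>) = 0 \<and>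
     mink w (dzbar (cpx \<circ> Y) \<zeta>) = 0 \<and> mink w (dzbar (dz (cpx \<circ> Y)) \<zeta>) = 0"
proof
  assume "w \<in> VC_perp Y \<zeta>"
  then show "mink w (cpx (Y \<zeta>)) = 0 \<and> mink w (dz (cpx \<circ> Y) \<zeta>) = 0 \<and>
     mink w (dzbar (cpx \<circ> Y) \<zeta>) = 0 \<and> mink w (dzbar (dz (cpx \<circ> Y)) \<zeta>) = 0"
    unfolding VC_perp_def using VC_memI[of Y \<zeta>] by blast
next
  assume "mink w (cpx (Y \<zeta>)) = 0 \<and> mink w (dz (cpx \<circ> Y) \<zeta>) = 0 \<and>
     mink w (dzbar (cpx \<circ> Y) \<zeta>) = 0 \<and> mink w (dzbar (dz (cpx \<circ> Y)) \<zeta>) = 0"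
  then show "w \<in> VC_perp Y \<zeta>"
    by (auto simp: VC_perp_def VC_def mink_simps)
qed

lemma VC_perp_cscale: "w \<in> VC_perp Y \<zeta> \<Longrightarrow> c *\<^sub>C w \<in> VC_perp Y \<zeta>"
  by (simp add: VC_perp_iff mink_simps)

lemma VC_perp_diff: "w \<in> VC_perp Y \<zeta> \<Longrightarrow> w' \<in> VC_perp Y \<zeta> \<Longrightarrow> w - w' \<in> VC_perp Y \<zeta>"
  by (simp add: VC_perp_iff mink_simps)

text \<open>The canonical lift detached from its surface. In the Darboux case the lift of the second
  surface becomes an instance as well.\<close>

locale lift =
  fixes \<Omega> :: "complex set" and Y :: "complex \<Rightarrow> (real, 'n::finite) mink_vec"
  assumes op: "open \<Omega>" and sY: "smooth_on \<Omega> Y"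
    and null: "\<And>\<zeta>. \<zeta> \<in> \<Omega> \<Longrightarrow> mink (Y \<zeta>) (Y \<zeta>) = 0"
    and conformal: "\<And>\<zeta>. \<zeta> \<in> \<Omega> \<Longrightarrow> mink (dz (cpx \<circ> Y) \<zeta>) (dz (cpx \<circ> Y) \<zeta>) = 0"
    and metric: "\<And>\<zeta>. \<zeta> \<in> \<Omega> \<Longrightarrow> mink (dz (cpx \<circ> Y) \<zeta>) (dzbar (cpx \<circ> Y) \<zeta>) = 1/2"
begin

abbreviation "y \<equiv> cpx \<circ> Y"

lemma smooth_y [smooth_intros]: "smooth_on \<Omega> y"
  unfolding o_def by (intro smooth_intros op sY)

lemma smooth_imp_diff: "smooth_on \<Omega> g \<Longrightarrow> \<zeta> \<in> \<Omega> \<Longrightarrow> g differentiable (at \<zeta>)"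
  using smooth_on_imp_differentiable by blast

lemma dz_conj: "\<zeta> \<in> \<Omega> \<Longrightarrow> cnjv (dz y \<zeta>) = dzbar y \<zeta>"
  using dz_cnjv_raw(2)[OF smooth_imp_diff[OF smooth_y], of \<zeta>] by (simp add: o_def)

lemma dzbar_conj: "\<zeta> \<in> \<Omega> \<Longrightarrow> cnjv (dzbar y \<zeta>) = dz y \<zeta>"
  by (simp flip: dz_conj)

lemma commute: "\<zeta> \<in> \<Omega> \<Longrightarrow> dz (dzbar y) \<zeta> = dzbar (dz y) \<zeta>"
  using dz_dzbar_commute[OF op _ smooth_y] by simp

lemma dzzbar_real: "\<zeta> \<in> \<Omega> \<Longrightarrow> cnjv (dzbar (dz y) \<zeta>) = dzbar (dz y) \<zeta>"
proof -
  assume z: "\<zeta> \<in> \<Omega>"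
  have "dzbar (dz y) \<zeta> = dzbar (\<lambda>\<zeta>. cnjv (dzbar y \<zeta>)) \<zeta>"
    by (rule dz_cong_open(2)[OF op z]) (simp add: dzbar_conj)
  also have "\<dots> = cnjv (dz (dzbar y) \<zeta>)"
    by (rule dz_cnjv_raw(2)) (intro smooth_imp_diff z smooth_intros op)
  finally show ?thesis
    by (simp add: commute[OF z])
qed

lemma dzz_conj: "\<zeta> \<in> \<Omega> \<Longrightarrow> cnjv (dz (dz y) \<zeta>) = dzbar (dzbar y) \<zeta>"
proof -
  assume z: "\<zeta> \<in> \<Omega>"
  have "dzbar (dzbar y) \<zeta> = dzbar (\<lambda>\<zeta>. cnjv (dz y \<zeta>)) \<zeta>"
    by (rule dz_cong_open(2)[OF op z]) (simp add: dz_conj)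
  also have "\<dots> = cnjv (dz (dz y) \<zeta>)"
    by (rule dz_cnjv_raw(2)) (intro smooth_imp_diff z smooth_intros op)
  finally show ?thesis by simp
qed

context
  fixes \<zeta> assumes z: "\<zeta> \<in> \<Omega>"
begin

lemma diffs: "y differentiable (at \<zeta>)" "dz y differentiable (at \<zeta>)" "dzbar y differentiable (at \<zeta>)"
  by (intro smooth_imp_diff z smooth_intros op)+

lemma pair_y_y: "mink (y \<zeta>) (y \<zeta>) = 0"
  using null[OF z] by (simp add: mink_cpx)

lemma pair_dz_y: "mink (dz y \<zeta>) (y \<zeta>) = 0"
  using wz_mink_raw(1)[OF diffs(1) diffs(1)]
    wz_const_on(1)[OF op z, of "\<lambda>\<zeta>. mink (y \<zeta>) (y \<zeta>)" 0] null
  by (simp add: mink_cpx mink_sym[of "cpx (Y \<zeta>)"])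

lemma pair_dzbar_y: "mink (dzbar y \<zeta>) (y \<zeta>) = 0"
  using mink_cnjv[of "dz y \<zeta>" "y \<zeta>"] pair_dz_y by (simp add: dz_conj z)

lemma pair_dzbar_dzbar: "mink (dzbar y \<zeta>) (dzbar y \<zeta>) = 0"
  using mink_cnjv[of "dz y \<zeta>" "dz y \<zeta>"] conformal[OF z] by (simp add: dz_conj z)

lemma pair_dzbar_dz: "mink (dzbar y \<zeta>) (dz y \<zeta>) = 1/2"
  using metric[OF z] by (simp add: mink_sym)

lemma pair_dzz_dz: "mink (dz (dz y) \<zeta>) (dz y \<zeta>) = 0"
  using wz_mink_raw(1)[OF diffs(2) diffs(2)]
    wz_const_on(1)[OF op z, of "\<lambda>\<zeta>. mink (dz y \<zeta>) (dz y \<zeta>)" 0] conformal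
  by (simp add: mink_sym[of "dz y \<zeta>"])

lemma pair_dzzbar_dz: "mink (dzbar (dz y) \<zeta>) (dz y \<zeta>) = 0"
  using wz_mink_raw(2)[OF diffs(2) diffs(2)]
    wz_const_on(2)[OF op z, of "\<lambda>\<zeta>. mink (dz y \<zeta>) (dz y \<zeta>)" 0] conformal
  by (simp add: mink_sym[of "dz y \<zeta>"])

lemma pair_dzzbar_dzbar: "mink (dzbar (dz y) \<zeta>) (dzbar y \<zeta>) = 0"
  using mink_cnjv[of "dzbar (dz y) \<zeta>" "dz y \<zeta>"] pair_dzzbar_dz
  by (simp add: dzzbar_real z dz_conj)

lemma pair_dzz_dzbar: "mink (dz (dz y) \<zeta>) (dzbar y \<zeta>) = 0"
  using wz_mink_raw(1)[OF diffs(2) diffs(3)] pair_dzzbar_dz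
    wz_const_on(1)[OF op z, of "\<lambda>\<zeta>. mink (dz y \<zeta>) (dzbar y \<zeta>)" "1/2"] metric
  by (simp add: commute[OF z] mink_sym[of "dz y \<zeta>"])

lemma pair_dzz_y: "mink (dz (dz y) \<zeta>) (y \<zeta>) = 0"
  using wz_mink_raw(1)[OF diffs(2) diffs(1)] conformal[OF z]
    wz_const_on(1)[OF op z, of "\<lambda>\<zeta>. mink (dz y \<zeta>) (y \<zeta>)" 0] 
  using lift.pair_dz_y[OF lift_axioms] by (simp add: o_def)

lemma pair_dzzbar_y: "mink (dzbar (dz y) \<zeta>) (y \<zeta>) = -1/2"
proof -
  have "wzbar (\<lambda>\<zeta>. mink (dz y \<zeta>) (y \<zeta>)) \<zeta> = 0"
    by (rule wz_const_on(2)[OF op z lift.pair_dz_y[OF lift_axioms]])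
  then show ?thesis
    using wz_mink_raw(2)[OF diffs(2) diffs(1)] metric[OF z] by (simp add: eq_neg_iff_add_eq_0)
qed

lemmas pairs = pair_y_y pair_dz_y pair_dzbar_y pair_dzbar_dzbar pair_dzbar_dz pair_dzz_dz
  pair_dzzbar_dz pair_dzzbar_dzbar pair_dzz_dzbar pair_dzz_y pair_dzzbar_y conformal[OF z] metric[OF z]

text \<open>Among the spanning vectors Y pairs only with the mixed derivative, and
  \<open>dz y\<close> only with \<open>dzbar y\<close>. Pairing thus kills first d, then b and c,
  then a; the unknown square of the mixed derivative enters only when d is already known to
  vanish.\<close>

lemma VC_nondegenerate:
  assumes "w \<in> VC Y \<zeta>" "w \<in> VC_perp Y \<zeta>"
  shows "w = 0"
proof -
  obtain a b c d where w: "w = a *\<^sub>C y \<zeta> + b *\<^sub>C dz y \<zeta> + c *\<^sub>C dzbar y \<zeta> + d *\<^sub>C dzbar (dz y) \<zeta>"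
    using assms(1) by (auto simp: VC_def)
  have o: "mink w (y \<zeta>) = 0" "mink w (dz y \<zeta>) = 0" "mink w (dzbar y \<zeta>) = 0" "mink w (dzbar (dz y) \<zeta>) = 0"
    using assms(2) by (auto simp: VC_perp_iff)
  have sym: "mink (y \<zeta>) v = mink v (y \<zeta>)" "mink (dz y \<zeta>) (dzbar (dz y) \<zeta>) = mink (dzbar (dz y) \<zeta>) (dz y \<zeta>)"
    "mink (dzbar y \<zeta>) (dzbar (dz y) \<zeta>) = mink (dzbar (dz y) \<zeta>) (dzbar y \<zeta>)" for v
    by (rule mink_sym)+
  have "d = 0"
    using o(1) unfolding w by (simp add: mink_simps pairs[simplified o_def] o_def pairs)
  moreover have "c = 0" "b = 0"
    using o(2,3) unfolding w by (simp_all add: mink_simps sym pairs del: o_apply)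
  ultimately have "a = 0"
    using o(4) unfolding w by (simp add: mink_simps sym pairs del: o_apply)
  with \<open>d = 0\<close> \<open>c = 0\<close> \<open>b = 0\<close> show ?thesis
    unfolding w by simp
qed

lemma proj_perp_eqI:
  assumes "u \<in> VC_perp Y \<zeta>" "w - u \<in> VC Y \<zeta>"
  shows "proj_perp Y \<zeta> w = u"
  unfolding proj_perp_def
proof (rule the_equality)
  fix u' assume u': "u' \<in> VC_perp Y \<zeta> \<and> w - u' \<in> VC Y \<zeta>"
  then have "(w - u) - (w - u') \<in> VC Y \<zeta>"
    using VC_diff[OF assms(2), of "w - u'"] by simp
  then have "u' - u \<in> VC Y \<zeta>" by simp
  then have "u' - u = 0"
    using VC_nondegenerate VC_perp_diff u' assms(1) by blast
  then show "u' = u" by simp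
qed (use assms in auto)

end

text \<open>The Schwarzian comes from pairing the defining equation with the mixed second derivative of \<open>Y\<close>,
  which pairs with \<open>Y\<close> to \<open>-1/2\<close>.\<close>

lemma schwarzian_hopf:
  assumes "\<zeta> \<in> \<Omega>"
  shows "dz (dz y) \<zeta> + (4 * mink (dz (dz y) \<zeta>) (dzbar (dz y) \<zeta>) / 2) *\<^sub>C cpx (Y \<zeta>) \<in> VC_perp Y \<zeta>"
proof -
  have 1: "mink (cpx (Y \<zeta>)) v = mink v (y \<zeta>)" for v by (simp add: mink_sym)
  have 2: "mink v (cpx (Y \<zeta>)) = mink v (y \<zeta>)" for v by simp
  show ?thesis
    unfolding VC_perp_iff mink_simps 1 2 by (simp add: pairs[OF assms] del: o_apply)
qed

text \<open>The difference of \<open>\<kappa>\<close> and its conjugate is a multiple of \<open>Y\<close>, and the only one that pairs to \<open>0\<close>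
  with the mixed second derivative of \<open>Y\<close> is \<open>0\<close>.\<close>

lemma hopf_realI:
  assumes z: "\<zeta> \<in> \<Omega>" and k: "\<kappa> \<in> VC_perp Y \<zeta>" "dz (dz y) \<zeta> + (s / 2) *\<^sub>C cpx (Y \<zeta>) = \<kappa>"
    and e: "dz (dz y) \<zeta> - dzbar (dzbar y) \<zeta> = \<eta> *\<^sub>C y \<zeta>"
  shows "\<kappa> \<in> range cpx"
proof -
  have ck: "cnjv \<kappa> = dzbar (dzbar y) \<zeta> + (cnj s / 2) *\<^sub>C y \<zeta>"
    using k(2)[symmetric] by (simp add: cnjv_simps dzz_conj z)
  have d: "\<kappa> - cnjv \<kappa> = (\<eta> + s/2 - cnj s/2) *\<^sub>C y \<zeta>"
    unfolding ck using k(2)[symmetric] e by (simp add: cscale_add_left cscale_diff_left algebra_simps)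
  have "mink \<kappa> (dzbar (dz y) \<zeta>) = 0"
    using k(1) by (simp add: VC_perp_iff)
  moreover from this have "mink (cnjv \<kappa>) (dzbar (dz y) \<zeta>) = 0"
    using mink_cnjv[of \<kappa> "dzbar (dz y) \<zeta>"] by (simp add: dzzbar_real z)
  ultimately have "mink ((\<eta> + s/2 - cnj s/2) *\<^sub>C y \<zeta>) (dzbar (dz y) \<zeta>) = 0"
    unfolding d[symmetric] by (simp add: mink_simps)
  then have "\<eta> + s/2 - cnj s/2 = 0"
    unfolding mink_simps mink_sym[of "y \<zeta>"] pair_dzzbar_y[OF z] by simp
  with d have "cnjv \<kappa> = \<kappa>" by simp
  then show ?thesis by (simp add: range_cpx)
qed

end

subsection \<open>Pairs of lifts enveloping a common sphere congruence\<close>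

locale lift_pair = lift \<Omega> Y for \<Omega> :: "complex set" and Y :: "complex \<Rightarrow> (real, 'n::finite) mink_vec" +
  fixes Z :: "complex \<Rightarrow> (real, 'n) mink_vec"
  assumes sZ: "smooth_on \<Omega> Z"
    and nullZ: "\<And>\<zeta>. \<zeta> \<in> \<Omega> \<Longrightarrow> mink (Z \<zeta>) (Z \<zeta>) = 0"
    and pairYZ: "\<And>\<zeta>. \<zeta> \<in> \<Omega> \<Longrightarrow> mink (Y \<zeta>) (Z \<zeta>) = -1"
begin

abbreviation "yh \<equiv> cpx \<circ> Z"

definition mu :: "complex \<Rightarrow> complex" where
  "mu \<zeta> = 2 * mink (dz y \<zeta>) (yh \<zeta>)"

text \<open>The component of \<open>dz y\<close> orthogonal to both Y and Z. With its conjugate it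
  completes Y and Z to a basis of the complexified space of the sphere; P is null and pairs to 1/2
  with its conjugate, which explains the factors 2 in the coefficients \<open>rho\<close> and
  \<open>theta\<close>.\<close>

definition P :: "complex \<Rightarrow> (complex, 'n) mink_vec" where
  "P \<zeta> = dz y \<zeta> + (mu \<zeta> / 2) *\<^sub>C y \<zeta>"

definition rho :: "complex \<Rightarrow> complex" where
  "rho \<zeta> = 2 * mink (dz yh \<zeta>) (cnjv (P \<zeta>))"

definition theta :: "complex \<Rightarrow> complex" where
  "theta \<zeta> = 2 * mink (dz yh \<zeta>) (P \<zeta>)"

lemma smooth_yh [smooth_intros]: "smooth_on \<Omega> yh"
  unfolding o_def by (intro smooth_intros op sZ)

lemma smooth_mu [smooth_intros]: "smooth_on \<Omega> mu"
  unfolding mu_def[abs_def] by (intro smooth_intros op)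

lemma smooth_mu_half: "smooth_on \<Omega> (\<lambda>\<zeta>. mu \<zeta> / 2)"
  unfolding divide_inverse by (intro smooth_intros op)

lemma smooth_P [smooth_intros]: "smooth_on \<Omega> P"
  unfolding P_def[abs_def] by (intro smooth_intros op smooth_mu_half)

lemma smooth_rho [smooth_intros]: "smooth_on \<Omega> rho"
  unfolding rho_def[abs_def] by (intro smooth_intros op)

lemma smooth_theta [smooth_intros]: "smooth_on \<Omega> theta"
  unfolding theta_def[abs_def] by (intro smooth_intros op)

lemma dz_conjZ: "\<zeta> \<in> \<Omega> \<Longrightarrow> cnjv (dz yh \<zeta>) = dzbar yh \<zeta>"
  using dz_cnjv_raw(2)[OF smooth_imp_diff[OF smooth_yh], of \<zeta>] by (simp add: o_def)

lemma dzbar_conjZ: "\<zeta> \<in> \<Omega> \<Longrightarrow> cnjv (dzbar yh \<zeta>) = dz yh \<zeta>"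
  by (simp flip: dz_conjZ)

lemma commuteZ: "\<zeta> \<in> \<Omega> \<Longrightarrow> dz (dzbar yh) \<zeta> = dzbar (dz yh) \<zeta>"
  using dz_dzbar_commute[OF op _ smooth_yh] by simp

lemma dzzbar_realZ: "\<zeta> \<in> \<Omega> \<Longrightarrow> cnjv (dzbar (dz yh) \<zeta>) = dzbar (dz yh) \<zeta>"
proof -
  assume z: "\<zeta> \<in> \<Omega>"
  have "dzbar (dz yh) \<zeta> = dzbar (\<lambda>\<zeta>. cnjv (dzbar yh \<zeta>)) \<zeta>"
    by (rule dz_cong_open(2)[OF op z]) (simp add: dzbar_conjZ)
  also have "\<dots> = cnjv (dz (dzbar yh) \<zeta>)"
    by (rule dz_cnjv_raw(2)) (intro smooth_imp_diff z smooth_intros op)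
  finally show ?thesis
    by (simp add: commuteZ[OF z])
qed

lemma diffsZ:
  assumes "\<zeta> \<in> \<Omega>"
  shows "yh differentiable (at \<zeta>)" "dz yh differentiable (at \<zeta>)" "dzbar yh differentiable (at \<zeta>)"
    "mu differentiable (at \<zeta>)" "rho differentiable (at \<zeta>)" "theta differentiable (at \<zeta>)"
    "P differentiable (at \<zeta>)" "(\<lambda>\<zeta>. mu \<zeta> / 2) differentiable (at \<zeta>)"
    "(\<lambda>\<zeta>. cnj (mu \<zeta>)) differentiable (at \<zeta>)" "(\<lambda>\<zeta>. cnj (rho \<zeta>)) differentiable (at \<zeta>)"
    "(\<lambda>\<zeta>. cnjv (P \<zeta>)) differentiable (at \<zeta>)"
  by (intro smooth_imp_diff[OF _ assms] smooth_intros op smooth_mu_half)+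

lemma wz_half: "f differentiable (at \<zeta>) \<Longrightarrow> wz (\<lambda>\<zeta>. f \<zeta> / 2) \<zeta> = wz f \<zeta> / 2"
    "f differentiable (at \<zeta>) \<Longrightarrow> wzbar (\<lambda>\<zeta>. f \<zeta> / 2) \<zeta> = wzbar f \<zeta> / 2"
  using wz_cmult[of f \<zeta> "1/2"] by simp_all

lemma cnjv_P: "\<zeta> \<in> \<Omega> \<Longrightarrow> cnjv (P \<zeta>) = dzbar y \<zeta> + (cnj (mu \<zeta>) / 2) *\<^sub>C y \<zeta>"
  by (simp add: P_def cnjv_simps dz_conj)

lemma dz_y_eq: "dz y \<zeta> = P \<zeta> - (mu \<zeta> / 2) *\<^sub>C y \<zeta>"
  by (simp add: P_def)

lemma dzbar_y_eq: "\<zeta> \<in> \<Omega> \<Longrightarrow> dzbar y \<zeta> = cnjv (P \<zeta>) - (cnj (mu \<zeta>) / 2) *\<^sub>C y \<zeta>"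
  by (simp add: cnjv_P)

lemma dz_P:
  assumes "\<zeta> \<in> \<Omega>"
  shows "dz P \<zeta> = dz (dz y) \<zeta> + (wz mu \<zeta> / 2) *\<^sub>C y \<zeta> + (mu \<zeta> / 2) *\<^sub>C dz y \<zeta>"
    and "dzbar P \<zeta> = dzbar (dz y) \<zeta> + (wzbar mu \<zeta> / 2) *\<^sub>C y \<zeta> + (mu \<zeta> / 2) *\<^sub>C dzbar y \<zeta>"
proof -
  have d: "(\<lambda>\<zeta>. (mu \<zeta> / 2) *\<^sub>C y \<zeta>) differentiable (at \<zeta>)"
    by (intro smooth_imp_diff[OF _ assms] smooth_intros op smooth_mu_half)
  show "dz P \<zeta> = dz (dz y) \<zeta> + (wz mu \<zeta> / 2) *\<^sub>C y \<zeta> + (mu \<zeta> / 2) *\<^sub>C dz y \<zeta>"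
    "dzbar P \<zeta> = dzbar (dz y) \<zeta> + (wzbar mu \<zeta> / 2) *\<^sub>C y \<zeta> + (mu \<zeta> / 2) *\<^sub>C dzbar y \<zeta>"
    unfolding P_def[abs_def] using diffs[OF assms] diffsZ[OF assms] d
    by (simp_all add: dz_add_raw dz_cscale_raw wz_half add.assoc del: o_apply)
qed

context
  fixes \<zeta> assumes z: "\<zeta> \<in> \<Omega>"
begin

lemma pair_yh_yh: "mink (yh \<zeta>) (yh \<zeta>) = 0"
  using nullZ[OF z] by (simp add: mink_cpx)

lemma pair_y_yh: "mink (y \<zeta>) (yh \<zeta>) = -1"
  using pairYZ[OF z] by (simp add: mink_cpx)

lemma pair_dz_yh: "mink (dz y \<zeta>) (yh \<zeta>) = mu \<zeta> / 2"
  by (simp add: mu_def)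

lemma pair_P_y: "mink (P \<zeta>) (y \<zeta>) = 0"
  and pair_P_yh: "mink (P \<zeta>) (yh \<zeta>) = 0"
  and pair_P_P: "mink (P \<zeta>) (P \<zeta>) = 0"
  by (simp_all add: P_def mink_simps pairs[OF z] pair_y_yh pair_dz_yh mink_sym[of "y \<zeta>" "dz y \<zeta>"]
      del: o_apply)

lemma pair_cnjP_y: "mink (cnjv (P \<zeta>)) (y \<zeta>) = 0"
  and pair_cnjP_yh: "mink (cnjv (P \<zeta>)) (yh \<zeta>) = 0"
  and pair_cnjP_cnjP: "mink (cnjv (P \<zeta>)) (cnjv (P \<zeta>)) = 0"
  using mink_cnjv[of "P \<zeta>" "y \<zeta>"] mink_cnjv[of "P \<zeta>" "yh \<zeta>"] mink_cnjv[of "P \<zeta>" "P \<zeta>"]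
    pair_P_y pair_P_yh pair_P_P by simp_all

lemma pair_P_cnjP: "mink (P \<zeta>) (cnjv (P \<zeta>)) = 1/2"
  unfolding cnjv_P[OF z] unfolding P_def
  by (simp add: mink_simps pairs[OF z] mink_sym[of "y \<zeta>" "dzbar y \<zeta>"] del: o_apply)

lemma pair_cnjP_P: "mink (cnjv (P \<zeta>)) (P \<zeta>) = 1/2"
  using pair_P_cnjP by (simp add: mink_sym)

lemmas pairsP = pair_yh_yh pair_y_yh pair_y_yh[unfolded mink_sym[of "y \<zeta>"]] pair_y_y[OF z]
  pair_P_y pair_P_yh pair_P_P pair_cnjP_y pair_cnjP_yh pair_cnjP_cnjP pair_P_cnjP pair_cnjP_P
  pair_P_y[unfolded mink_sym[of "P \<zeta>"]] pair_P_yh[unfolded mink_sym[of "P \<zeta>"]]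
  pair_cnjP_y[unfolded mink_sym[of "cnjv (P \<zeta>)"]] pair_cnjP_yh[unfolded mink_sym[of "cnjv (P \<zeta>)"]]

lemma pair_dzzbar_P: "mink (dzbar (dz y) \<zeta>) (P \<zeta>) = - mu \<zeta> / 4"
  by (simp add: P_def mink_simps pairs[OF z] del: o_apply)

lemma pair_dzzbar_cnjP: "mink (dzbar (dz y) \<zeta>) (cnjv (P \<zeta>)) = - cnj (mu \<zeta>) / 4"
  by (simp add: cnjv_P z mink_simps pairs[OF z] del: o_apply)

lemma sphere_span_nondegenerate:
  assumes "w = a *\<^sub>C y \<zeta> + b *\<^sub>C yh \<zeta> + c *\<^sub>C P \<zeta> + d *\<^sub>C cnjv (P \<zeta>)"
    and "mink w (y \<zeta>) = 0" "mink w (yh \<zeta>) = 0" "mink w (P \<zeta>) = 0" "mink w (cnjv (P \<zeta>)) = 0"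
  shows "w = 0"
proof -
  have "a = 0" "b = 0" "c = 0" "d = 0"
    using assms(2-5) unfolding assms(1) by (simp_all add: mink_simps pairsP del: o_apply)
  then show ?thesis using assms(1) by simp
qed

end

text \<open>\<open>dzbar (dz y)\<close> minus its projection to the span of Y, Z, P and the
  conjugate of P. If it vanishes, the mixed derivative lies in that span, which then agrees with
  \<open>VC\<close>: the enveloped sphere is the central sphere.\<close>

definition normal_part :: "complex \<Rightarrow> (complex, 'n) mink_vec" where
  "normal_part \<zeta> = dzbar (dz y) \<zeta> - (1/2) *\<^sub>C yh \<zeta> + mink (dzbar (dz y) \<zeta>) (yh \<zeta>) *\<^sub>C y \<zeta>
    + (cnj (mu \<zeta>) / 2) *\<^sub>C P \<zeta> + (mu \<zeta> / 2) *\<^sub>C cnjv (P \<zeta>)"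

lemma normal_part_orthogonal:
  assumes z: "\<zeta> \<in> \<Omega>"
  shows "mink (normal_part \<zeta>) (y \<zeta>) = 0" "mink (normal_part \<zeta>) (yh \<zeta>) = 0"
    "mink (normal_part \<zeta>) (P \<zeta>) = 0" "mink (normal_part \<zeta>) (cnjv (P \<zeta>)) = 0"
  by (simp_all add: normal_part_def mink_simps pairsP[OF z] pair_dzzbar_P[OF z]
      pair_dzzbar_cnjP[OF z] pair_dzzbar_y[OF z] del: o_apply)

lemma smooth_normal_part: "smooth_on \<Omega> normal_part"
proof -
  have "smooth_on \<Omega> (\<lambda>\<zeta>. cnj (mu \<zeta>) / 2)"
    using smooth_on_cnj[OF op smooth_mu_half] by simp
  then show ?thesis
    unfolding normal_part_def[abs_def] by (intro smooth_intros op smooth_mu_half)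
qed

end

text \<open>The absence of a normal component is the enveloping condition on Z. The coefficient of
  \<open>yh\<close> is forced by differentiating the constant pairing of Y and Z, and
  \<open>y\<close> cannot occur because Z is null.\<close>

locale enveloped_pair = lift_pair \<Omega> Y Z for \<Omega> :: "complex set"
  and Y Z :: "complex \<Rightarrow> (real, 'n::finite) mink_vec" +
  assumes decomp: "\<And>\<zeta>. \<zeta> \<in> \<Omega> \<Longrightarrow>
      dz yh \<zeta> = (mu \<zeta> / 2) *\<^sub>C yh \<zeta> + rho \<zeta> *\<^sub>C P \<zeta> + theta \<zeta> *\<^sub>C cnjv (P \<zeta>)"
begin

lemma decomp_conj: "\<zeta> \<in> \<Omega> \<Longrightarrow> dzbar yh \<zeta> =
    (cnj (mu \<zeta>) / 2) *\<^sub>C yh \<zeta> + cnj (rho \<zeta>) *\<^sub>C cnjv (P \<zeta>) + cnj (theta \<zeta>) *\<^sub>C P \<zeta>"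
  using arg_cong[OF decomp, of \<zeta> cnjv] by (simp add: cnjv_simps dz_conjZ)

lemma wzbar_mu:
  assumes z: "\<zeta> \<in> \<Omega>"
  shows "wzbar mu \<zeta> = 2 * mink (dzbar (dz y) \<zeta>) (yh \<zeta>) + cnj (rho \<zeta>) + mu \<zeta> * cnj (mu \<zeta>) / 2"
proof -
  have A: "wzbar mu \<zeta> = 2 * (mink (dzbar (dz y) \<zeta>) (yh \<zeta>) + mink (dz y \<zeta>) (dzbar yh \<zeta>))"
  proof -
    have "(\<lambda>\<zeta>. mink (dz y \<zeta>) (yh \<zeta>)) differentiable (at \<zeta>)"
      by (intro smooth_imp_diff[OF _ z] smooth_intros op)
    from wz_cmult(2)[OF this] wz_mink_raw(2)[OF diffs(2)[OF z] diffsZ(1)[OF z]] show ?thesis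
      unfolding mu_def[abs_def] by simp
  qed
  have B: "mink (dz y \<zeta>) (dzbar yh \<zeta>) = cnj (rho \<zeta>) / 2 + mu \<zeta> * cnj (mu \<zeta>) / 4"
    unfolding decomp_conj[OF z] dz_y_eq[of \<zeta>] by (simp add: mink_simps pairsP[OF z] del: o_apply)
  show ?thesis unfolding A B by (simp add: field_simps)
qed

lemma wz_mu:
  assumes z: "\<zeta> \<in> \<Omega>"
  shows "wz mu \<zeta> = 2 * mink (dz (dz y) \<zeta>) (yh \<zeta>) + theta \<zeta> + (mu \<zeta>)\<^sup>2 / 2"
proof -
  have A: "wz mu \<zeta> = 2 * (mink (dz (dz y) \<zeta>) (yh \<zeta>) + mink (dz y \<zeta>) (dz yh \<zeta>))"
  proof -
    have "(\<lambda>\<zeta>. mink (dz y \<zeta>) (yh \<zeta>)) differentiable (at \<zeta>)"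
      by (intro smooth_imp_diff[OF _ z] smooth_intros op)
    from wz_cmult(1)[OF this] wz_mink_raw(1)[OF diffs(2)[OF z] diffsZ(1)[OF z]] show ?thesis
      unfolding mu_def[abs_def] by simp
  qed
  have B: "mink (dz y \<zeta>) (dz yh \<zeta>) = theta \<zeta> / 2 + (mu \<zeta>)\<^sup>2 / 4"
    unfolding decomp[OF z] dz_y_eq[of \<zeta>]
    by (simp add: mink_simps pairsP[OF z] power2_eq_square del: o_apply)
  show ?thesis unfolding A B by (simp add: field_simps)
qed

text \<open>In \<open>wzbar_mu\<close> the pairing of the real vector \<open>dzbar (dz y)\<close>
  with Z is real and drops out, and so does the squared modulus of \<open>mu\<close>.\<close>

lemma wzbar_mu_imaginary:
  assumes z: "\<zeta> \<in> \<Omega>"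
  shows "wzbar mu \<zeta> - cnj (wzbar mu \<zeta>) = cnj (rho \<zeta>) - rho \<zeta>"
  using mink_cnjv[of "dzbar (dz y) \<zeta>" "yh \<zeta>"] unfolding wzbar_mu[OF z]
  by (simp add: dzzbar_real[OF z] algebra_simps)

lemma pair_dzbarP_cnjP:
  assumes z: "\<zeta> \<in> \<Omega>"
  shows "mink (dzbar P \<zeta>) (cnjv (P \<zeta>)) = - cnj (mu \<zeta>) / 4" "mink (dzbar P \<zeta>) (P \<zeta>) = 0"
  unfolding dz_P[OF z] dzbar_y_eq[OF z]
  by (simp_all add: mink_simps pairsP[OF z] pair_dzzbar_P[OF z] pair_dzzbar_cnjP[OF z] del: o_apply)

end

subsection \<open>The orientation reversing case\<close>

locale reversing_pair = enveloped_pair \<Omega> Y Z for \<Omega> :: "complex set"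
  and Y Z :: "complex \<Rightarrow> (real, 'n::finite) mink_vec" +
  assumes theta_0: "\<And>\<zeta>. \<zeta> \<in> \<Omega> \<Longrightarrow> theta \<zeta> = 0"
begin

lemma dz_yh: "\<zeta> \<in> \<Omega> \<Longrightarrow> dz yh \<zeta> = (mu \<zeta> / 2) *\<^sub>C yh \<zeta> + rho \<zeta> *\<^sub>C P \<zeta>"
  using decomp theta_0 by simp

lemma dzbar_yh: "\<zeta> \<in> \<Omega> \<Longrightarrow> dzbar yh \<zeta> = (cnj (mu \<zeta>) / 2) *\<^sub>C yh \<zeta> + cnj (rho \<zeta>) *\<^sub>C cnjv (P \<zeta>)"
  using decomp_conj theta_0 by simp

lemma dzzbar_yh:
  assumes z: "\<zeta> \<in> \<Omega>"
  shows "dzbar (dz yh) \<zeta> = (wzbar mu \<zeta> / 2) *\<^sub>C yh \<zeta> + (mu \<zeta> / 2) *\<^sub>C dzbar yh \<zeta>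
     + wzbar rho \<zeta> *\<^sub>C P \<zeta> + rho \<zeta> *\<^sub>C dzbar P \<zeta>"
proof -
  have "dzbar (dz yh) \<zeta> = dzbar (\<lambda>\<zeta>. (mu \<zeta> / 2) *\<^sub>C yh \<zeta> + rho \<zeta> *\<^sub>C P \<zeta>) \<zeta>"
    by (rule dz_cong_open(2)[OF op z]) (rule dz_yh)
  moreover have "(\<lambda>\<zeta>. (mu \<zeta> / 2) *\<^sub>C yh \<zeta>) differentiable (at \<zeta>)"
    "(\<lambda>\<zeta>. rho \<zeta> *\<^sub>C P \<zeta>) differentiable (at \<zeta>)"
    by (intro smooth_imp_diff[OF _ z] smooth_intros op smooth_mu_half)+
  ultimately show ?thesis
    using diffsZ[OF z] by (simp add: dz_add_raw dz_cscale_raw wz_half add.assoc del: o_apply)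
qed

text \<open>The vector \<open>dzbar (dz yh)\<close> is real, so its pairings with P and with the
  conjugate of P are conjugate to each other; the derivative of \<open>rho\<close> occurs in only
  one of them.\<close>

lemma wzbar_rho:
  assumes z: "\<zeta> \<in> \<Omega>"
  shows "wzbar rho \<zeta> = cnj (mu \<zeta>) * rho \<zeta>"
proof -
  have 1: "mink (dzbar (dz yh) \<zeta>) (cnjv (P \<zeta>)) = wzbar rho \<zeta> / 2 - rho \<zeta> * cnj (mu \<zeta>) / 4"
    unfolding dzzbar_yh[OF z] dzbar_yh[OF z]
    by (simp add: mink_simps pairsP[OF z] pair_dzbarP_cnjP[OF z] del: o_apply)
  have 2: "mink (dzbar (dz yh) \<zeta>) (P \<zeta>) = mu \<zeta> * cnj (rho \<zeta>) / 4"
    unfolding dzzbar_yh[OF z] dzbar_yh[OF z]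
    by (simp add: mink_simps pairsP[OF z] pair_dzbarP_cnjP[OF z] del: o_apply)
  have "mink (dzbar (dz yh) \<zeta>) (cnjv (P \<zeta>)) = cnj (mink (dzbar (dz yh) \<zeta>) (P \<zeta>))"
    using mink_cnjv[of "dzbar (dz yh) \<zeta>" "P \<zeta>"] by (simp add: dzzbar_realZ z)
  then show ?thesis unfolding 1 2 by (simp add: field_simps)
qed

text \<open>Modulo the span of the sphere, \<open>dzbar (dz yh)\<close> equals \<open>rho\<close>
  times \<open>dzbar (dz y)\<close>. Both vectors are real, so \<open>rho - cnj rho\<close>
  annihilates the normal part of the latter.\<close>

lemma normal_part_rho_real:
  assumes z: "\<zeta> \<in> \<Omega>"
  shows "rho \<zeta> = cnj (rho \<zeta>) \<or> normal_part \<zeta> = 0"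
proof -
  let ?r = "rho \<zeta>" and ?m = "mu \<zeta>" and ?k = "mink (dzbar (dz y) \<zeta>) (yh \<zeta>)"
  define X where "X = dzbar (dz y) \<zeta>"
  have "dzbar (dz yh) \<zeta> - cnjv (dzbar (dz yh) \<zeta>) = 0"
    by (simp add: dzzbar_realZ z)
  then have eq: "((wzbar mu \<zeta> / 2) *\<^sub>C yh \<zeta> + (?m / 2) *\<^sub>C ((cnj ?m / 2) *\<^sub>C yh \<zeta> + cnj ?r *\<^sub>C cnjv (P \<zeta>))
     + wzbar rho \<zeta> *\<^sub>C P \<zeta> + ?r *\<^sub>C (X + (wzbar mu \<zeta> / 2) *\<^sub>C y \<zeta> + (?m / 2) *\<^sub>C
        (cnjv (P \<zeta>) - (cnj ?m / 2) *\<^sub>C y \<zeta>)))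
     - ((cnj (wzbar mu \<zeta>) / 2) *\<^sub>C yh \<zeta> + (cnj ?m / 2) *\<^sub>C ((?m / 2) *\<^sub>C yh \<zeta> + ?r *\<^sub>C P \<zeta>)
     + cnj (wzbar rho \<zeta>) *\<^sub>C cnjv (P \<zeta>) + cnj ?r *\<^sub>C (X + (cnj (wzbar mu \<zeta>) / 2) *\<^sub>C y \<zeta> +
        (cnj ?m / 2) *\<^sub>C (P \<zeta> - (?m / 2) *\<^sub>C y \<zeta>))) = 0"
    unfolding dzzbar_yh[OF z] dzbar_yh[OF z] dz_P(2)[OF z] dzbar_y_eq[OF z]
    by (simp add: cnjv_simps dzzbar_real[OF z] X_def)
  have "\<exists>a b c d. (?r - cnj ?r) *\<^sub>C X = a *\<^sub>C y \<zeta> + b *\<^sub>C yh \<zeta> + c *\<^sub>C P \<zeta> + d *\<^sub>C cnjv (P \<zeta>)"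
  proof -
    define b where "b = (cnj (wzbar mu \<zeta>) - wzbar mu \<zeta>) / 2"
    define c where "c = ?r * cnj ?m / 2 - wzbar rho \<zeta> + cnj ?r * cnj ?m / 2"
    define d where "d = - (?m * cnj ?r / 2) + cnj (wzbar rho \<zeta>) - ?r * ?m / 2"
    define a where "a = - ?r * (wzbar mu \<zeta> / 2 - ?m * cnj ?m / 4) + cnj ?r * (cnj (wzbar mu \<zeta>) / 2 - ?m * cnj ?m / 4)"
    have "(?r - cnj ?r) *\<^sub>C X - (a *\<^sub>C y \<zeta> + b *\<^sub>C yh \<zeta> + c *\<^sub>C P \<zeta> + d *\<^sub>C cnjv (P \<zeta>)) = 0"
      unfolding eq[symmetric]
      by (rule mink_vec_eqI; simp add: a_def b_def c_def d_def algebra_simps del: o_apply)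
        (simp_all add: field_simps)
    then show ?thesis by (metis eq_iff_diff_eq_0)
  qed
  then obtain a b c d where
    abcd: "(?r - cnj ?r) *\<^sub>C X = a *\<^sub>C y \<zeta> + b *\<^sub>C yh \<zeta> + c *\<^sub>C P \<zeta> + d *\<^sub>C cnjv (P \<zeta>)" by blast
  let ?q = "?r - cnj ?r"
  have "?q *\<^sub>C normal_part \<zeta> = (a + ?q * ?k) *\<^sub>C y \<zeta> + (b - ?q / 2) *\<^sub>C yh \<zeta>
      + (c + ?q * (cnj ?m / 2)) *\<^sub>C P \<zeta> + (d + ?q * (?m / 2)) *\<^sub>C cnjv (P \<zeta>)"
    unfolding normal_part_def X_def[symmetric] cscale_add_right cscale_diff_right abcd
    by (rule mink_vec_eqI; simp add: field_simps)
  then have "?q *\<^sub>C normal_part \<zeta> = 0"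
    by (rule sphere_span_nondegenerate[OF z]) (simp_all add: mink_simps normal_part_orthogonal[OF z] del: o_apply)
  then show ?thesis by (auto simp: cscale_eq_0_iff)
qed

text \<open>With \<open>x = \<rho> - cnj \<rho>\<close> and \<open>g = \<rho>\<^sub>z - \<mu> cnj \<rho>\<close> the antiholomorphic derivatives of \<open>x\<close> and \<open>g\<close> are
  linear in \<open>x\<close>, \<open>g\<close> and their conjugates.\<close>

lemma rho_real_propagates:
  assumes sq: "csquare a h \<subseteq> \<Omega>" and "0 < r"
    and real: "\<And>\<zeta>. \<zeta> \<in> \<Omega> \<Longrightarrow> cmod (\<zeta> - a) < r \<Longrightarrow> cnj (rho \<zeta>) = rho \<zeta>"
    and "cmod (\<zeta>0 - a) < h"
  shows "cnj (rho \<zeta>0) = rho \<zeta>0"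
proof -
  define x where "x \<zeta> = rho \<zeta> - cnj (rho \<zeta>)" for \<zeta>
  define g where "g \<zeta> = wz rho \<zeta> - mu \<zeta> * cnj (rho \<zeta>)" for \<zeta>
  define c where "c \<zeta> = wzbar mu \<zeta> + rho \<zeta> - mu \<zeta> * cnj (mu \<zeta>)" for \<zeta>
  have h: "0 < h"
    using \<open>cmod (\<zeta>0 - a) < h\<close> norm_ge_zero[of "\<zeta>0 - a"] by linarith
  have sx: "smooth_on \<Omega> x" and sg: "smooth_on \<Omega> g" and sc: "smooth_on \<Omega> c"
    unfolding x_def g_def c_def by (intro smooth_intros op)+
  have wx: "wzbar x \<zeta> = - cnj (g \<zeta>)" if z: "\<zeta> \<in> \<Omega>" for \<zeta>
    unfolding x_def[abs_def] g_def using diffsZ[OF z]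
    by (simp add: wz_diff wz_cnj_raw wzbar_rho z)
  have wg: "wzbar g \<zeta> = c \<zeta> * x \<zeta> + cnj (mu \<zeta>) * g \<zeta> - mu \<zeta> * cnj (g \<zeta>)" if z: "\<zeta> \<in> \<Omega>" for \<zeta>
  proof -
    have "(\<lambda>\<zeta>. mu \<zeta> * cnj (rho \<zeta>)) differentiable (at \<zeta>)" "wz rho differentiable (at \<zeta>)"
      by (intro smooth_imp_diff[OF _ z] smooth_intros op)+
    then have E1: "wzbar g \<zeta> = wzbar (wz rho) \<zeta> - (wzbar mu \<zeta> * cnj (rho \<zeta>) + mu \<zeta> * cnj (wz rho \<zeta>))"
      unfolding g_def[abs_def] using diffsZ[OF z] by (simp add: wz_diff wz_cnj_raw wz_mult_raw)
    have E2: "wzbar (wz rho) \<zeta> = wz (wzbar rho) \<zeta>"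
      by (rule wz_wzbar_commute[OF op z smooth_rho])
    have E3: "wz (wzbar rho) \<zeta> = wz (\<lambda>\<zeta>. cnj (mu \<zeta>) * rho \<zeta>) \<zeta>"
      by (rule wz_cong_open(1)[OF op z wzbar_rho])
    have E4: "wz (\<lambda>\<zeta>. cnj (mu \<zeta>) * rho \<zeta>) \<zeta> = cnj (wzbar mu \<zeta>) * rho \<zeta> + cnj (mu \<zeta>) * wz rho \<zeta>"
      using diffsZ[OF z] by (simp add: wz_mult_raw wz_cnj_raw)
    have E5: "cnj (wzbar mu \<zeta>) = wzbar mu \<zeta> + x \<zeta>"
      using wzbar_mu_imaginary[OF z] by (simp add: x_def algebra_simps)
    show ?thesis
      unfolding E1 E2 E3 E4 E5
      by (simp add: c_def g_def x_def algebra_simps)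
  qed
  have ct: "continuous_on (csquare a h) f" if "smooth_on \<Omega> f" for f :: "complex \<Rightarrow> complex"
    using continuous_on_subset[OF smooth_on_imp_continuous_on[OF that] sq] .
  obtain K where K: "0 \<le> K" "\<And>\<zeta>. \<zeta> \<in> csquare a h \<Longrightarrow> (cmod (c \<zeta>))\<^sup>2 \<le> K"
    using continuous_on_csquare_bounded[OF continuous_on_power[OF continuous_on_norm[OF ct[OF sc]]]] by metis
  obtain M where M: "0 \<le> M" "\<And>\<zeta>. \<zeta> \<in> csquare a h \<Longrightarrow> (cmod (mu \<zeta>))\<^sup>2 \<le> M"
    using continuous_on_csquare_bounded[OF continuous_on_power[OF continuous_on_norm[OF ct[OF smooth_mu]]]]
    by metis
  have "x \<zeta>0 = 0 \<and> g \<zeta>0 = 0"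
  proof (rule unique_continuation[OF op sq sx sg])
    fix \<zeta> assume \<zeta>: "\<zeta> \<in> csquare a h"
    then have z: "\<zeta> \<in> \<Omega>" using sq by auto
    have "cmod (wzbar g \<zeta>) \<le> cmod (c \<zeta>) * cmod (x \<zeta>) + 2 * (cmod (mu \<zeta>) * cmod (g \<zeta>))"
      unfolding wg[OF z]
      using norm_triangle_ineq4[of "c \<zeta> * x \<zeta> + cnj (mu \<zeta>) * g \<zeta>" "mu \<zeta> * cnj (g \<zeta>)"]
        norm_triangle_ineq[of "c \<zeta> * x \<zeta>" "cnj (mu \<zeta>) * g \<zeta>"]
      by (simp add: norm_mult)
    then have "(cmod (wzbar g \<zeta>))\<^sup>2 \<le> (cmod (c \<zeta>) * cmod (x \<zeta>) + 2 * (cmod (mu \<zeta>) * cmod (g \<zeta>)))\<^sup>2"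
      by (intro power_mono) auto
    also have "\<dots> \<le> 2 * (cmod (c \<zeta>) * cmod (x \<zeta>))\<^sup>2 + 2 * (2 * (cmod (mu \<zeta>) * cmod (g \<zeta>)))\<^sup>2"
      using zero_le_power2[of "cmod (c \<zeta>) * cmod (x \<zeta>) - 2 * (cmod (mu \<zeta>) * cmod (g \<zeta>))"]
      by (simp add: power2_eq_square algebra_simps)
    also have "\<dots> = 2 * ((cmod (c \<zeta>))\<^sup>2 * (cmod (x \<zeta>))\<^sup>2) + 8 * ((cmod (mu \<zeta>))\<^sup>2 * (cmod (g \<zeta>))\<^sup>2)"
      by (simp add: power_mult_distrib)
    also have "\<dots> \<le> 2 * (K * (cmod (x \<zeta>))\<^sup>2) + 8 * (M * (cmod (g \<zeta>))\<^sup>2)"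
      using K(2)[OF \<zeta>] M(2)[OF \<zeta>] by (intro add_mono mult_left_mono mult_right_mono) auto
    finally have "(cmod (wzbar x \<zeta>))\<^sup>2 + (cmod (wzbar g \<zeta>))\<^sup>2 \<le>
        2 * K * (cmod (x \<zeta>))\<^sup>2 + (8 * M + 1) * (cmod (g \<zeta>))\<^sup>2"
      by (simp add: wx[OF z] algebra_simps)
    also have "\<dots> \<le> (2 * K + 8 * M + 1) * (cmod (x \<zeta>))\<^sup>2 + (2 * K + 8 * M + 1) * (cmod (g \<zeta>))\<^sup>2"
      using K(1) M(1) by (intro add_mono mult_right_mono) auto
    finally show "(cmod (wzbar x \<zeta>))\<^sup>2 + (cmod (wzbar g \<zeta>))\<^sup>2 \<le>
        (2 * K + 8 * M + 1) * ((cmod (x \<zeta>))\<^sup>2 + (cmod (g \<zeta>))\<^sup>2)"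
      by (simp add: algebra_simps)
  next
    \<comment> \<open>Shrinking the radius to \<open>min r h\<close> keeps the disc inside the
      square and hence inside \<Omega>.\<close>
    show "0 < min r h" using \<open>0 < r\<close> h by simp
  next
    let ?B = "\<Omega> \<inter> ball a (min r h)"
    have zero: "x \<zeta> = 0" if "\<zeta> \<in> ?B" for \<zeta>
      using real[of \<zeta>] that by (simp add: x_def dist_norm norm_minus_commute)
    fix \<zeta> assume "cmod (\<zeta> - a) < min r h"
    then have \<zeta>: "\<zeta> \<in> ?B"
      using ball_subset_csquare[of \<zeta> a h] sq by (auto simp: dist_norm norm_minus_commute)
    \<comment> \<open>Vanishing of x on an open set passes to its derivative, which is minus the
      conjugate of g.\<close>
    have "wzbar x \<zeta> = 0"
      by (rule wz_const_on(2)[OF _ \<zeta> zero]) (use op in auto)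
    then show "x \<zeta> = 0 \<and> g \<zeta> = 0"
      using wx[of \<zeta>] zero[OF \<zeta>] \<zeta> by auto
  qed fact
  then show ?thesis by (simp add: x_def)
qed

end

text \<open>For a real map the two partial derivatives are, up to sign, the real and imaginary parts
  of twice \<open>dz\<close>, so \<open>dz\<close> alone controls the whole derivative.\<close>

lemma has_derivative_zeroI:
  fixes F :: "complex \<Rightarrow> (real, 'n::finite) mink_vec"
  assumes F: "smooth_on T F" "\<zeta> \<in> T" and z: "dz (cpx \<circ> F) \<zeta> = 0"
  shows "(F has_derivative (\<lambda>v. 0)) (at \<zeta>)"
proof -
  let ?D = "frechet_derivative F (at \<zeta>)"
  have D: "(F has_derivative ?D) (at \<zeta>)"
    by (rule smooth_on_has_derivative[OF F])
  have "(cpx \<circ> F has_derivative (\<lambda>v. cpx (?D v))) (at \<zeta>)"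
    using bounded_linear.has_derivative[OF bounded_linear_cpx D] by (simp add: o_def)
  from dz_at[OF this] z have e: "cpx (?D 1) - \<i> *\<^sub>C cpx (?D \<i>) = 0"
    by (simp add: cscale_eq_0_iff)
  have 1: "fst (?D 1) $ i = 0 \<and> fst (?D \<i>) $ i = 0" for i
    using arg_cong[OF e, of "\<lambda>v. fst v $ i"] by (simp add: complex_eq_iff)
  have 2: "snd (?D 1) = 0 \<and> snd (?D \<i>) = 0"
    using arg_cong[OF e, of snd] by (simp add: complex_eq_iff)
  have "?D 1 = 0" "?D \<i> = 0"
    by (rule mink_vec_eqI; use 1 2 in simp)+
  then have "?D v = 0" for v
    using linear_complex_expand[OF has_derivative_linear[OF D], of v] by simp
  then have "?D = (\<lambda>v. 0)" by auto
  with D show ?thesis by simp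
qed

section \<open>The mirror of a pair with real \<open>rho\<close>\<close>

context reversing_pair
begin

text \<open>For real \<open>rho\<close> this vector has square \<open>2 * rho\<close> and is normal
  to the mirror that exchanges the two surfaces.\<close>

definition axis :: "complex \<Rightarrow> (real, 'n) mink_vec" where
  "axis \<zeta> = Re (rho \<zeta>) *\<^sub>R Y \<zeta> - Z \<zeta>"

text \<open>Only the line of \<open>axis\<close> is constant: \<open>axis\<close> has logarithmic
  derivative \<open>mu / 2\<close>, and the real \<open>rho\<close> has \<open>mu\<close>. An
  expression quadratic in \<open>axis\<close> and divided by \<open>rho\<close> cancels both. It is
  twice the orthogonal projection of v to the line, which is what the reflection subtracts.\<close>

lemma axis_projection_constant:
  assumes real: "\<And>\<zeta>. \<zeta> \<in> \<Omega> \<Longrightarrow> cnj (rho \<zeta>) = rho \<zeta>" and nz: "\<And>\<zeta>. \<zeta> \<in> \<Omega> \<Longrightarrow> rho \<zeta> \<noteq> 0"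
    and z: "\<zeta> \<in> \<Omega>"
  shows "((\<lambda>\<zeta>. (mink v (axis \<zeta>) * inverse (Re (rho \<zeta>))) *\<^sub>R axis \<zeta>) has_derivative (\<lambda>v. 0)) (at \<zeta>)"
proof (rule has_derivative_zeroI[OF _ z])
  have Re: "complex_of_real (Re (rho \<zeta>)) = rho \<zeta>" if "\<zeta> \<in> \<Omega>" for \<zeta>
    using real[OF that] by (simp add: complex_eq_iff)
  have nzR: "Re (rho \<zeta>) \<noteq> 0" if "\<zeta> \<in> \<Omega>" for \<zeta>
    using nz[OF that] Re[OF that] by auto
  have sa: "smooth_on \<Omega> axis"
    unfolding axis_def[abs_def] by (intro smooth_intros op sY sZ)
  have si: "smooth_on \<Omega> (\<lambda>\<zeta>. inverse (Re (rho \<zeta>)))"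
    by (intro smooth_intros op nzR)
  show "smooth_on \<Omega> (\<lambda>\<zeta>. (mink v (axis \<zeta>) * inverse (Re (rho \<zeta>))) *\<^sub>R axis \<zeta>)"
    by (intro smooth_intros op sa si)
  define d where "d \<zeta> = rho \<zeta> *\<^sub>C y \<zeta> - yh \<zeta>" for \<zeta>
  define j where "j \<zeta> = complex_of_real (inverse (Re (rho \<zeta>)))" for \<zeta>
  have jr: "j \<zeta> * rho \<zeta> = 1" if "\<zeta> \<in> \<Omega>" for \<zeta>
    using nzR[OF that] Re[OF that] by (simp add: j_def flip: of_real_mult)
      (metis Re nz of_real_inverse left_inverse that)
  have sd: "smooth_on \<Omega> d" and sj: "smooth_on \<Omega> j"
    unfolding d_def[abs_def] j_def[abs_def] by (intro smooth_intros op si)+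
  have smd: "smooth_on \<Omega> (\<lambda>\<zeta>. mink (cpx v) (d \<zeta>))" and smdj: "smooth_on \<Omega> (\<lambda>\<zeta>. mink (cpx v) (d \<zeta>) * j \<zeta>)"
    by (intro smooth_intros op sd sj)+
  have sry: "smooth_on \<Omega> (\<lambda>\<zeta>. rho \<zeta> *\<^sub>C y \<zeta>)"
    by (intro smooth_intros op)
  note D = smooth_imp_diff[OF _ z]
  \<comment> \<open>Reality of \<open>rho\<close> converts its antiholomorphic derivative, known
    from \<open>wzbar_rho\<close>, into the holomorphic one.\<close>
  have "wz rho \<zeta> = wz (\<lambda>\<zeta>. cnj (rho \<zeta>)) \<zeta>"
    by (rule wz_cong_open(1)[OF op z]) (simp add: real)
  then have wr: "wz rho \<zeta> = mu \<zeta> * rho \<zeta>"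
    using wz_cnj_raw(1)[OF D[OF smooth_rho]] wzbar_rho[OF z] real[OF z] by simp
  have "wz (\<lambda>\<zeta>. j \<zeta> * rho \<zeta>) \<zeta> = 0"
    by (rule wz_const_on(1)[OF op z jr])
  then have "(wz j \<zeta> + j \<zeta> * mu \<zeta>) * rho \<zeta> = 0"
    unfolding wz_mult_raw(1)[OF D[OF sj] D[OF smooth_rho]] wr by (simp add: algebra_simps)
  then have wj: "wz j \<zeta> = - (j \<zeta> * mu \<zeta>)"
    using nz[OF z] by (simp add: eq_neg_iff_add_eq_0)
  have dd: "dz d \<zeta> = (mu \<zeta> / 2) *\<^sub>C d \<zeta>"
  proof -
    have "dz d \<zeta> = (wz rho \<zeta> *\<^sub>C y \<zeta> + rho \<zeta> *\<^sub>C dz y \<zeta>) - dz yh \<zeta>"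
      unfolding d_def[abs_def] dz_diff(1)[OF D[OF sry] D[OF smooth_yh]]
        dz_cscale_raw(1)[OF D[OF smooth_rho] D[OF smooth_y]] ..
    also have "\<dots> = (mu \<zeta> / 2) *\<^sub>C d \<zeta>"
      unfolding wr dz_yh[OF z] dz_y_eq[of \<zeta>] d_def
      by (rule mink_vec_eqI; simp add: field_simps del: o_apply)
    finally show ?thesis .
  qed
  have "dz (cpx \<circ> (\<lambda>\<zeta>. (mink v (axis \<zeta>) * inverse (Re (rho \<zeta>))) *\<^sub>R axis \<zeta>)) \<zeta> =
      dz (\<lambda>\<zeta>. (mink (cpx v) (d \<zeta>) * j \<zeta>) *\<^sub>C d \<zeta>) \<zeta>"
  proof (rule dz_cong_open(1)[OF op z])
    fix w assume w: "w \<in> \<Omega>"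
    have "cpx (axis w) = d w"
      unfolding axis_def d_def by (simp add: cpx_diff cpx_scaleR Re[OF w])
    then show "(cpx \<circ> (\<lambda>\<zeta>. (mink v (axis \<zeta>) * inverse (Re (rho \<zeta>))) *\<^sub>R axis \<zeta>)) w =
      (mink (cpx v) (d w) * j w) *\<^sub>C d w"
      by (simp add: cpx_scaleR j_def flip: mink_cpx)
  qed
  also have "\<dots> = 0"
  proof -
    have "wz (\<lambda>\<zeta>. mink (cpx v) (d \<zeta>)) \<zeta> = mink (cpx v) (dz d \<zeta>)"
      using wz_mink_raw(1)[OF _ D[OF sd], of "\<lambda>_. cpx v"] dz_cmult(1)[of "\<lambda>_. cpx v" \<zeta> 0]
      by (simp add: dz_def frechet_derivative_const mink_simps)
    then have "wz (\<lambda>\<zeta>. mink (cpx v) (d \<zeta>) * j \<zeta>) \<zeta> = - ((mu \<zeta> / 2) * (mink (cpx v) (d \<zeta>) * j \<zeta>))"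
      unfolding wz_mult_raw(1)[OF D[OF smd] D[OF sj]] wj dd mink_simps by (simp add: field_simps)
    then show ?thesis
      unfolding dz_cscale_raw(1)[OF D[OF smdj] D[OF sd]] dd
      by (simp add: cscale_minus_left mult.commute)
  qed
  finally show "dz (cpx \<circ> (\<lambda>\<zeta>. (mink v (axis \<zeta>) * inverse (Re (rho \<zeta>))) *\<^sub>R axis \<zeta>)) \<zeta> = 0" .
qed

lemma y_in_VC: "y \<zeta> \<in> VC Y \<zeta>"
  using VC_memI(1)[of Y \<zeta>] by simp

lemma P_in_VC: "P \<zeta> \<in> VC Y \<zeta>"
  unfolding P_def by (intro VC_add VC_cscale y_in_VC VC_memI(2))

lemma cnjP_in_VC: "\<zeta> \<in> \<Omega> \<Longrightarrow> cnjv (P \<zeta>) \<in> VC Y \<zeta>"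
  using cnjv_P by (simp only:) (intro VC_add VC_cscale y_in_VC VC_memI(3))

end

section \<open>Central spheres: the S-Willmore surface and its dual\<close>

locale dual_pair = reversing_pair \<Omega> Y Z for \<Omega> :: "complex set"
  and Y Z :: "complex \<Rightarrow> (real, 'n::finite) mink_vec" +
  assumes normal_part_0: "\<And>\<zeta>. \<zeta> \<in> \<Omega> \<Longrightarrow> normal_part \<zeta> = 0"
begin

lemma dzzbar_y:
  assumes z: "\<zeta> \<in> \<Omega>"
  shows "dzbar (dz y) \<zeta> = (1/2) *\<^sub>C yh \<zeta> - mink (dzbar (dz y) \<zeta>) (yh \<zeta>) *\<^sub>C y \<zeta>
    - (cnj (mu \<zeta>) / 2) *\<^sub>C P \<zeta> - (mu \<zeta> / 2) *\<^sub>C cnjv (P \<zeta>)"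
proof -
  have "normal_part \<zeta> = 0" by (rule normal_part_0[OF z])
  then show ?thesis
    unfolding normal_part_def by (simp add: algebra_simps eq_neg_iff_add_eq_0)
qed

lemma yh_in_VC:
  assumes z: "\<zeta> \<in> \<Omega>"
  shows "yh \<zeta> \<in> VC Y \<zeta>"
proof -
  have "yh \<zeta> = 2 *\<^sub>C (dzbar (dz y) \<zeta> + mink (dzbar (dz y) \<zeta>) (yh \<zeta>) *\<^sub>C y \<zeta>
    + (cnj (mu \<zeta>) / 2) *\<^sub>C P \<zeta> + (mu \<zeta> / 2) *\<^sub>C cnjv (P \<zeta>))"
    by (subst dzzbar_y[OF z]) (simp add: cscale_add_right cscale_diff_right)
  also have "\<dots> \<in> VC Y \<zeta>"
    by (intro VC_add VC_cscale y_in_VC VC_memI(4) P_in_VC cnjP_in_VC z)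
  finally show ?thesis .
qed

text \<open>After exchanging the derivatives, the expansion of \<open>dzbar (dz y)\<close> in the
  frame of the sphere is differentiated. The only term that leaves \<open>VC\<close> is the second
  derivative inside \<open>dz P\<close>, and it carries the coefficient
  \<open>- cnj mu / 2\<close>.\<close>

lemma dzz_in_VC:
  assumes z: "\<zeta> \<in> \<Omega>"
  shows "dzbar (dz (dz y)) \<zeta> + (cnj (mu \<zeta>) / 2) *\<^sub>C dz (dz y) \<zeta> \<in> VC Y \<zeta>"
proof -
  define k where "k = (\<lambda>\<zeta>. mink (dzbar (dz y) \<zeta>) (yh \<zeta>))"
  note D = smooth_imp_diff[OF _ z]
  have smh: "smooth_on \<Omega> (\<lambda>\<zeta>. cnj (mu \<zeta>) / 2)"
    using smooth_on_cnj[OF op smooth_mu_half] by simp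
  have sk: "smooth_on \<Omega> k"
    unfolding k_def by (intro smooth_intros op)
  have s: "smooth_on \<Omega> (\<lambda>\<zeta>. (1/2) *\<^sub>C yh \<zeta>)" "smooth_on \<Omega> (\<lambda>\<zeta>. k \<zeta> *\<^sub>C y \<zeta>)"
    "smooth_on \<Omega> (\<lambda>\<zeta>. (cnj (mu \<zeta>) / 2) *\<^sub>C P \<zeta>)" "smooth_on \<Omega> (\<lambda>\<zeta>. (mu \<zeta> / 2) *\<^sub>C cnjv (P \<zeta>))"
    "smooth_on \<Omega> (\<lambda>\<zeta>. (1/2) *\<^sub>C yh \<zeta> - k \<zeta> *\<^sub>C y \<zeta>)"
    "smooth_on \<Omega> (\<lambda>\<zeta>. (1/2) *\<^sub>C yh \<zeta> - k \<zeta> *\<^sub>C y \<zeta> - (cnj (mu \<zeta>) / 2) *\<^sub>C P \<zeta>)"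
    "smooth_on \<Omega> (\<lambda>\<zeta>. cnjv (P \<zeta>))"
    by (intro smooth_intros op sk smooth_mu_half smh)+
  have w: "wz (\<lambda>\<zeta>. cnj (mu \<zeta>) / 2) \<zeta> = cnj (wzbar mu \<zeta>) / 2"
    using wz_half(1)[of "\<lambda>\<zeta>. cnj (mu \<zeta>)"] diffsZ[OF z] by (simp add: wz_cnj_raw)
  have cP: "dz (\<lambda>\<zeta>. cnjv (P \<zeta>)) \<zeta> = dzbar (dz y) \<zeta> + (cnj (wzbar mu \<zeta>) / 2) *\<^sub>C y \<zeta> + (cnj (mu \<zeta>) / 2) *\<^sub>C dz y \<zeta>"
    unfolding dz_cnjv_raw(1)[OF diffsZ(7)[OF z]] dz_P(2)[OF z]
    by (simp add: cnjv_simps dzzbar_real[OF z] dzbar_conj[OF z])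
  have "dzbar (dz (dz y)) \<zeta> = dz (dzbar (dz y)) \<zeta>"
    by (rule dz_dzbar_commute[OF op z]) (intro smooth_intros op)
  also have "\<dots> = dz (\<lambda>\<zeta>. (1/2) *\<^sub>C yh \<zeta> - k \<zeta> *\<^sub>C y \<zeta> - (cnj (mu \<zeta>) / 2) *\<^sub>C P \<zeta>
      - (mu \<zeta> / 2) *\<^sub>C cnjv (P \<zeta>)) \<zeta>"
    by (rule dz_cong_open(1)[OF op z]) (simp only: k_def, rule dzzbar_y)
  also have "\<dots> = (1/2) *\<^sub>C dz yh \<zeta> - (wz k \<zeta> *\<^sub>C y \<zeta> + k \<zeta> *\<^sub>C dz y \<zeta>)
      - ((cnj (wzbar mu \<zeta>) / 2) *\<^sub>C P \<zeta> + (cnj (mu \<zeta>) / 2) *\<^sub>C dz P \<zeta>)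
      - ((wz mu \<zeta> / 2) *\<^sub>C cnjv (P \<zeta>) + (mu \<zeta> / 2) *\<^sub>C dz (\<lambda>\<zeta>. cnjv (P \<zeta>)) \<zeta>)"
    unfolding dz_diff(1)[OF D[OF s(6)] D[OF s(4)]] dz_diff(1)[OF D[OF s(5)] D[OF s(3)]]
      dz_diff(1)[OF D[OF s(1)] D[OF s(2)]] dz_cmult(1)[OF diffsZ(1)[OF z]]
      dz_cscale_raw(1)[OF D[OF sk] diffs(1)[OF z]] dz_cscale_raw(1)[OF D[OF smh] diffsZ(7)[OF z]]
      dz_cscale_raw(1)[OF diffsZ(8)[OF z] D[OF s(7)]] wz_half(1)[OF diffsZ(4)[OF z]] w ..
  finally have e: "dzbar (dz (dz y)) \<zeta> + (cnj (mu \<zeta>) / 2) *\<^sub>C dz (dz y) \<zeta> =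
      (1/2) *\<^sub>C dz yh \<zeta> - (wz k \<zeta> *\<^sub>C y \<zeta> + k \<zeta> *\<^sub>C dz y \<zeta>) - (cnj (wzbar mu \<zeta>) / 2) *\<^sub>C P \<zeta>
      - (cnj (mu \<zeta>) / 2) *\<^sub>C ((wz mu \<zeta> / 2) *\<^sub>C y \<zeta> + (mu \<zeta> / 2) *\<^sub>C dz y \<zeta>)
      - ((wz mu \<zeta> / 2) *\<^sub>C cnjv (P \<zeta>) + (mu \<zeta> / 2) *\<^sub>C (dzbar (dz y) \<zeta> +
        (cnj (wzbar mu \<zeta>) / 2) *\<^sub>C y \<zeta> + (cnj (mu \<zeta>) / 2) *\<^sub>C dz y \<zeta>))"
    unfolding cP dz_P(1)[OF z] by (simp add: cscale_add_right)
  show ?thesis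
    unfolding e dz_yh[OF z]
    by (intro VC_diff VC_add VC_cscale y_in_VC VC_memI(2-4) P_in_VC cnjP_in_VC[OF z] yh_in_VC[OF z])
qed

context
  fixes s :: "complex \<Rightarrow> complex" and \<kappa> :: "complex \<Rightarrow> (complex, 'n) mink_vec"
  assumes perp: "\<And>\<zeta>. \<zeta> \<in> \<Omega> \<Longrightarrow> \<kappa> \<zeta> \<in> VC_perp Y \<zeta>"
    and hopf: "\<And>\<zeta>. \<zeta> \<in> \<Omega> \<Longrightarrow> dz (dz y) \<zeta> + (s \<zeta> / 2) *\<^sub>C cpx (Y \<zeta>) = \<kappa> \<zeta>"
begin

text \<open>Z lies in \<open>VC\<close>, so \<kappa> is orthogonal to it, and pairing the defining
  equation with Z isolates s. This is a Riccati equation for \<open>mu\<close>.\<close>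

lemma schwarzian_eq:
  assumes z: "\<zeta> \<in> \<Omega>"
  shows "s \<zeta> = wz mu \<zeta> - (mu \<zeta>)\<^sup>2 / 2"
proof -
  have "mink (\<kappa> \<zeta>) (yh \<zeta>) = 0"
    using perp[OF z] yh_in_VC[OF z] by (auto simp: VC_perp_def)
  then have "mink (dz (dz y) \<zeta>) (yh \<zeta>) - s \<zeta> / 2 = 0"
    unfolding hopf[OF z, symmetric] using pair_y_yh[OF z] by (simp add: mink_simps)
  then have "2 * mink (dz (dz y) \<zeta>) (yh \<zeta>) - s \<zeta> = 0"
    by (simp add: field_simps)
  then show ?thesis
    using wz_mu[OF z] theta_0[OF z] by simp
qed

text \<open>The conditions on s and \<kappa> are pointwise; smoothness comes from the formula for s
  in terms of \<open>mu\<close>.\<close>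

lemma smooth_kappa: "smooth_on \<Omega> \<kappa>"
proof (rule smooth_on_cong[OF op])
  show "smooth_on \<Omega> (\<lambda>\<zeta>. dz (dz y) \<zeta> + ((wz mu \<zeta> - mu \<zeta> * (mu \<zeta> * (1/2))) * (1/2)) *\<^sub>C y \<zeta>)"
    by (intro smooth_intros op)
  show "dz (dz y) \<zeta> + ((wz mu \<zeta> - mu \<zeta> * (mu \<zeta> * (1/2))) * (1/2)) *\<^sub>C y \<zeta> = \<kappa> \<zeta>" if "\<zeta> \<in> \<Omega>" for \<zeta>
    unfolding hopf[OF that, symmetric] schwarzian_eq[OF that]
    by (simp add: power2_eq_square)
qed

lemma dzbar_kappa:
  assumes z: "\<zeta> \<in> \<Omega>"
  shows "dzbar \<kappa> \<zeta> + (cnj (mu \<zeta>) / 2) *\<^sub>C \<kappa> \<zeta> \<in> VC Y \<zeta>"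
proof -
  define t where "t \<zeta> = (wz mu \<zeta> - mu \<zeta> * (mu \<zeta> * (1/2))) * (1/2)" for \<zeta>
  have st: "smooth_on \<Omega> t" "smooth_on \<Omega> (\<lambda>\<zeta>. t \<zeta> *\<^sub>C y \<zeta>)" "smooth_on \<Omega> (dz (dz y))"
    unfolding t_def[abs_def] by (intro smooth_intros op)+
  have k: "\<kappa> \<zeta> = dz (dz y) \<zeta> + t \<zeta> *\<^sub>C y \<zeta>" if "\<zeta> \<in> \<Omega>" for \<zeta>
    unfolding hopf[OF that, symmetric] schwarzian_eq[OF that] t_def by (simp add: power2_eq_square)
  note D = smooth_imp_diff[OF _ z]
  have "dzbar \<kappa> \<zeta> = dzbar (\<lambda>\<zeta>. dz (dz y) \<zeta> + t \<zeta> *\<^sub>C y \<zeta>) \<zeta>"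
    by (rule dz_cong_open(2)[OF op z k])
  also have "\<dots> = dzbar (dz (dz y)) \<zeta> + (wzbar t \<zeta> *\<^sub>C y \<zeta> + t \<zeta> *\<^sub>C dzbar y \<zeta>)"
    unfolding dz_add_raw(2)[OF D[OF st(3)] D[OF st(2)]] dz_cscale_raw(2)[OF D[OF st(1)] diffs(1)[OF z]] ..
  finally have e: "dzbar \<kappa> \<zeta> + (cnj (mu \<zeta>) / 2) *\<^sub>C \<kappa> \<zeta> =
      (dzbar (dz (dz y)) \<zeta> + (cnj (mu \<zeta>) / 2) *\<^sub>C dz (dz y) \<zeta>) +
      (wzbar t \<zeta> *\<^sub>C y \<zeta> + t \<zeta> *\<^sub>C dzbar y \<zeta> + (cnj (mu \<zeta>) / 2 * t \<zeta>) *\<^sub>C y \<zeta>)"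
    unfolding k[OF z] by (simp add: cscale_add_right)
  show ?thesis
    unfolding e by (rule VC_add[OF dzz_in_VC[OF z]]) (intro VC_add VC_cscale y_in_VC VC_memI(3))
qed

lemma Dzbar_kappa:
  assumes z: "\<zeta> \<in> \<Omega>"
  shows "Dzbar Y \<kappa> \<zeta> = (- cnj (mu \<zeta>) / 2) *\<^sub>C \<kappa> \<zeta>"
  unfolding Dzbar_def
  by (rule proj_perp_eqI[OF z VC_perp_cscale[OF perp[OF z]]])
    (use dzbar_kappa[OF z] in \<open>simp add: cscale_minus_left\<close>)

text \<open>Applying \<open>Dzbar_kappa\<close> twice multiplies \<kappa> by a Riccati expression in
  \<open>cnj mu\<close>, which \<open>schwarzian_eq\<close> identifies with
  \<open>- cnj s / 2\<close>.\<close>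

lemma willmore_equation:
  assumes z: "\<zeta> \<in> \<Omega>"
  shows "Dzbar Y (Dzbar Y \<kappa>) \<zeta> + (cnj (s \<zeta>) / 2) *\<^sub>C \<kappa> \<zeta> = 0"
proof -
  have sm: "smooth_on \<Omega> (\<lambda>\<zeta>. - cnj (mu \<zeta>) / 2)"
    using smooth_on_minus[OF op smooth_on_cnj[OF op smooth_mu_half]] by simp
  note D = smooth_imp_diff[OF _ z]
  have "(\<lambda>\<zeta>. - cnj (mu \<zeta>)) differentiable (at \<zeta>)"
    by (rule D) (intro smooth_intros op)
  then have w: "wzbar (\<lambda>\<zeta>. - cnj (mu \<zeta>) / 2) \<zeta> = - cnj (wz mu \<zeta>) / 2"
    using wz_half(2)[of "\<lambda>\<zeta>. - cnj (mu \<zeta>)" \<zeta>] diffsZ[OF z]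
    by (simp add: wz_minus wz_cnj_raw)
  have "dzbar (Dzbar Y \<kappa>) \<zeta> = dzbar (\<lambda>\<zeta>. (- cnj (mu \<zeta>) / 2) *\<^sub>C \<kappa> \<zeta>) \<zeta>"
    by (rule dz_cong_open(2)[OF op z Dzbar_kappa])
  also have "\<dots> = (- cnj (wz mu \<zeta>) / 2) *\<^sub>C \<kappa> \<zeta> + (- cnj (mu \<zeta>) / 2) *\<^sub>C dzbar \<kappa> \<zeta>"
    unfolding dz_cscale_raw(2)[OF D[OF sm] D[OF smooth_kappa]] w ..
  finally have "dzbar (Dzbar Y \<kappa>) \<zeta> - (- cnj (s \<zeta>) / 2) *\<^sub>C \<kappa> \<zeta> =
      (- cnj (mu \<zeta>) / 2) *\<^sub>C (dzbar \<kappa> \<zeta> + (cnj (mu \<zeta>) / 2) *\<^sub>C \<kappa> \<zeta>)"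
    unfolding schwarzian_eq[OF z]
    by (intro mink_vec_eqI; simp add: power2_eq_square field_simps)
  then have "dzbar (Dzbar Y \<kappa>) \<zeta> - (- cnj (s \<zeta>) / 2) *\<^sub>C \<kappa> \<zeta> \<in> VC Y \<zeta>"
    using VC_cscale[OF dzbar_kappa[OF z]] by simp
  from proj_perp_eqI[OF z VC_perp_cscale[OF perp[OF z]] this]
  have "Dzbar Y (Dzbar Y \<kappa>) \<zeta> = (- cnj (s \<zeta>) / 2) *\<^sub>C \<kappa> \<zeta>"
    unfolding Dzbar_def[of Y "Dzbar Y \<kappa>"] .
  then show ?thesis by (simp add: cscale_minus_left)
qed

end

text \<open>The formula forces N to be the remainder of Z after the other three terms. What has to
  be seen is that this remainder is real, lies in \<open>VC\<close> and has the pairings required of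
  N.\<close>

lemma dual_surface_formula:
  assumes z: "\<zeta> \<in> \<Omega>"
  obtains N where "is_N Y \<zeta> N"
    "complex_of_real ((cmod (mu \<zeta>))\<^sup>2 / 2) *\<^sub>C cpx (Y \<zeta>) + cnj (mu \<zeta>) *\<^sub>C dz y \<zeta> + mu \<zeta> *\<^sub>C dzbar y \<zeta> + cpx N
     = cpx (Z \<zeta>)"
proof -
  let ?c = "mu \<zeta> * cnj (mu \<zeta>) / 2"
  have c: "complex_of_real ((cmod (mu \<zeta>))\<^sup>2 / 2) = ?c"
    by (simp add: complex_norm_square flip: of_real_power)
  define M where "M = yh \<zeta> - (?c *\<^sub>C y \<zeta> + cnj (mu \<zeta>) *\<^sub>C dz y \<zeta> + mu \<zeta> *\<^sub>C dzbar y \<zeta>)"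
  have "cnjv M = M"
    unfolding M_def by (simp add: cnjv_simps dz_conj[OF z] dzbar_conj[OF z] algebra_simps)
  then obtain N where N: "M = cpx N"
    using range_cpx by blast
  have "M \<in> VC Y \<zeta>"
    unfolding M_def by (intro VC_diff VC_add VC_cscale y_in_VC VC_memI(2,3) yh_in_VC[OF z])
  have sym: "mink (yh \<zeta>) (dz y \<zeta>) = mink (dz y \<zeta>) (yh \<zeta>)" "mink (yh \<zeta>) (dzbar y \<zeta>) = mink (dzbar y \<zeta>) (yh \<zeta>)"
    "mink (y \<zeta>) (dz y \<zeta>) = mink (dz y \<zeta>) (y \<zeta>)" "mink (y \<zeta>) (dzbar y \<zeta>) = mink (dzbar y \<zeta>) (y \<zeta>)"
    "mink (yh \<zeta>) (y \<zeta>) = mink (y \<zeta>) (yh \<zeta>)"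
    by (rule mink_sym)+
  have b: "mink (dzbar y \<zeta>) (yh \<zeta>) = cnj (mu \<zeta>) / 2"
    using mink_cnjv[of "dz y \<zeta>" "yh \<zeta>"] unfolding pair_dz_yh[OF z] by (simp add: dz_conj[OF z])
  note ps = pairs[OF z] pair_yh_yh[OF z] pair_y_yh[OF z] pair_dz_yh[OF z] b sym
  have "mink M M = 0" "mink M (y \<zeta>) = -1" "mink M (dz y \<zeta>) = 0"
    unfolding M_def by (simp_all add: mink_simps ps del: o_apply)
  then have M: "complex_of_real (mink N N) = of_real 0"
      "complex_of_real (mink N (Y \<zeta>)) = of_real (-1)" "mink (cpx N) (dz y \<zeta>) = 0"
    by (simp_all add: N mink_cpx)
  have "is_N Y \<zeta> N"
    using M(3) \<open>M \<in> VC Y \<zeta>\<close> M(1,2)[unfolded of_real_eq_iff] unfolding is_N_def N by simp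
  moreover have "?c *\<^sub>C cpx (Y \<zeta>) + cnj (mu \<zeta>) *\<^sub>C dz y \<zeta> + mu \<zeta> *\<^sub>C dzbar y \<zeta> + M = cpx (Z \<zeta>)"
    unfolding M_def by simp
  ultimately show ?thesis
    using that unfolding c N by blast
qed

end

subsection \<open>The orientation preserving case\<close>

text \<open>The imaginary part of the mixed derivative of Z must vanish. This leaves
  \<open>dz (dz y) - dzbar (dzbar y)\<close> as a combination of Z and Y, and pairing with Y removes
  Z. The form with arbitrary Z and m allows a second use, with the two lifts exchanged and m
  replaced by its negative.\<close>

lemma (in lift) christoffel_relation:
  fixes Z :: "complex \<Rightarrow> (real, 'n) mink_vec"
  assumes sZ: "smooth_on \<Omega> Z" and sm: "smooth_on \<Omega> m" and z: "\<zeta> \<in> \<Omega>"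
    and YZ: "mink (Y \<zeta>) (Z \<zeta>) = -1"
    and rel: "\<And>\<zeta>. \<zeta> \<in> \<Omega> \<Longrightarrow> dz (cpx \<circ> Z) \<zeta> = (m \<zeta> / 2) *\<^sub>C cpx (Z \<zeta>) + dzbar y \<zeta> + (cnj (m \<zeta>) / 2) *\<^sub>C y \<zeta>"
  obtains \<eta> where "dz (dz y) \<zeta> - dzbar (dzbar y) \<zeta> = \<eta> *\<^sub>C y \<zeta>"
proof -
  define w where "w = cpx \<circ> Z"
  have sw: "smooth_on \<Omega> w"
    unfolding w_def o_def by (intro smooth_intros op sZ)
  have smh: "smooth_on \<Omega> (\<lambda>\<zeta>. m \<zeta> / 2)"
    using smooth_on_mult[OF op sm smooth_on_const[OF op, of "1/2"]] by simp
  have scmh: "smooth_on \<Omega> (\<lambda>\<zeta>. cnj (m \<zeta>) / 2)"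
    using smooth_on_cnj[OF op smh] by simp
  note D = smooth_imp_diff[OF _ z]
  have conj: "cnjv (dz w \<zeta>) = dzbar w \<zeta>" if "\<zeta> \<in> \<Omega>" for \<zeta>
    using dz_cnjv_raw(2)[OF smooth_imp_diff[OF sw that]] by (simp add: w_def o_def)
  have rl: "dz w \<zeta> = (m \<zeta> / 2) *\<^sub>C w \<zeta> + dzbar y \<zeta> + (cnj (m \<zeta>) / 2) *\<^sub>C y \<zeta>" if "\<zeta> \<in> \<Omega>" for \<zeta>
    using rel[OF that] by (simp add: w_def)
  have rlb: "dzbar w \<zeta> = (cnj (m \<zeta>) / 2) *\<^sub>C w \<zeta> + dz y \<zeta> + (m \<zeta> / 2) *\<^sub>C y \<zeta>"
    unfolding conj[OF z, symmetric] rl[OF z] by (simp add: cnjv_simps dzbar_conj[OF z] w_def)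
  have s: "smooth_on \<Omega> (\<lambda>\<zeta>. (m \<zeta> / 2) *\<^sub>C w \<zeta>)" "smooth_on \<Omega> (\<lambda>\<zeta>. (cnj (m \<zeta>) / 2) *\<^sub>C y \<zeta>)"
    "smooth_on \<Omega> (\<lambda>\<zeta>. (m \<zeta> / 2) *\<^sub>C w \<zeta> + dzbar y \<zeta>)" "smooth_on \<Omega> (\<lambda>\<zeta>. cnj (m \<zeta>))"
    by (intro smooth_intros op smh scmh sw sm)+
  have h: "wzbar (\<lambda>\<zeta>. m \<zeta> / 2) \<zeta> = wzbar m \<zeta> / 2" "wzbar (\<lambda>\<zeta>. cnj (m \<zeta>) / 2) \<zeta> = cnj (wz m \<zeta>) / 2"
    using wz_cmult(2)[OF D[OF sm], of "1/2"] wz_cmult(2)[OF D[OF s(4)], of "1/2"] wz_cnj_raw(2)[OF D[OF sm]]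
    by simp_all
  have "dzbar (dz w) \<zeta> = dzbar (\<lambda>\<zeta>. (m \<zeta> / 2) *\<^sub>C w \<zeta> + dzbar y \<zeta> + (cnj (m \<zeta>) / 2) *\<^sub>C y \<zeta>) \<zeta>"
    by (rule dz_cong_open(2)[OF op z rl])
  also have "\<dots> = (wzbar m \<zeta> / 2) *\<^sub>C w \<zeta> + (m \<zeta> / 2) *\<^sub>C dzbar w \<zeta> + dzbar (dzbar y) \<zeta>
      + ((cnj (wz m \<zeta>) / 2) *\<^sub>C y \<zeta> + (cnj (m \<zeta>) / 2) *\<^sub>C dzbar y \<zeta>)"
    unfolding dz_add_raw(2)[OF D[OF s(3)] D[OF s(2)]] dz_add_raw(2)[OF D[OF s(1)] diffs(3)[OF z]]
      dz_cscale_raw(2)[OF D[OF smh] D[OF sw]] dz_cscale_raw(2)[OF D[OF scmh] diffs(1)[OF z]] h ..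
  finally have e: "dzbar (dz w) \<zeta> = (wzbar m \<zeta> / 2) *\<^sub>C w \<zeta> + (m \<zeta> / 2) *\<^sub>C dzbar w \<zeta> + dzbar (dzbar y) \<zeta>
      + ((cnj (wz m \<zeta>) / 2) *\<^sub>C y \<zeta> + (cnj (m \<zeta>) / 2) *\<^sub>C dzbar y \<zeta>)" .
  have real: "cnjv (dzbar (dz w) \<zeta>) = dzbar (dz w) \<zeta>"
  proof -
    have "dzbar (dz w) \<zeta> = dzbar (\<lambda>\<zeta>. cnjv (dzbar w \<zeta>)) \<zeta>"
      by (rule dz_cong_open(2)[OF op z]) (simp flip: conj)
    also have "\<dots> = cnjv (dz (dzbar w) \<zeta>)"
      by (rule dz_cnjv_raw(2)) (intro D smooth_intros op sw)
    finally show ?thesis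
      using dz_dzbar_commute[OF op z sw] by simp
  qed
  have conj2: "cnjv (dzbar (dzbar y) \<zeta>) = dz (dz y) \<zeta>"
    by (simp flip: dzz_conj[OF z])
  define n where "n = (wzbar m \<zeta> - cnj (wzbar m \<zeta>)) / 2"
  define \<eta> where "\<eta> = (m \<zeta>)\<^sup>2 / 4 - (cnj (m \<zeta>))\<^sup>2 / 4 + (cnj (wz m \<zeta>) - wz m \<zeta>) / 2"
  have ce: "cnjv (dzbar (dz w) \<zeta>) = (cnj (wzbar m \<zeta>) / 2) *\<^sub>C w \<zeta> + (cnj (m \<zeta>) / 2) *\<^sub>C dz w \<zeta> + dz (dz y) \<zeta>
      + ((wz m \<zeta> / 2) *\<^sub>C y \<zeta> + (m \<zeta> / 2) *\<^sub>C dz y \<zeta>)"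
    unfolding e by (simp add: cnjv_simps conj2 dzbar_conj[OF z] w_def)
      (simp add: w_def[symmetric] conj[OF z, symmetric])
  have "(dz (dz y) \<zeta> - dzbar (dzbar y) \<zeta>) - (n *\<^sub>C w \<zeta> + \<eta> *\<^sub>C y \<zeta>)
      = cnjv (dzbar (dz w) \<zeta>) - dzbar (dz w) \<zeta>"
    unfolding ce unfolding e rlb rl[OF z]
    by (rule mink_vec_eqI; simp add: n_def \<eta>_def power2_eq_square field_simps del: o_apply)
  then have d: "dz (dz y) \<zeta> - dzbar (dzbar y) \<zeta> = n *\<^sub>C w \<zeta> + \<eta> *\<^sub>C y \<zeta>"
    using real by simp
  have "mink (dzbar (dzbar y) \<zeta>) (y \<zeta>) = 0"
    using mink_cnjv[of "dz (dz y) \<zeta>" "y \<zeta>"] pair_dzz_y[OF z] by (simp add: dzz_conj[OF z])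
  moreover have "mink (w \<zeta>) (y \<zeta>) = -1"
    using YZ by (simp add: w_def mink_cpx mink_sym[of "Z \<zeta>"])
  ultimately have "n = 0"
    using arg_cong[OF d, of "\<lambda>v. mink v (y \<zeta>)"] pair_dzz_y[OF z] pair_y_y[OF z]
    by (simp add: mink_simps del: o_apply)
  with d that show ?thesis by simp
qed

locale preserving_pair = enveloped_pair \<Omega> Y Z for \<Omega> :: "complex set"
  and Y Z :: "complex \<Rightarrow> (real, 'n::finite) mink_vec" +
  assumes rho_0: "\<And>\<zeta>. \<zeta> \<in> \<Omega> \<Longrightarrow> rho \<zeta> = 0"
begin

text \<open>The same comparison of conjugate pairings as for \<open>wzbar_rho\<close>, but here the
  terms with \<open>mu\<close> on the two sides cancel.\<close>

lemma wzbar_theta: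
  assumes z: "\<zeta> \<in> \<Omega>"
  shows "wzbar theta \<zeta> = 0"
proof -
  have dy: "dz yh \<zeta> = (mu \<zeta> / 2) *\<^sub>C yh \<zeta> + theta \<zeta> *\<^sub>C cnjv (P \<zeta>)" if "\<zeta> \<in> \<Omega>" for \<zeta>
    using decomp[OF that] rho_0[OF that] by simp
  have dyb: "dzbar yh \<zeta> = (cnj (mu \<zeta>) / 2) *\<^sub>C yh \<zeta> + cnj (theta \<zeta>) *\<^sub>C P \<zeta>"
    using decomp_conj[OF z] rho_0[OF z] by simp
  note D = smooth_imp_diff[OF _ z]
  have s: "smooth_on \<Omega> (\<lambda>\<zeta>. (mu \<zeta> / 2) *\<^sub>C yh \<zeta>)" "smooth_on \<Omega> (\<lambda>\<zeta>. theta \<zeta> *\<^sub>C cnjv (P \<zeta>))"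
    by (intro smooth_intros op smooth_mu_half)+
  have "dzbar (dz yh) \<zeta> = dzbar (\<lambda>\<zeta>. (mu \<zeta> / 2) *\<^sub>C yh \<zeta> + theta \<zeta> *\<^sub>C cnjv (P \<zeta>)) \<zeta>"
    by (rule dz_cong_open(2)[OF op z dy])
  also have "\<dots> = ((wzbar mu \<zeta> / 2) *\<^sub>C yh \<zeta> + (mu \<zeta> / 2) *\<^sub>C dzbar yh \<zeta>)
      + (wzbar theta \<zeta> *\<^sub>C cnjv (P \<zeta>) + theta \<zeta> *\<^sub>C cnjv (dz P \<zeta>))"
    unfolding dz_add_raw(2)[OF D[OF s(1)] D[OF s(2)]] dz_cscale_raw(2)[OF diffsZ(8,1)[OF z]]
      dz_cscale_raw(2)[OF diffsZ(6,11)[OF z]] wz_half(2)[OF diffsZ(4)[OF z]]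
      dz_cnjv_raw(2)[OF diffsZ(7)[OF z]] ..
  finally have e: "dzbar (dz yh) \<zeta> = ((wzbar mu \<zeta> / 2) *\<^sub>C yh \<zeta> + (mu \<zeta> / 2) *\<^sub>C dzbar yh \<zeta>)
      + (wzbar theta \<zeta> *\<^sub>C cnjv (P \<zeta>) + theta \<zeta> *\<^sub>C cnjv (dz P \<zeta>))" .
  have 1: "mink (cnjv (dz P \<zeta>)) (P \<zeta>) = cnj (mu \<zeta>) / 4"
  proof -
    have "mink (dz P \<zeta>) (cnjv (P \<zeta>)) = mu \<zeta> / 4"
      unfolding dz_P[OF z] cnjv_P[OF z]
      by (simp add: mink_simps pairs[OF z] mink_sym[of "y \<zeta>" "dzbar y \<zeta>"] del: o_apply)
    then show ?thesis
      unfolding mink_cnjv_left by (simp only: complex_cnj_divide complex_cnj_numeral)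
  qed
  have 2: "mink (dzbar (dz yh) \<zeta>) (P \<zeta>) = wzbar theta \<zeta> / 2 + theta \<zeta> * cnj (mu \<zeta>) / 4"
    unfolding e dyb by (simp add: mink_simps pairsP[OF z] 1 del: o_apply)
  have 3: "mink (dzbar (dz yh) \<zeta>) (cnjv (P \<zeta>)) = mu \<zeta> * cnj (theta \<zeta>) / 4"
  proof -
    have "mink (cnjv (dz P \<zeta>)) (cnjv (P \<zeta>)) = 0"
      unfolding mink_cnjv dz_P[OF z] P_def
      by (simp add: mink_simps pairs[OF z] mink_sym[of "y \<zeta>" "dz y \<zeta>"] del: o_apply)
    then show ?thesis
      unfolding e dyb by (simp add: mink_simps pairsP[OF z] del: o_apply)
  qed
  have "mink (dzbar (dz yh) \<zeta>) (P \<zeta>) = cnj (mink (dzbar (dz yh) \<zeta>) (cnjv (P \<zeta>)))"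
    using mink_cnjv[of "dzbar (dz yh) \<zeta>" "cnjv (P \<zeta>)"] by (simp add: dzzbar_realZ[OF z])
  then show ?thesis
    unfolding 2 3 by simp
qed

lemma theta_holomorphic: "theta holomorphic_on \<Omega>"
proof (subst holomorphic_on_open[OF op], intro ballI)
  fix \<zeta> assume z: "\<zeta> \<in> \<Omega>"
  let ?D = "frechet_derivative theta (at \<zeta>)"
  have D: "(theta has_derivative ?D) (at \<zeta>)"
    by (rule smooth_on_has_derivative[OF smooth_theta z])
  have "?D 1 + \<i> * ?D \<i> = 0"
    using wzbar_theta[OF z] by (simp add: wzbar_def)
  then have Di: "?D \<i> = \<i> * ?D 1"
  proof -
    assume "?D 1 + \<i> * ?D \<i> = 0"
    then have "\<i> * (?D 1 + \<i> * ?D \<i>) = 0" by simp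
    then show ?thesis by (simp add: distrib_left)
  qed
  have "?D v = ?D 1 * v" for v
  proof -
    have "?D v = Re v *\<^sub>R ?D 1 + Im v *\<^sub>R ?D \<i>"
      by (rule linear_complex_expand[OF has_derivative_linear[OF D]])
    also have "\<dots> = ?D 1 * (Re v + \<i> * Im v)"
      unfolding Di by (simp add: scaleR_conv_of_real algebra_simps)
    also have "Re v + \<i> * Im v = v"
      by (rule complex_eq[symmetric])
    finally show ?thesis .
  qed
  then have "?D = (*) (?D 1)" by (rule ext)
  with D show "\<exists>f'. (theta has_field_derivative f') (at \<zeta>)"
    unfolding has_field_derivative_def by metis
qed

text \<open>In a coordinate with \<open>\<theta> = 1\<close> the lift \<open>Z\<close> is canonical too and the relation between \<open>Y\<close> and \<open>Z\<close>
  is symmetric.\<close>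

context
  assumes theta_1: "\<And>\<zeta>. \<zeta> \<in> \<Omega> \<Longrightarrow> theta \<zeta> = 1"
begin

lemma dz_yh_1:
  assumes z: "\<zeta> \<in> \<Omega>"
  shows "dz yh \<zeta> = (mu \<zeta> / 2) *\<^sub>C yh \<zeta> + cnjv (P \<zeta>)"
  using decomp[OF z] rho_0[OF z] theta_1[OF z] by simp

lemma dzbar_yh_1:
  assumes z: "\<zeta> \<in> \<Omega>"
  shows "dzbar yh \<zeta> = (cnj (mu \<zeta>) / 2) *\<^sub>C yh \<zeta> + P \<zeta>"
  using decomp_conj[OF z] rho_0[OF z] theta_1[OF z] by simp

lemma lift_Z: "lift \<Omega> Z"
proof
  fix \<zeta> assume z: "\<zeta> \<in> \<Omega>"
  show "mink (dz yh \<zeta>) (dz yh \<zeta>) = 0" "mink (dz yh \<zeta>) (dzbar yh \<zeta>) = 1/2"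
    unfolding dz_yh_1[OF z] dzbar_yh_1[OF z] by (simp_all add: mink_simps pairsP[OF z] del: o_apply)
qed (use op sZ nullZ in auto)

lemma hopf_real_Y:
  assumes z: "\<zeta> \<in> \<Omega>" and k: "\<kappa> \<in> VC_perp Y \<zeta>" "dz (dz y) \<zeta> + (s / 2) *\<^sub>C cpx (Y \<zeta>) = \<kappa>"
  shows "\<kappa> \<in> range cpx"
proof -
  have "dz (cpx \<circ> Z) \<zeta> = (mu \<zeta> / 2) *\<^sub>C cpx (Z \<zeta>) + dzbar y \<zeta> + (cnj (mu \<zeta>) / 2) *\<^sub>C y \<zeta>"
    if "\<zeta> \<in> \<Omega>" for \<zeta>
    using dz_yh_1[OF that] cnjv_P[OF that] by (simp add: add.assoc)
  from christoffel_relation[OF sZ smooth_mu z pairYZ[OF z] this]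
  obtain \<eta> where "dz (dz y) \<zeta> - dzbar (dzbar y) \<zeta> = \<eta> *\<^sub>C y \<zeta>" by blast
  from hopf_realI[OF z k this] show ?thesis .
qed

lemma hopf_real_Z:
  assumes z: "\<zeta> \<in> \<Omega>" and k: "\<kappa> \<in> VC_perp Z \<zeta>" "dz (dz yh) \<zeta> + (s / 2) *\<^sub>C cpx (Z \<zeta>) = \<kappa>"
  shows "\<kappa> \<in> range cpx"
proof -
  interpret Z: lift \<Omega> Z by (rule lift_Z)
  have r: "dz (cpx \<circ> Y) \<zeta> = (- mu \<zeta> / 2) *\<^sub>C cpx (Y \<zeta>) + dzbar yh \<zeta> + (cnj (- mu \<zeta>) / 2) *\<^sub>C yh \<zeta>"
    if "\<zeta> \<in> \<Omega>" for \<zeta>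
    using dzbar_yh_1[OF that] dz_y_eq[of \<zeta>] by (simp add: cscale_minus_left)
  have "smooth_on \<Omega> (\<lambda>\<zeta>. - mu \<zeta>)"
    by (intro smooth_intros op)
  from Z.christoffel_relation[OF sY this z _ r] pairYZ[OF z]
  obtain \<eta> where "dz (dz yh) \<zeta> - dzbar (dzbar yh) \<zeta> = \<eta> *\<^sub>C yh \<zeta>"
    by (auto simp: mink_sym[of "Z \<zeta>"])
  from Z.hopf_realI[OF z k this] show ?thesis .
qed

end

end

subsection \<open>Coordinate changes\<close>

context
  fixes A :: "('m::t2_space) atlas"
  assumes RS: "riemann_surface A"
begin

lemma chart_homeomorphism:
  assumes "(W, \<phi>) \<in> A"
  shows "open W" "open (\<phi> ` W)" "homeomorphism W (\<phi> ` W) \<phi> (inv_into W \<phi>)" "inj_on \<phi> W"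
    "continuous_on W \<phi>"
proof -
  have "\<forall>c\<in>A. open (fst c) \<and> open (snd c ` fst c) \<and>
      homeomorphism (fst c) (snd c ` fst c) (snd c) (inv_into (fst c) (snd c))"
    using RS unfolding riemann_surface_def case_prod_beta by (elim conjE)
  from bspec[OF this assms]
  show "open W" "open (\<phi> ` W)" and h: "homeomorphism W (\<phi> ` W) \<phi> (inv_into W \<phi>)"
    by simp_all
  show "continuous_on W \<phi>"
    using h by (simp add: homeomorphism_def)
  show "inj_on \<phi> W"
    by (rule inj_on_inverseI) (rule homeomorphism_apply1[OF h])
qed

lemma chart_exists:
  obtains W \<phi> where "(W, \<phi>) \<in> A" "p \<in> W"
proof -
  have "(\<Union>(W, \<phi>)\<in>A. W) = UNIV"
    using RS unfolding riemann_surface_def by (elim conjE)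
  then have "p \<in> (\<Union>(W, \<phi>)\<in>A. W)" by simp
  then show ?thesis using that by auto
qed

lemma chart_coordinate: "(W, \<phi>) \<in> A \<Longrightarrow> coordinate A W \<phi>"
proof -
  assume W: "(W, \<phi>) \<in> A"
  have hol: "\<forall>c\<in>A. \<forall>d\<in>A. (snd d \<circ> inv_into (fst c) (snd c)) holomorphic_on snd c ` (fst c \<inter> fst d)"
    using RS unfolding riemann_surface_def case_prod_beta by (elim conjE)
  have "(\<phi> \<circ> inv_into (fst c) (snd c)) holomorphic_on snd c ` (fst c \<inter> W)" if "c \<in> A" for c
    using bspec[OF bspec[OF hol that] W] by simp
  then show ?thesis
    using chart_homeomorphism(1,4)[OF W] unfolding coordinate_def case_prod_beta by simp
qed

text \<open>\<open>coordinate\<close> provides holomorphy only in the direction from charts to z. An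
  injective holomorphic map is open with holomorphic inverse, which gives the other direction and
  the relation of the derivatives.\<close>

lemma coordinate_transition:
  assumes z: "coordinate A V z" and W: "(W, \<phi>) \<in> A"
  shows "open (z ` (W \<inter> V))" "(\<phi> \<circ> inv_into V z) holomorphic_on z ` (W \<inter> V)"
    "\<And>p. p \<in> W \<Longrightarrow> p \<in> V \<Longrightarrow>
       deriv (z \<circ> inv_into W \<phi>) (\<phi> p) * deriv (\<phi> \<circ> inv_into V z) (z p) = 1"
    "continuous_on (W \<inter> V) z"
proof -
  let ?h = "z \<circ> inv_into W \<phi>" and ?D = "\<phi> ` (W \<inter> V)"
  note W' = chart_homeomorphism[OF W]
  have injz: "inj_on z V" and "open V" and hol: "?h holomorphic_on ?D"
    using z W by (auto simp: coordinate_def)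
  have inv1: "inv_into W \<phi> (\<phi> p) = p" if "p \<in> W" for p
    using W'(4) that by simp
  have "openin (top_of_set W) (W \<inter> V)"
    using \<open>open V\<close> by (simp add: openin_open_Int)
  then have "openin (top_of_set (\<phi> ` W)) ?D"
    using homeomorphism_imp_open_map[OF W'(3)] by blast
  then have oD: "open ?D"
    using W'(2) openin_open_trans by blast
  have inj: "inj_on ?h ?D"
    using injz inv1 by (auto simp: inj_on_def)
  have im: "?h ` ?D = z ` (W \<inter> V)"
    using inv1 by (force simp: image_iff)
  obtain g where g: "g holomorphic_on ?h ` ?D" "\<And>w. w \<in> ?D \<Longrightarrow> deriv ?h w * deriv g (?h w) = 1"
    "\<And>w. w \<in> ?D \<Longrightarrow> g (?h w) = w"
    using holomorphic_has_inverse[OF hol oD inj] by metis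
  show oi: "open (z ` (W \<inter> V))"
    using open_mapping_thm3[OF hol oD inj] im by simp
  have gz: "g \<zeta> = (\<phi> \<circ> inv_into V z) \<zeta>" if "\<zeta> \<in> z ` (W \<inter> V)" for \<zeta>
    using that g(3) injz inv1 by fastforce
  show hg: "(\<phi> \<circ> inv_into V z) holomorphic_on z ` (W \<inter> V)"
    using holomorphic_cong[OF refl gz] g(1) im by (simp add: o_def)
  show "deriv ?h (\<phi> p) * deriv (\<phi> \<circ> inv_into V z) (z p) = 1" if "p \<in> W" "p \<in> V" for p
  proof -
    have "deriv g (z p) = deriv (\<phi> \<circ> inv_into V z) (z p)"
      by (rule deriv_cong_ev) (use oi gz that in \<open>auto simp: eventually_nhds\<close>)
    then show ?thesis
      using g(2)[of "\<phi> p"] inv1 that by auto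
  qed
  have "continuous_on (W \<inter> V) (\<lambda>p. ?h (\<phi> p))"
    by (rule continuous_on_compose2[OF holomorphic_on_imp_continuous_on[OF hol]])
      (auto intro: continuous_on_subset[OF W'(5)])
  then show "continuous_on (W \<inter> V) z"
    by (rule continuous_on_eq) (use inv1 in auto)
qed

lemma coordinate_continuous:
  assumes z: "coordinate A V z"
  shows "continuous_on V z"
proof -
  have "isCont z p" if "p \<in> V" for p
  proof -
    obtain W \<phi> where W: "(W, \<phi>) \<in> A" "p \<in> W" by (rule chart_exists)
    have "open (W \<inter> V)"
      using chart_homeomorphism(1)[OF W(1)] z by (auto simp: coordinate_def)
    then show ?thesis
      using coordinate_transition(4)[OF z W(1)] W(2) that
      by (simp add: continuous_on_eq_continuous_at)
  qed
  then show ?thesis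
    by (simp add: continuous_at_imp_continuous_on)
qed

lemma coordinate_open_image:
  assumes z: "coordinate A V z"
  shows "open (z ` V)"
proof (subst open_subopen, intro ballI)
  fix \<zeta> assume "\<zeta> \<in> z ` V"
  then obtain p where p: "p \<in> V" "\<zeta> = z p" by auto
  obtain W \<phi> where W: "(W, \<phi>) \<in> A" "p \<in> W" by (rule chart_exists)
  show "\<exists>T. open T \<and> \<zeta> \<in> T \<and> T \<subseteq> z ` V"
    by (rule exI[of _ "z ` (W \<inter> V)"]) (use coordinate_transition(1)[OF z W(1)] p W(2) in auto)
qed

lemma smooth_in_coordinate:
  assumes z: "coordinate A V z" and g: "smooth_map_on A UNIV g"
  shows "smooth_on (z ` V) (g \<circ> inv_into V z)"
proof (rule smooth_on_local)
  fix \<zeta> assume "\<zeta> \<in> z ` V"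
  then obtain p where p: "p \<in> V" "\<zeta> = z p" by auto
  obtain W \<phi> where W: "(W, \<phi>) \<in> A" "p \<in> W" by (rule chart_exists)
  note t = coordinate_transition[OF z W(1)]
  have injz: "inj_on z V" using z by (simp add: coordinate_def)
  have inv1: "inv_into W \<phi> (\<phi> p) = p" if "p \<in> W" for p
    using chart_homeomorphism(4)[OF W(1)] that by simp
  have s: "smooth_on (\<phi> ` W) (g \<circ> inv_into W \<phi>)"
    using g W(1) by (auto simp: smooth_map_on_def)
  have "smooth_on (z ` (W \<inter> V)) (\<lambda>\<zeta>. (g \<circ> inv_into W \<phi>) ((\<phi> \<circ> inv_into V z) \<zeta>))"
    by (rule smooth_on_compose_holomorphic[OF t(1,2) _ s]) (use injz in auto)
  then have "smooth_on (z ` (W \<inter> V)) (g \<circ> inv_into V z)"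
    by (rule smooth_on_cong[OF t(1), rotated]) (use injz inv1 in auto)
  then show "\<exists>S. open S \<and> \<zeta> \<in> S \<and> smooth_on S (g \<circ> inv_into V z)"
    using t(1) p W(2) by (intro exI[of _ "z ` (W \<inter> V)"]) auto
qed

lemma diff_at_transition:
  fixes g :: "'m \<Rightarrow> 'b::real_normed_vector"
  assumes z: "coordinate A V z" and W: "(W, \<phi>) \<in> A" and p: "p \<in> W" "p \<in> V"
    and g: "smooth_map_on A UNIV g"
  shows "diff_at V z g p v = diff_at W \<phi> g p (deriv (\<phi> \<circ> inv_into V z) (z p) * v)"
proof -
  note t = coordinate_transition[OF z W]
  have injz: "inj_on z V" using z by (simp add: coordinate_def)
  have inv1: "inv_into W \<phi> (\<phi> p) = p" if "p \<in> W" for p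
    using chart_homeomorphism(4)[OF W] that by simp
  let ?h = "\<phi> \<circ> inv_into V z" and ?G = "g \<circ> inv_into W \<phi>"
  have s: "smooth_on (\<phi> ` W) ?G"
    using g W by (auto simp: smooth_map_on_def)
  have h: "(?h has_field_derivative deriv ?h (z p)) (at (z p))"
    using holomorphic_derivI[OF t(2,1)] p by auto
  have hp: "?h (z p) = \<phi> p" using injz p by simp
  have "(?G has_derivative frechet_derivative ?G (at (\<phi> p))) (at (?h (z p)))"
    unfolding hp using smooth_on_has_derivative[OF s] p by auto
  from has_derivative_compose_holomorphic[OF h this]
  have "((\<lambda>x. ?G (?h x)) has_derivative (\<lambda>v. diff_at W \<phi> g p (deriv ?h (z p) * v))) (at (z p))"
    by (simp add: diff_at_def)
  then have "((g \<circ> inv_into V z) has_derivative (\<lambda>v. diff_at W \<phi> g p (deriv ?h (z p) * v))) (at (z p))"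
    by (rule has_derivative_transform_within_open[OF _ t(1)]) (use p injz inv1 in auto)
  from frechet_derivative_at[OF this, symmetric] show ?thesis
    unfolding diff_at_def[of V] by metis
qed

end

subsection \<open>Reflections and orientations\<close>

definition refl :: "'a::real_inner \<Rightarrow> 'a \<Rightarrow> 'a" where
  "refl m v = v - (2 * (v \<bullet> m) / (m \<bullet> m)) *\<^sub>R m"

lemma refl_refl: "m \<noteq> 0 \<Longrightarrow> refl m (refl m v) = v"
  by (simp add: refl_def inner_diff_left algebra_simps)

lemma inner_refl_left: "refl m u \<bullet> v = u \<bullet> refl m v"
  by (simp add: refl_def inner_diff_left inner_diff_right inner_commute)

lemma inner_refl_refl: "m \<noteq> 0 \<Longrightarrow> refl m u \<bullet> refl m v = u \<bullet> v"
  by (simp add: inner_refl_left refl_refl)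

lemma refl_add: "refl m (u + v) = refl m u + refl m v"
  by (simp add: refl_def inner_add_left add_divide_distrib algebra_simps)

lemma refl_scaleR: "refl m (c *\<^sub>R v) = c *\<^sub>R refl m v"
  by (simp add: refl_def algebra_simps)

text \<open>Two points at equal distance from c are exchanged by the reflection in their bisecting
  hyperplane, and this hyperplane passes through c.\<close>

lemma refl_radius:
  assumes "norm (x - c) = norm (x' - c)" "x \<noteq> x'"
  shows "refl (x' - x) (x - c) = x' - c"
proof -
  have eq: "(x - c) \<bullet> (x - c) = (x' - c) \<bullet> (x' - c)"
    using assms(1) by (simp add: dot_square_norm)
  have "2 * (u \<bullet> (u' - u)) = - ((u' - u) \<bullet> (u' - u))" if "u \<bullet> u = u' \<bullet> u'" for u u' :: 'a
    using that by (simp add: inner_diff_left inner_diff_right inner_commute)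
  from this[OF eq] have "2 * ((x - c) \<bullet> (x' - x)) = - ((x' - x) \<bullet> (x' - x))"
    by simp
  moreover have "(x' - x) \<bullet> (x' - x) \<noteq> 0" using assms(2) by simp
  ultimately show ?thesis
    unfolding refl_def by simp
qed

text \<open>The reflection moves vectors along x' - x and so preserves \<open>dirs \<Sigma>\<close>;
  it is self-adjoint and takes the radius at x to the radius at x', so it preserves orthogonality to
  the radii.\<close>

lemma refl_tangent_plane:
  assumes \<Sigma>: "round_2sphere_in_Sn \<Sigma>" and x: "x \<in> points \<Sigma>" "x' \<in> points \<Sigma>" "x \<noteq> x'"
    and v: "v \<in> tangent_plane \<Sigma> x'"
  shows "refl (x' - x) v \<in> tangent_plane \<Sigma> x"
proof -
  have sub: "subspace (dirs \<Sigma>)" using \<Sigma> by (simp add: round_2sphere_in_Sn_def)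
  have "x' - x = (x' - centre \<Sigma>) - (x - centre \<Sigma>)" by simp
  then have m: "x' - x \<in> dirs \<Sigma>"
    using x subspace_diff[OF sub] by (metis (no_types, lifting) mem_Collect_eq points_def)
  have "refl (x' - x) v \<in> dirs \<Sigma>"
    unfolding refl_def
    by (rule subspace_diff[OF sub _ subspace_scale[OF sub m]]) (use v in \<open>simp add: tangent_plane_def\<close>)
  moreover have "refl (x' - x) (x - centre \<Sigma>) = x' - centre \<Sigma>"
    using x by (intro refl_radius) (auto simp: points_def)
  then have "refl (x' - x) v \<bullet> (x - centre \<Sigma>) = 0"
    using v by (simp add: inner_refl_left tangent_plane_def)
  ultimately show ?thesis by (simp add: tangent_plane_def)
qed

text \<open>For the differentials \<open>a\<close> and \<open>b\<close> of the two envelopes, \<open>rho_num\<close> and \<open>theta_num\<close> below are \<open>2 l\<^sup>2\<close> times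
  the complex linear and antilinear part of \<open>b\<close> relative to the reflected \<open>a\<close>.\<close>

locale tangent_pair =
  fixes a b :: "complex \<Rightarrow> real^'n" and m :: "real^'n" and l lh :: real
  assumes lin: "linear a" "linear b"
    and l: "0 < l" "0 < lh"
    and conf: "\<And>v. norm (a v) = l * cmod v" "\<And>v. norm (b v) = lh * cmod v"
    and m: "m \<noteq> 0"
    and tang: "\<And>v. refl m (b v) \<in> range a"
begin

abbreviation "ra v \<equiv> refl m (a v)"

lemma conformal_inner:
  assumes "linear h" "\<And>v. norm (h v) = k * cmod v"
  shows "h 1 \<bullet> h 1 = k\<^sup>2" "h \<i> \<bullet> h \<i> = k\<^sup>2" "h 1 \<bullet> h \<i> = 0"
proof -
  show 1: "h 1 \<bullet> h 1 = k\<^sup>2" and 2: "h \<i> \<bullet> h \<i> = k\<^sup>2"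
    using assms(2) by (simp_all add: dot_square_norm power_mult_distrib)
  have "(norm (h (1 + \<i>)))\<^sup>2 = 2 * k\<^sup>2"
    unfolding assms(2) by (simp add: power_mult_distrib cmod_power2)
  moreover have "(norm (h (1 + \<i>)))\<^sup>2 = k\<^sup>2 + k\<^sup>2 + 2 * (h 1 \<bullet> h \<i>)"
    using linear_add[OF assms(1), of 1 \<i>]
    by (simp add: power2_norm_eq_inner inner_add_left inner_add_right 1 2 inner_commute[of "h \<i>" "h 1"])
  ultimately show "h 1 \<bullet> h \<i> = 0" by simp
qed

lemmas inner_a = conformal_inner[OF lin(1) conf(1)]
lemmas inner_b = conformal_inner[OF lin(2) conf(2)]

lemma inner_ra: "ra 1 \<bullet> ra 1 = l\<^sup>2" "ra \<i> \<bullet> ra \<i> = l\<^sup>2" "ra 1 \<bullet> ra \<i> = 0" "ra \<i> \<bullet> ra 1 = 0"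
  using inner_a by (simp_all add: inner_refl_refl[OF m] inner_commute[of "a \<i>" "a 1"])

definition "rho_num = Complex (b 1 \<bullet> ra 1 + b \<i> \<bullet> ra \<i>) (b 1 \<bullet> ra \<i> - b \<i> \<bullet> ra 1)"
definition "theta_num = Complex (b 1 \<bullet> ra 1 - b \<i> \<bullet> ra \<i>) (- (b 1 \<bullet> ra \<i> + b \<i> \<bullet> ra 1))"

lemma a_expand: "a w = Re w *\<^sub>R a 1 + Im w *\<^sub>R a \<i>"
  by (rule linear_complex_expand[OF lin(1)])

lemma b_expand: "b v = ((b v \<bullet> ra 1) / l\<^sup>2) *\<^sub>R ra 1 + ((b v \<bullet> ra \<i>) / l\<^sup>2) *\<^sub>R ra \<i>"
proof -
  obtain w where "refl m (b v) = a w" using tang by blast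
  then have "b v = refl m (Re w *\<^sub>R a 1 + Im w *\<^sub>R a \<i>)"
    using refl_refl[OF m, of "b v"] by (simp only: a_expand[symmetric])
  then have b: "b v = Re w *\<^sub>R ra 1 + Im w *\<^sub>R ra \<i>"
    by (simp add: refl_add refl_scaleR)
  have "b v \<bullet> ra 1 = Re w * l\<^sup>2" "b v \<bullet> ra \<i> = Im w * l\<^sup>2"
    unfolding b by (simp_all add: inner_add_left inner_ra)
  with b l show ?thesis by simp
qed

text \<open>Conformality of b in the orthogonal basis \<open>ra 1\<close>, \<open>ra \<i>\<close>:
  the coefficient matrix is a multiple of an orthogonal matrix.\<close>

lemma gram:
  fixes p q r s :: real
  defines "p \<equiv> b 1 \<bullet> ra 1" and "q \<equiv> b 1 \<bullet> ra \<i>" and "r \<equiv> b \<i> \<bullet> ra 1" and "s \<equiv> b \<i> \<bullet> ra \<i>"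
  shows "p\<^sup>2 + q\<^sup>2 = lh\<^sup>2 * l\<^sup>2" "r\<^sup>2 + s\<^sup>2 = lh\<^sup>2 * l\<^sup>2" "p * r + q * s = 0"
proof -
  have e: "b 1 = (p / l\<^sup>2) *\<^sub>R ra 1 + (q / l\<^sup>2) *\<^sub>R ra \<i>" "b \<i> = (r / l\<^sup>2) *\<^sub>R ra 1 + (s / l\<^sup>2) *\<^sub>R ra \<i>"
    unfolding p_def q_def r_def s_def by (rule b_expand)+
  have l0: "l\<^sup>2 \<noteq> 0" using l by simp
  have "b 1 \<bullet> b 1 = (p\<^sup>2 + q\<^sup>2) / l\<^sup>2"
    unfolding e by (simp add: inner_add_left inner_add_right inner_ra) (use l0 in \<open>simp add: field_simps power2_eq_square\<close>)
  then show "p\<^sup>2 + q\<^sup>2 = lh\<^sup>2 * l\<^sup>2"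
    using inner_b(1) l0 by (simp add: field_simps)
  have "b \<i> \<bullet> b \<i> = (r\<^sup>2 + s\<^sup>2) / l\<^sup>2"
    unfolding e by (simp add: inner_add_left inner_add_right inner_ra) (use l0 in \<open>simp add: field_simps power2_eq_square\<close>)
  then show "r\<^sup>2 + s\<^sup>2 = lh\<^sup>2 * l\<^sup>2"
    using inner_b(2) l0 by (simp add: field_simps)
  have "b 1 \<bullet> b \<i> = (p * r + q * s) / l\<^sup>2"
    unfolding e by (simp add: inner_add_left inner_add_right inner_ra) (use l0 in \<open>simp add: field_simps power2_eq_square\<close>)
  then show "p * r + q * s = 0"
    using inner_b(3) l0 by (simp add: field_simps)
qed

text \<open>A nonzero multiple of an orthogonal 2 by 2 matrix is either complex linear or complex
  antilinear, and \<open>gram\<close> provides such a matrix.\<close>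

lemma rho_theta_exclusive: "rho_num * theta_num = 0" "rho_num \<noteq> 0 \<or> theta_num \<noteq> 0"
proof -
  define p q r s where pq: "p = b 1 \<bullet> ra 1" "q = b 1 \<bullet> ra \<i>" "r = b \<i> \<bullet> ra 1" "s = b \<i> \<bullet> ra \<i>"
  note g = gram[folded pq]
  have "p * p + q * q = r * r + s * s"
    using g(1,2) by (simp add: power2_eq_square)
  then show "rho_num * theta_num = 0"
    unfolding rho_num_def theta_num_def pq[symmetric] using g(3)
    by (simp add: complex_eq_iff algebra_simps)
  have "0 < p\<^sup>2 + q\<^sup>2" unfolding g(1) using l by simp
  then have "p \<noteq> 0 \<or> q \<noteq> 0" by auto
  then show "rho_num \<noteq> 0 \<or> theta_num \<noteq> 0"
    unfolding rho_num_def theta_num_def pq[symmetric] by (auto simp: complex_eq_iff)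
qed

text \<open>The reflection is a rank one perturbation of the identity with determinant \<open>-1\<close>.\<close>

lemma change_of_basis:
  assumes x0: "refl m x0 = x0 + m" "x0 \<noteq> 0"
    and mtan: "\<And>k. (m - k *\<^sub>R x0) \<bullet> x0 = 0 \<Longrightarrow> m - k *\<^sub>R x0 \<in> range a"
  obtains P where "base_change P (vector [x0, a 1, a \<i>]) (vector [x0 + m, b 1, b \<i>])"
    "theta_num = 0 \<longrightarrow> det P < 0" "rho_num = 0 \<longrightarrow> det P > 0"
proof -
  define k0 where "k0 = (m \<bullet> x0) / (x0 \<bullet> x0)"
  have "(m - k0 *\<^sub>R x0) \<bullet> x0 = 0"
    using x0(2) by (simp add: k0_def inner_diff_left)
  from mtan[OF this] obtain w where w: "m - k0 *\<^sub>R x0 = a w" by blast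
  define k1 k2 where "k1 = Re w" and "k2 = Im w"
  have mk: "m = k0 *\<^sub>R x0 + k1 *\<^sub>R a 1 + k2 *\<^sub>R a \<i>"
    using w a_expand[of w] by (simp add: k1_def k2_def algebra_simps)
  define f1 f2 where "f1 = 2 * (a 1 \<bullet> m) / (m \<bullet> m)" and "f2 = 2 * (a \<i> \<bullet> m) / (m \<bullet> m)"
  have mm: "m \<bullet> m \<noteq> 0" using m by simp
  have "(1 + 2 * (x0 \<bullet> m) / (m \<bullet> m)) *\<^sub>R m = 0"
    using x0(1) by (simp add: refl_def algebra_simps)
  then have f0: "2 * (x0 \<bullet> m) / (m \<bullet> m) = -1"
    using m by (simp add: eq_neg_iff_add_eq_0)
  have "2 * (m \<bullet> m) / (m \<bullet> m) = k0 * (2 * (x0 \<bullet> m) / (m \<bullet> m)) + k1 * f1 + k2 * f2"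
    by (subst (1) mk) (simp add: inner_add_left f1_def f2_def add_divide_distrib distrib_left mult_ac)
  \<comment> \<open>The reflection is v - F(v) m for a linear form F with F(x0) = -1, F(a 1) = f1,
    F(a \<i>) = f2 and F(m) = 2. The left side is 1 - F(m), the determinant of the
    reflection.\<close>
  then have tr: "1 + k0 - k1 * f1 - k2 * f2 = -1"
    using mm unfolding f0 by simp
  have r: "ra 1 = a 1 - f1 *\<^sub>R m" "ra \<i> = a \<i> - f2 *\<^sub>R m"
    by (simp_all add: refl_def f1_def f2_def)
  define p q u v where pq: "p = b 1 \<bullet> ra 1 / l\<^sup>2" "q = b 1 \<bullet> ra \<i> / l\<^sup>2" "u = b \<i> \<bullet> ra 1 / l\<^sup>2" "v = b \<i> \<bullet> ra \<i> / l\<^sup>2"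
  have b1: "b 1 = p *\<^sub>R a 1 + q *\<^sub>R a \<i> - (p * f1 + q * f2) *\<^sub>R m"
    using b_expand[of 1] unfolding pq[symmetric] unfolding r by (simp add: algebra_simps)
  have b2: "b \<i> = u *\<^sub>R a 1 + v *\<^sub>R a \<i> - (u * f1 + v * f2) *\<^sub>R m"
    using b_expand[of \<i>] unfolding pq[symmetric] unfolding r by (simp add: algebra_simps)
  \<comment> \<open>The matrix of the reflection in the basis x0, a 1, a \<i>, multiplied by the
    matrix that fixes x0 and has the coefficients of b relative to the reflected vectors.\<close>
  define P :: "real^3^3" where "P = vector [
     vector [1 + k0, - (p * f1 + q * f2) * k0, - (u * f1 + v * f2) * k0],
     vector [k1, p - (p * f1 + q * f2) * k1, u - (u * f1 + v * f2) * k1],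
     vector [k2, q - (p * f1 + q * f2) * k2, v - (u * f1 + v * f2) * k2]]"
  have "base_change P (vector [x0, a 1, a \<i>]) (vector [x0 + m, b 1, b \<i>])"
    unfolding base_change_def forall_3 sum_3 P_def vector_3 b1 b2
    by (intro conjI; subst mk; simp add: algebra_simps)
  moreover have "det P = (p * v - q * u) * (1 + k0 - k1 * f1 - k2 * f2)"
    unfolding det_3 P_def vector_3 by (simp add: algebra_simps)
  then have det: "det P = - (p * v - q * u)"
    unfolding tr by simp
  have l0: "l\<^sup>2 \<noteq> 0" using l by simp
  have "p\<^sup>2 + q\<^sup>2 = lh\<^sup>2 / l\<^sup>2"
    using gram(1) l0 by (simp add: pq power_divide field_simps power2_eq_square)
  then have pos: "0 < p\<^sup>2 + q\<^sup>2" using l by simp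
  have "det P < 0" if "theta_num = 0"
  proof -
    have "b 1 \<bullet> ra 1 = b \<i> \<bullet> ra \<i>" "b \<i> \<bullet> ra 1 = - (b 1 \<bullet> ra \<i>)"
      using that by (auto simp: theta_num_def complex_eq_iff)
    then have "p = v" "u = - q"
      by (simp_all add: pq)
    then show ?thesis using pos unfolding det by (simp add: power2_eq_square)
  qed
  moreover have "det P > 0" if "rho_num = 0"
  proof -
    have "b \<i> \<bullet> ra \<i> = - (b 1 \<bullet> ra 1)" "b \<i> \<bullet> ra 1 = b 1 \<bullet> ra \<i>"
      using that by (auto simp: rho_num_def complex_eq_iff)
    then have "v = - p" "u = q"
      by (simp_all add: pq)
    then show ?thesis using pos unfolding det by (simp add: power2_eq_square)
  qed
  ultimately show ?thesis using that by blast
qed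

end

subsection \<open>Lifts of a pair of maps into the sphere\<close>

lemma mink_real: "mink (v :: (real, 'n::finite) mink_vec) w = fst v \<bullet> fst w - snd v * snd w"
  by (simp add: mink_def inner_vec_def)

lemma (in lift_pair) rho_theta_eqI:
  assumes z: "\<zeta> \<in> \<Omega>" and e: "dz yh \<zeta> = c *\<^sub>C yh \<zeta> + R *\<^sub>C P \<zeta> + T *\<^sub>C cnjv (P \<zeta>)"
  shows "rho \<zeta> = R" "theta \<zeta> = T"
  unfolding rho_def theta_def e by (simp_all add: mink_simps pairsP[OF z] del: o_apply)

context tangent_pair
begin

text \<open>The reflection in the bisecting hyperplane of the two points is the linear isometry of Minkowski
  space exchanging their isotropic lines.\<close>

lemma frame_decomposition:
  fixes F G :: "real^'n" and r t :: real and re te :: "complex \<Rightarrow> real"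
  defines "Y \<equiv> r *\<^sub>R (F, 1)" and "Z \<equiv> t *\<^sub>R (G, 1)"
    and "Yd \<equiv> \<lambda>v. re v *\<^sub>R (F, 1) + r *\<^sub>R (a v, 0)" and "Zd \<equiv> \<lambda>v. te v *\<^sub>R (G, 1) + t *\<^sub>R (b v, 0)"
  defines "Pr \<equiv> \<lambda>v. Yd v + mink (Yd v) Z *\<^sub>R Y"
  assumes FG: "F \<bullet> F = 1" "G \<bullet> G = 1" "m = G - F"
    and tan: "\<And>v. a v \<bullet> F = 0"
    and r: "0 < r" "r * t * (1 - F \<bullet> G) = 1"
    and deriv: "mink (Yd v) Z = - mink Y (Zd v)"
  shows "Zd v = mink (Yd v) Z *\<^sub>R Z +
    (t / r) *\<^sub>R ((b v \<bullet> ra 1 / l\<^sup>2) *\<^sub>R Pr 1 + (b v \<bullet> ra \<i> / l\<^sup>2) *\<^sub>R Pr \<i>)"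
proof -
  define d where "d = 1 - F \<bullet> G"
  define k where "k v = (a v \<bullet> G) / d" for v
  have mm: "m \<bullet> m = 2 * d"
    unfolding FG(3) d_def by (simp add: inner_diff_left inner_diff_right FG inner_commute)
  have rtd: "r * t * d = 1" using r(2) by (simp add: d_def)
  then have d0: "d \<noteq> 0" and t0: "t \<noteq> 0" by auto
  have rt: "r * t = 1 / d" using rtd d0 by (simp add: field_simps)
  have ref: "ra v = a v - k v *\<^sub>R (G - F)" for v
    unfolding refl_def mm using tan[of v] d0 by (simp add: FG(3) k_def inner_diff_right)
  have m1: "mink (Yd v) Z = - re v / r + k v" for v
  proof -
    have "mink (Yd v) Z = - re v * (t * d) + (r * t) * (a v \<bullet> G)"
      by (simp add: Yd_def Z_def mink_real d_def inner_add_left algebra_simps)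
    moreover have "t * d = 1 / r" using rtd r(1) by (simp add: field_simps)
    ultimately show ?thesis unfolding rt by (simp add: k_def)
  qed
  \<comment> \<open>Up to a multiple of (G, 1), \<open>Pr v\<close> is r times the reflected tangent
    vector, and b is known in terms of the reflected vectors.\<close>
  have Pr: "Pr v = r *\<^sub>R ((ra v, 0) + k v *\<^sub>R (G, 1))" for v
  proof -
    have "Pr v = Yd v + (- re v / r + k v) *\<^sub>R Y"
      unfolding Pr_def m1 ..
    then show ?thesis
      unfolding Yd_def Y_def ref using r(1) by (simp add: prod_eq_iff algebra_simps)
  qed
  define p q where "p = b v \<bullet> ra 1 / l\<^sup>2" and "q = b v \<bullet> ra \<i> / l\<^sup>2"
  have b: "b v = p *\<^sub>R ra 1 + q *\<^sub>R ra \<i>"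
    unfolding p_def q_def by (rule b_expand)
  have "F \<bullet> ra w = k w * d" for w
    unfolding ref using tan[of w] by (simp add: d_def inner_diff_right FG inner_commute algebra_simps)
  then have Fb: "F \<bullet> b v = (p * k 1 + q * k \<i>) * d"
    unfolding b by (simp add: inner_add_right algebra_simps)
  \<comment> \<open>The derivative \<open>te\<close> of the scale of Z is determined by the
    constancy of the pairing of Y and Z.\<close>
  have "mink Y (Zd v) = - te v * (r * d) + r * t * (F \<bullet> b v)"
    by (simp add: Y_def Zd_def mink_real d_def inner_add_right algebra_simps)
  also have "\<dots> = - te v * (r * d) + (p * k 1 + q * k \<i>)"
    unfolding Fb using rtd by (simp add: mult_ac)
  finally have "te v * (r * d) = mink (Yd v) Z + (p * k 1 + q * k \<i>)"
    using deriv by simp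
  then have "te v * (r * t * d) = t * (mink (Yd v) Z + (p * k 1 + q * k \<i>))"
    by (simp add: mult_ac)
  then have te: "te v = t * (mink (Yd v) Z + (p * k 1 + q * k \<i>))"
    unfolding rtd by simp
  show ?thesis
    unfolding p_def[symmetric] q_def[symmetric] Pr using r(1)
    unfolding Zd_def te Z_def[symmetric] unfolding b
    by (simp add: prod_eq_iff Z_def algebra_simps)
qed

end

section \<open>Lifts built from two maps in a coordinate\<close>

locale sphere_pair =
  fixes \<Omega> :: "complex set" and F G :: "complex \<Rightarrow> real^'n::finite"
  assumes op: "open \<Omega>" and sF: "smooth_on \<Omega> F" and sG: "smooth_on \<Omega> G"
    and unit: "\<And>\<zeta>. \<zeta> \<in> \<Omega> \<Longrightarrow> F \<zeta> \<bullet> F \<zeta> = 1" "\<And>\<zeta>. \<zeta> \<in> \<Omega> \<Longrightarrow> G \<zeta> \<bullet> G \<zeta> = 1"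
    and tp: "\<And>\<zeta>. \<zeta> \<in> \<Omega> \<Longrightarrow> \<exists>l lh. tangent_pair (frechet_derivative F (at \<zeta>))
      (frechet_derivative G (at \<zeta>)) (G \<zeta> - F \<zeta>) l lh"
begin

abbreviation "DF \<zeta> \<equiv> frechet_derivative F (at \<zeta>)"
abbreviation "DG \<zeta> \<equiv> frechet_derivative G (at \<zeta>)"

definition "gap \<zeta> = 1 - F \<zeta> \<bullet> G \<zeta>"

lemma gap_pos: "\<zeta> \<in> \<Omega> \<Longrightarrow> 0 < gap \<zeta>"
proof -
  assume z: "\<zeta> \<in> \<Omega>"
  then obtain l lh where "tangent_pair (DF \<zeta>) (DG \<zeta>) (G \<zeta> - F \<zeta>) l lh" using tp by blast
  then have "G \<zeta> - F \<zeta> \<noteq> 0" by (rule tangent_pair.m)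
  then have "0 < (G \<zeta> - F \<zeta>) \<bullet> (G \<zeta> - F \<zeta>)" by simp
  also have "\<dots> = 2 * gap \<zeta>"
    using unit[OF z] by (simp add: gap_def inner_diff_left inner_diff_right inner_commute)
  finally show ?thesis by simp
qed

lemma has_derivatives:
  assumes "\<zeta> \<in> \<Omega>"
  shows "(F has_derivative DF \<zeta>) (at \<zeta>)" "(G has_derivative DG \<zeta>) (at \<zeta>)"
  using smooth_on_has_derivative[OF sF assms] smooth_on_has_derivative[OF sG assms] .

lemma tangential:
  assumes z: "\<zeta> \<in> \<Omega>"
  shows "DF \<zeta> v \<bullet> F \<zeta> = 0"
proof -
  have "((\<lambda>\<zeta>. F \<zeta> \<bullet> F \<zeta>) has_derivative (\<lambda>v. F \<zeta> \<bullet> DF \<zeta> v + DF \<zeta> v \<bullet> F \<zeta>)) (at \<zeta>)"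
    by (rule has_derivative_inner[OF has_derivatives(1)[OF z] has_derivatives(1)[OF z]])
  moreover have "((\<lambda>\<zeta>. F \<zeta> \<bullet> F \<zeta>) has_derivative (\<lambda>v. 0)) (at \<zeta>)"
    by (rule has_derivative_transform_within_open[OF has_derivative_const[of 1] op z]) (simp add: unit)
  ultimately have "(\<lambda>v. F \<zeta> \<bullet> DF \<zeta> v + DF \<zeta> v \<bullet> F \<zeta>) = (\<lambda>v. 0)"
    by (rule has_derivative_unique)
  from fun_cong[OF this, of v] show ?thesis by (simp add: inner_commute)
qed

context
  fixes r :: "complex \<Rightarrow> real"
  assumes sr: "smooth_on \<Omega> r" and r: "\<And>\<zeta>. \<zeta> \<in> \<Omega> \<Longrightarrow> 0 < r \<zeta>"
begin

abbreviation "Y \<equiv> \<lambda>\<zeta>. r \<zeta> *\<^sub>R (F \<zeta>, 1 :: real)"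

definition Yd :: "complex \<Rightarrow> complex \<Rightarrow> (real, 'n) mink_vec" where
  "Yd \<zeta> v = frechet_derivative r (at \<zeta>) v *\<^sub>R (F \<zeta>, 1) + r \<zeta> *\<^sub>R (DF \<zeta> v, 0)"

lemma scaled_derivative:
  assumes "(u has_derivative u') (at \<zeta>)" "(H has_derivative H') (at \<zeta>)"
  shows "((\<lambda>\<zeta>. u \<zeta> *\<^sub>R (H \<zeta>, 1 :: real)) has_derivative
      (\<lambda>v. u' v *\<^sub>R (H \<zeta>, 1) + u \<zeta> *\<^sub>R (H' v, 0))) (at \<zeta>)"
  using has_derivative_scaleR[OF assms(1) has_derivative_Pair[OF assms(2) has_derivative_const[of "1 :: real"]]]
  by (simp add: add.commute)

lemma Y_derivative: "\<zeta> \<in> \<Omega> \<Longrightarrow> (Y has_derivative Yd \<zeta>) (at \<zeta>)"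
  unfolding Yd_def[abs_def]
  by (rule scaled_derivative[OF smooth_on_has_derivative[OF sr] has_derivatives(1)])

lemma cpx_derivative:
  assumes "(H has_derivative H') (at \<zeta>)"
  shows "dz (cpx \<circ> H) \<zeta> = (1/2) *\<^sub>C (cpx (H' 1) - \<i> *\<^sub>C cpx (H' \<i>))"
    "dzbar (cpx \<circ> H) \<zeta> = (1/2) *\<^sub>C (cpx (H' 1) + \<i> *\<^sub>C cpx (H' \<i>))"
  using dz_at[of "cpx \<circ> H"] dzbar_at[of "cpx \<circ> H"] bounded_linear.has_derivative[OF bounded_linear_cpx assms]
  by (auto simp: o_def)

lemma mink_Yd:
  assumes z: "\<zeta> \<in> \<Omega>"
  shows "mink (Yd \<zeta> v) (Yd \<zeta> w) = (r \<zeta>)\<^sup>2 * (DF \<zeta> v \<bullet> DF \<zeta> w)"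
  using unit(1)[OF z] tangential[OF z, of v] tangential[OF z, of w]
  by (simp add: Yd_def mink_real inner_add_left inner_add_right inner_commute[of "F \<zeta>" "DF \<zeta> w"] power2_eq_square)

lemma dz_Y_pairings:
  assumes z: "\<zeta> \<in> \<Omega>"
  shows "mink (dz (cpx \<circ> Y) \<zeta>) (dz (cpx \<circ> Y) \<zeta>) = 0"
    "mink (dz (cpx \<circ> Y) \<zeta>) (dzbar (cpx \<circ> Y) \<zeta>) = of_real ((r \<zeta>)\<^sup>2 * (DF \<zeta> 1 \<bullet> DF \<zeta> 1) / 2)"
proof -
  obtain l lh where "tangent_pair (DF \<zeta>) (DG \<zeta>) (G \<zeta> - F \<zeta>) l lh" using tp[OF z] by blast
  then interpret T: tangent_pair "DF \<zeta>" "DG \<zeta>" "G \<zeta> - F \<zeta>" l lh .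
  note c = cpx_derivative[OF Y_derivative[OF z]]
  show "mink (dz (cpx \<circ> Y) \<zeta>) (dz (cpx \<circ> Y) \<zeta>) = 0"
    "mink (dz (cpx \<circ> Y) \<zeta>) (dzbar (cpx \<circ> Y) \<zeta>) = of_real ((r \<zeta>)\<^sup>2 * (DF \<zeta> 1 \<bullet> DF \<zeta> 1) / 2)"
    unfolding c using T.inner_a
    by (simp_all add: mink_simps mink_cpx mink_Yd[OF z] inner_commute[of "DF \<zeta> \<i>" "DF \<zeta> 1"] algebra_simps)
qed

lemma lift_iff_canonical:
  "lift \<Omega> Y \<longleftrightarrow> (\<forall>\<zeta>\<in>\<Omega>. (r \<zeta>)\<^sup>2 * (DF \<zeta> 1 \<bullet> DF \<zeta> 1) = 1)"
proof
  assume "lift \<Omega> Y"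
  then have "complex_of_real ((r \<zeta>)\<^sup>2 * (DF \<zeta> 1 \<bullet> DF \<zeta> 1) / 2) = of_real (1/2)" if "\<zeta> \<in> \<Omega>" for \<zeta>
    using lift.metric[of \<Omega> Y \<zeta>] dz_Y_pairings(2)[OF that] that by simp
  then have "(r \<zeta>)\<^sup>2 * (DF \<zeta> 1 \<bullet> DF \<zeta> 1) / 2 = 1/2" if "\<zeta> \<in> \<Omega>" for \<zeta>
    using that of_real_eq_iff by blast
  then show "\<forall>\<zeta>\<in>\<Omega>. (r \<zeta>)\<^sup>2 * (DF \<zeta> 1 \<bullet> DF \<zeta> 1) = 1" by simp
next
  assume c: "\<forall>\<zeta>\<in>\<Omega>. (r \<zeta>)\<^sup>2 * (DF \<zeta> 1 \<bullet> DF \<zeta> 1) = 1"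
  show "lift \<Omega> Y"
  proof
    show "smooth_on \<Omega> Y" by (intro smooth_intros op sr sF)
    show "mink (Y \<zeta>) (Y \<zeta>) = 0" if "\<zeta> \<in> \<Omega>" for \<zeta>
      using unit(1)[OF that] by (simp add: mink_real)
    show "mink (dz (cpx \<circ> Y) \<zeta>) (dz (cpx \<circ> Y) \<zeta>) = 0" if "\<zeta> \<in> \<Omega>" for \<zeta>
      by (rule dz_Y_pairings(1)[OF that])
    show "mink (dz (cpx \<circ> Y) \<zeta>) (dzbar (cpx \<circ> Y) \<zeta>) = 1/2" if "\<zeta> \<in> \<Omega>" for \<zeta>
      using dz_Y_pairings(2)[OF that] c that by simp
  qed (rule op)
qed

text \<open>Forced by the normalisation of Z, since (F, 1) and (G, 1) pair to minus the gap.\<close>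

definition t :: "complex \<Rightarrow> real" where
  "t \<zeta> = inverse (r \<zeta> * gap \<zeta>)"

abbreviation "Z \<equiv> \<lambda>\<zeta>. t \<zeta> *\<^sub>R (G \<zeta>, 1 :: real)"

lemma smooth_t: "smooth_on \<Omega> t"
proof -
  have "r \<zeta> * (1 - F \<zeta> \<bullet> G \<zeta>) \<noteq> 0" if "\<zeta> \<in> \<Omega>" for \<zeta>
    using r[OF that] gap_pos[OF that] by (simp add: gap_def)
  then show ?thesis
    unfolding t_def[abs_def] gap_def by (intro smooth_intros op sr sF sG)
qed

lemma rt: "\<zeta> \<in> \<Omega> \<Longrightarrow> r \<zeta> * t \<zeta> * (1 - F \<zeta> \<bullet> G \<zeta>) = 1"
  using r[of \<zeta>] gap_pos[of \<zeta>] by (simp add: t_def gap_def field_simps)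

text \<open>Complexifies \<open>frame_decomposition\<close>, taken in the directions 1 and \<i>, and
  recognises its real coefficients as those of the linear and antilinear parts.\<close>

lemma enveloped_pair_of_lift:
  assumes L: "lift \<Omega> Y"
  shows "enveloped_pair \<Omega> Y Z"
    and "\<zeta> \<in> \<Omega> \<Longrightarrow> lift_pair.rho Y Z \<zeta> =
      tangent_pair.rho_num (DF \<zeta>) (DG \<zeta>) (G \<zeta> - F \<zeta>) / of_real (2 * gap \<zeta>)"
    and "\<zeta> \<in> \<Omega> \<Longrightarrow> lift_pair.theta Y Z \<zeta> =
      tangent_pair.theta_num (DF \<zeta>) (DG \<zeta>) (G \<zeta> - F \<zeta>) / of_real (2 * gap \<zeta>)"
proof -
  have YZ: "mink (Y \<zeta>) (Z \<zeta>) = -1" if "\<zeta> \<in> \<Omega>" for \<zeta>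
    using rt[OF that] by (simp add: mink_real algebra_simps)
  have sZ: "smooth_on \<Omega> Z"
    by (intro smooth_intros op smooth_t sG)
  interpret L: lift \<Omega> Y by (rule L)
  interpret LP: lift_pair \<Omega> Y Z
    by unfold_locales (use sZ YZ unit(2) in \<open>auto simp: mink_real\<close>)
  have key: "dz LP.yh \<zeta> = (LP.mu \<zeta> / 2) *\<^sub>C LP.yh \<zeta> + R *\<^sub>C LP.P \<zeta> + T *\<^sub>C cnjv (LP.P \<zeta>)"
    if z: "\<zeta> \<in> \<Omega>" and R: "R = tangent_pair.rho_num (DF \<zeta>) (DG \<zeta>) (G \<zeta> - F \<zeta>) / of_real (2 * gap \<zeta>)"
      and T: "T = tangent_pair.theta_num (DF \<zeta>) (DG \<zeta>) (G \<zeta> - F \<zeta>) / of_real (2 * gap \<zeta>)" for \<zeta> R T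
  proof -
    obtain l lh where "tangent_pair (DF \<zeta>) (DG \<zeta>) (G \<zeta> - F \<zeta>) l lh" using tp[OF z] by blast
    then interpret T: tangent_pair "DF \<zeta>" "DG \<zeta>" "G \<zeta> - F \<zeta>" l lh .
    define Zd where "Zd v = frechet_derivative t (at \<zeta>) v *\<^sub>R (G \<zeta>, 1 :: real) + t \<zeta> *\<^sub>R (DG \<zeta> v, 0)" for v
    have ZD: "(Z has_derivative Zd) (at \<zeta>)"
      unfolding Zd_def[abs_def]
      by (rule scaled_derivative[OF smooth_on_has_derivative[OF smooth_t z] has_derivatives(2)[OF z]])
    note YD = Y_derivative[OF z]
    have "((\<lambda>\<zeta>. mink (Y \<zeta>) (Z \<zeta>)) has_derivative (\<lambda>v. mink (Y \<zeta>) (Zd v) + mink (Yd \<zeta> v) (Z \<zeta>))) (at \<zeta>)"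
      by (rule bounded_bilinear.FDERIV[OF bounded_bilinear_mink YD ZD])
    moreover have "((\<lambda>\<zeta>. mink (Y \<zeta>) (Z \<zeta>)) has_derivative (\<lambda>v. 0)) (at \<zeta>)"
      by (rule has_derivative_transform_within_open[OF has_derivative_const[of "-1"] op z]) (simp only: YZ)
    ultimately have "(\<lambda>v. mink (Y \<zeta>) (Zd v) + mink (Yd \<zeta> v) (Z \<zeta>)) = (\<lambda>v. 0)"
      by (rule has_derivative_unique)
    from fun_cong[OF this] have dv: "mink (Yd \<zeta> v) (Z \<zeta>) = - mink (Y \<zeta>) (Zd v)" for v
      by (simp add: add_eq_0_iff2)
    define mm where "mm v = mink (Yd \<zeta> v) (Z \<zeta>)" for v
    define Pr where "Pr v = Yd \<zeta> v + mm v *\<^sub>R Y \<zeta>" for v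
    define c where "c = t \<zeta> / r \<zeta> / l\<^sup>2"
    have Zd: "Zd v = mm v *\<^sub>R Z \<zeta> + c *\<^sub>R ((DG \<zeta> v \<bullet> T.ra 1) *\<^sub>R Pr 1 + (DG \<zeta> v \<bullet> T.ra \<i>) *\<^sub>R Pr \<i>)" for v
    proof -
      have "Zd v = mm v *\<^sub>R Z \<zeta> + (t \<zeta> / r \<zeta>) *\<^sub>R
          ((DG \<zeta> v \<bullet> T.ra 1 / l\<^sup>2) *\<^sub>R Pr 1 + (DG \<zeta> v \<bullet> T.ra \<i> / l\<^sup>2) *\<^sub>R Pr \<i>)"
        unfolding mm_def Pr_def Zd_def Yd_def
        by (rule T.frame_decomposition[OF unit[OF z] refl tangential[OF z] r[OF z] rt[OF z]])
          (use dv[of v] in \<open>simp only: Zd_def Yd_def\<close>)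
      then show ?thesis by (simp add: c_def scaleR_add_right)
    qed
    \<comment> \<open>Canonical scaling gives r l = 1 and the normalisation of Z gives r t gap = 1,
      so t / (r l^2) = r t = 1 / gap.\<close>
    have "(r \<zeta>)\<^sup>2 * l\<^sup>2 = 1"
      using L lift_iff_canonical z T.inner_a(1) by auto
    then have "c = r \<zeta> * t \<zeta>"
      using r[OF z] T.l(1) by (simp add: c_def field_simps power2_eq_square)
    moreover have "r \<zeta> * t \<zeta> * gap \<zeta> = 1"
      using rt[OF z] by (simp only: gap_def)
    ultimately have c: "c = 1 / gap \<zeta>"
      using gap_pos[OF z] by (simp add: field_simps)
    have mu: "LP.mu \<zeta> = mm 1 - \<i> * mm \<i>"
      unfolding LP.mu_def cpx_derivative[OF YD] mm_def by (simp add: mink_simps mink_cpx)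
    have P: "LP.P \<zeta> = (1/2) *\<^sub>C (cpx (Pr 1) - \<i> *\<^sub>C cpx (Pr \<i>))"
      unfolding LP.P_def mu cpx_derivative[OF YD] Pr_def
      by (rule mink_vec_eqI; simp add: field_simps)
    define p q u v where pq: "p = DG \<zeta> 1 \<bullet> T.ra 1" "q = DG \<zeta> 1 \<bullet> T.ra \<i>" "u = DG \<zeta> \<i> \<bullet> T.ra 1" "v = DG \<zeta> \<i> \<bullet> T.ra \<i>"
    have R': "R = of_real c * Complex (p + v) (q - u) / 2" and T': "T = of_real c * Complex (p - v) (- (q + u)) / 2"
      unfolding R T T.rho_num_def T.theta_num_def c pq by (simp_all add: field_simps)
    show ?thesis
      unfolding cpx_derivative[OF ZD] P mu Zd pq[symmetric] R' T'
      by (rule mink_vec_eqI; simp add: complex_eq_iff field_simps)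
  qed
  note rt = LP.rho_theta_eqI[OF _ key[OF _ refl refl]]
  show "\<zeta> \<in> \<Omega> \<Longrightarrow> LP.rho \<zeta> = tangent_pair.rho_num (DF \<zeta>) (DG \<zeta>) (G \<zeta> - F \<zeta>) / of_real (2 * gap \<zeta>)"
    "\<zeta> \<in> \<Omega> \<Longrightarrow> LP.theta \<zeta> = tangent_pair.theta_num (DF \<zeta>) (DG \<zeta>) (G \<zeta> - F \<zeta>) / of_real (2 * gap \<zeta>)"
    by (rule rt; assumption)+
  show "enveloped_pair \<Omega> Y Z"
  proof
    show "dz LP.yh \<zeta> = (LP.mu \<zeta> / 2) *\<^sub>C LP.yh \<zeta> + LP.rho \<zeta> *\<^sub>C LP.P \<zeta> + LP.theta \<zeta> *\<^sub>C cnjv (LP.P \<zeta>)"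
      if z: "\<zeta> \<in> \<Omega>" for \<zeta>
      by (rule key[OF z rt[OF z z]])
  qed
qed

end

lemma canonical_scale:
  defines "r \<equiv> \<lambda>\<zeta>. inverse (sqrt (DF \<zeta> 1 \<bullet> DF \<zeta> 1))"
  shows "smooth_on \<Omega> r" "\<And>\<zeta>. \<zeta> \<in> \<Omega> \<Longrightarrow> 0 < r \<zeta>"
    "\<And>\<zeta>. \<zeta> \<in> \<Omega> \<Longrightarrow> (r \<zeta>)\<^sup>2 * (DF \<zeta> 1 \<bullet> DF \<zeta> 1) = 1"
proof -
  have pos: "0 < DF \<zeta> 1 \<bullet> DF \<zeta> 1" if z: "\<zeta> \<in> \<Omega>" for \<zeta>
  proof -
    obtain l lh where "tangent_pair (DF \<zeta>) (DG \<zeta>) (G \<zeta> - F \<zeta>) l lh" using tp[OF z] by blast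
    then interpret T: tangent_pair "DF \<zeta>" "DG \<zeta>" "G \<zeta> - F \<zeta>" l lh .
    show ?thesis using T.inner_a(1) T.l by simp
  qed
  show "0 < r \<zeta>" "(r \<zeta>)\<^sup>2 * (DF \<zeta> 1 \<bullet> DF \<zeta> 1) = 1" if "\<zeta> \<in> \<Omega>" for \<zeta>
    using pos[OF that] by (simp_all add: r_def power_inverse)
  have "sqrt (DF \<zeta> 1 \<bullet> DF \<zeta> 1) \<noteq> 0" if "\<zeta> \<in> \<Omega>" for \<zeta>
    using pos[OF that] by simp
  then show "smooth_on \<Omega> r"
    unfolding r_def by (intro smooth_intros op sF pos)
qed

end

text \<open>A given canonical lift is described only over the coordinate domain, and the lift built
  from the maps may differ from it elsewhere. Derivatives on the open domain do not see the
  difference; this and the next lemma transfer the structure.\<close>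

lemma lift_cong:
  assumes L: "lift \<Omega> Y'" and e: "\<And>\<zeta>. \<zeta> \<in> \<Omega> \<Longrightarrow> Y' \<zeta> = Y \<zeta>"
  shows "lift \<Omega> Y"
proof -
  interpret L: lift \<Omega> Y' by (rule L)
  have d: "dz (cpx \<circ> Y) \<zeta> = dz (cpx \<circ> Y') \<zeta>" "dzbar (cpx \<circ> Y) \<zeta> = dzbar (cpx \<circ> Y') \<zeta>" if "\<zeta> \<in> \<Omega>" for \<zeta>
    by (rule dz_cong_open[OF L.op that]; simp add: e)+
  show ?thesis
  proof
    show "smooth_on \<Omega> Y" by (rule smooth_on_cong[OF L.op e L.sY])
    show "mink (Y \<zeta>) (Y \<zeta>) = 0" if "\<zeta> \<in> \<Omega>" for \<zeta>
      using L.null[OF that] e[OF that] by simp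
    show "mink (dz (cpx \<circ> Y) \<zeta>) (dz (cpx \<circ> Y) \<zeta>) = 0" if "\<zeta> \<in> \<Omega>" for \<zeta>
      using L.conformal[OF that] d[OF that] by simp
    show "mink (dz (cpx \<circ> Y) \<zeta>) (dzbar (cpx \<circ> Y) \<zeta>) = 1/2" if "\<zeta> \<in> \<Omega>" for \<zeta>
      using L.metric[OF that] d[OF that] by simp
  qed (rule L.op)
qed

lemma enveloped_pair_cong:
  assumes E: "enveloped_pair \<Omega> Y' Z" and e: "\<And>\<zeta>. \<zeta> \<in> \<Omega> \<Longrightarrow> Y' \<zeta> = Y \<zeta>"
  shows "enveloped_pair \<Omega> Y Z"
    and "\<zeta> \<in> \<Omega> \<Longrightarrow> lift_pair.rho Y Z \<zeta> = lift_pair.rho Y' Z \<zeta>"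
    and "\<zeta> \<in> \<Omega> \<Longrightarrow> lift_pair.theta Y Z \<zeta> = lift_pair.theta Y' Z \<zeta>"
proof -
  interpret E: enveloped_pair \<Omega> Y' Z by (rule E)
  interpret L: lift \<Omega> Y by (rule lift_cong[OF E.lift_axioms e])
  interpret N: lift_pair \<Omega> Y Z
    by unfold_locales (use E.sZ E.nullZ E.pairYZ e in auto)
  have d: "dz (cpx \<circ> Y) \<zeta> = dz (cpx \<circ> Y') \<zeta>" if "\<zeta> \<in> \<Omega>" for \<zeta>
    by (rule dz_cong_open[OF L.op that]) (simp add: e)
  have mu: "N.mu \<zeta> = E.mu \<zeta>" if "\<zeta> \<in> \<Omega>" for \<zeta>
    unfolding N.mu_def E.mu_def d[OF that] ..
  have P: "N.P \<zeta> = E.P \<zeta>" if "\<zeta> \<in> \<Omega>" for \<zeta>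
    unfolding N.P_def E.P_def d[OF that] mu[OF that] by (simp add: e[OF that])
  have r: "N.rho \<zeta> = E.rho \<zeta>" and t: "N.theta \<zeta> = E.theta \<zeta>" if "\<zeta> \<in> \<Omega>" for \<zeta>
    unfolding N.rho_def E.rho_def N.theta_def E.theta_def P[OF that] by simp_all
  show "\<zeta> \<in> \<Omega> \<Longrightarrow> N.rho \<zeta> = E.rho \<zeta>" "\<zeta> \<in> \<Omega> \<Longrightarrow> N.theta \<zeta> = E.theta \<zeta>"
    by (rule r t; assumption)+
  show "enveloped_pair \<Omega> Y Z"
    by unfold_locales (use E.decomp r t mu P in auto)
qed

lemma canonical_lift_imp_lift:
  assumes c: "canonical_lift f V z Y" and "open (z ` V)" and f: "\<And>p. p \<in> V \<Longrightarrow> f p \<bullet> f p = 1"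
  shows "lift (z ` V) Y"
proof
  show "mink (Y \<zeta>) (Y \<zeta>) = 0" if "\<zeta> \<in> z ` V" for \<zeta>
  proof -
    obtain p l where "p \<in> V" "\<zeta> = z p" "Y (z p) = l *\<^sub>R (f p, 1)"
      using \<open>\<zeta> \<in> z ` V\<close> c unfolding canonical_lift_def by blast
    then show ?thesis using f[of p] by (simp add: mink_real)
  qed
qed (use c \<open>open (z ` V)\<close> in \<open>auto simp: canonical_lift_def\<close>)

lemma (in lift) lift_data_exists:
  assumes "coordinate A V z" "canonical_lift f V z Y" "\<Omega> = z ` V"
  obtains s \<kappa> where "lift_data A f V z Y s \<kappa>"
proof -
  define s where "s \<zeta> = 4 * mink (dz (dz y) \<zeta>) (dzbar (dz y) \<zeta>)" for \<zeta>
  have "lift_data A f V z Y s (\<lambda>\<zeta>. dz (dz y) \<zeta> + (s \<zeta> / 2) *\<^sub>C cpx (Y \<zeta>))"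
    using assms schwarzian_hopf by (auto simp: lift_data_def s_def)
  then show ?thesis by (rule that)
qed

text \<open>Both differentials are precomposed with multiplication by c. Relative to each other
  their linear and antilinear parts, scaled by the metric, transform like coefficients of |dz|^2 and
  of dz^2.\<close>

lemma (in tangent_pair) coordinate_change:
  fixes c :: complex
  assumes "c \<noteq> 0"
  defines "a' \<equiv> \<lambda>v. a (c * v)" and "b' \<equiv> \<lambda>v. b (c * v)"
  shows "tangent_pair a' b' m (l * cmod c) (lh * cmod c)"
    and "tangent_pair.rho_num a' b' m = of_real ((cmod c)\<^sup>2) * rho_num"
    and "tangent_pair.theta_num a' b' m = c\<^sup>2 * theta_num"
    and "a' 1 \<bullet> a' 1 = (cmod c)\<^sup>2 * (a 1 \<bullet> a 1)"
proof -
  have lc: "linear (\<lambda>v. c * v)"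
    by (simp add: linear_iff algebra_simps)
  have rg: "range a' = range a"
  proof
    show "range a \<subseteq> range a'"
    proof
      fix x assume "x \<in> range a"
      then obtain v where "x = a v" by blast
      then have "x = a' (v / c)" using \<open>c \<noteq> 0\<close> by (simp add: a'_def)
      then show "x \<in> range a'" by blast
    qed
  qed (auto simp: a'_def)
  show T': "tangent_pair a' b' m (l * cmod c) (lh * cmod c)"
  proof (rule tangent_pair.intro)
    show "linear a'" "linear b'"
      unfolding a'_def b'_def using linear_compose[OF lc lin(1)] linear_compose[OF lc lin(2)]
      by (simp_all add: o_def)
    show "refl m (b' v) \<in> range a'" for v
      unfolding rg b'_def by (rule tang)
  qed (use l m \<open>c \<noteq> 0\<close> in \<open>simp_all add: a'_def b'_def conf norm_mult\<close>)
  interpret T': tangent_pair a' b' m "l * cmod c" "lh * cmod c" by (rule T')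
  have ex: "a' 1 = Re c *\<^sub>R a 1 + Im c *\<^sub>R a \<i>" "a' \<i> = Re c *\<^sub>R a \<i> - Im c *\<^sub>R a 1"
    "b' 1 = Re c *\<^sub>R b 1 + Im c *\<^sub>R b \<i>" "b' \<i> = Re c *\<^sub>R b \<i> - Im c *\<^sub>R b 1"
    unfolding a'_def b'_def
    using linear_complex_expand[OF lin(1), of c] linear_complex_expand[OF lin(1), of "c * \<i>"]
      linear_complex_expand[OF lin(2), of c] linear_complex_expand[OF lin(2), of "c * \<i>"]
    by simp_all
  have rex: "refl m (a' 1) = Re c *\<^sub>R ra 1 + Im c *\<^sub>R ra \<i>" "refl m (a' \<i>) = Re c *\<^sub>R ra \<i> - Im c *\<^sub>R ra 1"
    unfolding ex refl_add refl_scaleR diff_conv_add_uminus scaleR_minus_left[symmetric] by simp_all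
  show "T'.rho_num = of_real ((cmod c)\<^sup>2) * rho_num" "T'.theta_num = c\<^sup>2 * theta_num"
    unfolding T'.rho_num_def rho_num_def T'.theta_num_def theta_num_def rex unfolding ex cmod_power2
    by (simp_all add: complex_eq_iff inner_add_left inner_add_right inner_diff_left inner_diff_right
        power2_eq_square algebra_simps)
  show "a' 1 \<bullet> a' 1 = (cmod c)\<^sup>2 * (a 1 \<bullet> a 1)"
    using T'.inner_a(1) inner_a(1) by (simp add: power_mult_distrib mult.commute)
qed

subsection \<open>Pairs of envelopes on a Riemann surface\<close>

locale surface_pair =
  fixes A :: "('m::t2_space) atlas" and f fh :: "'m \<Rightarrow> real^('n::finite)" and S :: "'m \<Rightarrow> 'n sphere2"
  assumes RS: "riemann_surface A"
    and imm: "immersion_on A UNIV f" "immersion_on A UNIV fh"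
    and distinct: "\<And>p. f p \<noteq> fh p"
    and sph: "sphere_congruence_on A UNIV S"
    and env: "envelops_on A UNIV f S" "envelops_on A UNIV fh S"
    and conf: "induces_conformal_structure_on A UNIV f" "induces_conformal_structure_on A UNIV fh"
begin

abbreviation "df V z p \<equiv> diff_at V z f p"
abbreviation "dfh V z p \<equiv> diff_at V z fh p"
abbreviation "rn V z p \<equiv> tangent_pair.rho_num (df V z p) (dfh V z p) (fh p - f p)"
abbreviation "tn V z p \<equiv> tangent_pair.theta_num (df V z p) (dfh V z p) (fh p - f p)"
abbreviation "speed V z p \<equiv> df V z p 1 \<bullet> df V z p 1"

definition "gapM p = 1 - f p \<bullet> fh p"

lemma smooth_f: "smooth_map_on A UNIV f" "smooth_map_on A UNIV fh"
  using imm by (auto simp: immersion_on_def)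

lemma unit: "f p \<bullet> f p = 1" "fh p \<bullet> fh p = 1"
proof -
  have "f p \<in> sphere 0 1" "fh p \<in> sphere 0 1"
    using imm unfolding immersion_on_def by blast+
  then have "norm (f p) = 1" "norm (fh p) = 1"
    by simp_all
  then show "f p \<bullet> f p = 1" "fh p \<bullet> fh p = 1"
    by (simp_all add: dot_square_norm)
qed

lemma gapM_pos: "0 < gapM p"
proof -
  have "0 < (fh p - f p) \<bullet> (fh p - f p)" using distinct[of p] by simp
  also have "\<dots> = 2 * gapM p"
    using unit[of p] by (simp add: gapM_def inner_diff_left inner_diff_right inner_commute)
  finally show ?thesis by simp
qed

lemma on_sphere: "round_2sphere_in_Sn (S p)" "f p \<in> points (S p)" "fh p \<in> points (S p)"
  using sph env by (auto simp: sphere_congruence_on_def envelops_on_def)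

lemma chart_linear:
  assumes "(W, \<phi>) \<in> A" "p \<in> W" "smooth_map_on A UNIV g"
  shows "linear (diff_at W \<phi> g p)"
proof -
  have "smooth_on (\<phi> ` W) (g \<circ> inv_into W \<phi>)"
    using assms by (auto simp: smooth_map_on_def)
  from smooth_on_has_derivative[OF this, of "\<phi> p"] assms(2) show ?thesis
    unfolding diff_at_def by (auto intro: has_derivative_linear)
qed

lemma chart_range:
  assumes "(W, \<phi>) \<in> A" "p \<in> W"
  shows "range (df W \<phi> p) = tangent_plane (S p) (f p)" "range (dfh W \<phi> p) = tangent_plane (S p) (fh p)"
proof -
  have "\<forall>c\<in>A. \<forall>p\<in>fst c \<inter> UNIV. range (diff_at (fst c) (snd c) f p) = tangent_plane (S p) (f p)"
    "\<forall>c\<in>A. \<forall>p\<in>fst c \<inter> UNIV. range (diff_at (fst c) (snd c) fh p) = tangent_plane (S p) (fh p)"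
    using env unfolding envelops_on_def case_prod_beta by blast+
  from bspec[OF bspec[OF this(1) assms(1)], of p] bspec[OF bspec[OF this(2) assms(1)], of p] assms(2)
  show "range (df W \<phi> p) = tangent_plane (S p) (f p)" "range (dfh W \<phi> p) = tangent_plane (S p) (fh p)"
    by simp_all
qed

lemma chart_conformal:
  assumes "(W, \<phi>) \<in> A" "p \<in> W"
  obtains l lh where "0 < l" "0 < lh" "\<And>v. norm (df W \<phi> p v) = l * cmod v" "\<And>v. norm (dfh W \<phi> p v) = lh * cmod v"
proof -
  have "\<forall>c\<in>A. \<forall>p\<in>fst c \<inter> UNIV. \<exists>l>0. \<forall>v. norm (diff_at (fst c) (snd c) f p v) = l * cmod v"
    "\<forall>c\<in>A. \<forall>p\<in>fst c \<inter> UNIV. \<exists>l>0. \<forall>v. norm (diff_at (fst c) (snd c) fh p v) = l * cmod v"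
    using conf unfolding induces_conformal_structure_on_def case_prod_beta by blast+
  from bspec[OF bspec[OF this(1) assms(1)], of p] bspec[OF bspec[OF this(2) assms(1)], of p] assms(2) that
  show ?thesis by auto
qed

lemma chart_tangent_pair:
  assumes "(W, \<phi>) \<in> A" "p \<in> W"
  obtains l lh where "tangent_pair (df W \<phi> p) (dfh W \<phi> p) (fh p - f p) l lh"
proof -
  obtain l lh where l: "0 < l" "0 < lh" "\<And>v. norm (df W \<phi> p v) = l * cmod v"
    "\<And>v. norm (dfh W \<phi> p v) = lh * cmod v"
    using chart_conformal[OF assms] by metis
  have ne: "fh p - f p \<noteq> 0"
    using distinct[of p] by auto
  have "tangent_pair (df W \<phi> p) (dfh W \<phi> p) (fh p - f p) l lh"
  proof (rule tangent_pair.intro)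
    show "refl (fh p - f p) (dfh W \<phi> p v) \<in> range (df W \<phi> p)" for v
      unfolding chart_range(1)[OF assms]
      by (rule refl_tangent_plane[OF on_sphere distinct]) (simp flip: chart_range(2)[OF assms])
  qed (fact l ne chart_linear[OF assms smooth_f(1)] chart_linear[OF assms smooth_f(2)])+
  then show ?thesis by (rule that)
qed

lemma coordinate_change_at:
  assumes z: "coordinate A V z" "p \<in> V" and W: "(W, \<phi>) \<in> A" "p \<in> W"
  obtains c l lh where "c \<noteq> 0" "deriv (z \<circ> inv_into W \<phi>) (\<phi> p) * c = 1"
    "tangent_pair (df V z p) (dfh V z p) (fh p - f p) l lh"
    "rn V z p = of_real ((cmod c)\<^sup>2) * rn W \<phi> p" "tn V z p = c\<^sup>2 * tn W \<phi> p"
    "speed V z p = (cmod c)\<^sup>2 * speed W \<phi> p"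
proof -
  define c where "c = deriv (\<phi> \<circ> inv_into V z) (z p)"
  have c1: "deriv (z \<circ> inv_into W \<phi>) (\<phi> p) * c = 1"
    unfolding c_def by (rule coordinate_transition(3)[OF RS z(1) W(1) W(2) z(2)])
  then have c0: "c \<noteq> 0" by auto
  have d: "df V z p = (\<lambda>v. df W \<phi> p (c * v))" "dfh V z p = (\<lambda>v. dfh W \<phi> p (c * v))"
    unfolding c_def using diff_at_transition[OF RS z(1) W(1) W(2) z(2)] smooth_f by (intro ext; blast)+
  obtain l lh where T: "tangent_pair (df W \<phi> p) (dfh W \<phi> p) (fh p - f p) l lh"
    by (rule chart_tangent_pair[OF W])
  note cc = tangent_pair.coordinate_change[OF T c0]
  show ?thesis
    by (rule that[OF c0 c1]) (use cc in \<open>simp_all only: d\<close>)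
qed

definition chart :: "'m \<Rightarrow> 'm set \<times> ('m \<Rightarrow> complex)" where
  "chart p = (SOME c. c \<in> A \<and> p \<in> fst c)"

lemma chart: "chart p \<in> A" "p \<in> fst (chart p)"
proof -
  obtain W \<phi> where "(W, \<phi>) \<in> A" "p \<in> W" by (rule chart_exists[OF RS])
  then have "\<exists>c. c \<in> A \<and> p \<in> fst c" by force
  from someI_ex[OF this] show "chart p \<in> A" "p \<in> fst (chart p)"
    by (auto simp: chart_def)
qed

text \<open>Division by the speed removes the factor |c|^2 of a coordinate change, so the value does
  not depend on the chosen chart.\<close>

definition rhoM :: "'m \<Rightarrow> complex" where
  "rhoM p = rn (fst (chart p)) (snd (chart p)) p / of_real (speed (fst (chart p)) (snd (chart p)) p)"

text \<open>Depends on the chosen chart through a factor c^2; it serves only to record vanishing at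
  the point.\<close>

definition thetaM :: "'m \<Rightarrow> complex" where
  "thetaM p = tn (fst (chart p)) (snd (chart p)) p"

lemma invariants:
  assumes z: "coordinate A V z" "p \<in> V"
  shows "rn V z p = of_real (speed V z p) * rhoM p" "tn V z p = 0 \<longleftrightarrow> thetaM p = 0" "0 < speed V z p"
proof -
  have C: "(fst (chart p), snd (chart p)) \<in> A" using chart(1) by simp
  obtain c l lh where c: "c \<noteq> 0" "tangent_pair (df V z p) (dfh V z p) (fh p - f p) l lh"
    "rn V z p = of_real ((cmod c)\<^sup>2) * rn (fst (chart p)) (snd (chart p)) p"
    "tn V z p = c\<^sup>2 * tn (fst (chart p)) (snd (chart p)) p"
    "speed V z p = (cmod c)\<^sup>2 * speed (fst (chart p)) (snd (chart p)) p"
    using coordinate_change_at[OF z C chart(2)] by metis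
  show pos: "0 < speed V z p"
    using tangent_pair.inner_a(1)[OF c(2)] tangent_pair.l(1)[OF c(2)] by simp
  then have "speed (fst (chart p)) (snd (chart p)) p \<noteq> 0"
    unfolding c(5) by auto
  then show "rn V z p = of_real (speed V z p) * rhoM p"
    unfolding c(3,5) rhoM_def by simp
  show "tn V z p = 0 \<longleftrightarrow> thetaM p = 0"
    unfolding c(4) thetaM_def using c(1) by simp
qed

lemma exclusive: "rhoM p = 0 \<longleftrightarrow> thetaM p \<noteq> 0"
proof -
  have C: "(fst (chart p), snd (chart p)) \<in> A" using chart(1) by simp
  note cc = chart_coordinate[OF RS C]
  obtain l lh where T: "tangent_pair (df (fst (chart p)) (snd (chart p)) p)
      (dfh (fst (chart p)) (snd (chart p)) p) (fh p - f p) l lh"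
    by (rule chart_tangent_pair[OF C chart(2)])
  show ?thesis
    using tangent_pair.rho_theta_exclusive[OF T] invariants[OF cc chart(2)] by auto
qed

lemma sphere_pair_in_coordinate:
  assumes z: "coordinate A V z"
  shows "sphere_pair (z ` V) (f \<circ> inv_into V z) (fh \<circ> inv_into V z)"
proof
  have inj: "inj_on z V" using z by (simp add: coordinate_def)
  show "open (z ` V)" by (rule coordinate_open_image[OF RS z])
  show "smooth_on (z ` V) (f \<circ> inv_into V z)" "smooth_on (z ` V) (fh \<circ> inv_into V z)"
    by (rule smooth_in_coordinate[OF RS z smooth_f(1)] smooth_in_coordinate[OF RS z smooth_f(2)])+
  fix \<zeta> assume "\<zeta> \<in> z ` V"
  then obtain p where p: "p \<in> V" "\<zeta> = z p" by blast
  show "(f \<circ> inv_into V z) \<zeta> \<bullet> (f \<circ> inv_into V z) \<zeta> = 1" "(fh \<circ> inv_into V z) \<zeta> \<bullet> (fh \<circ> inv_into V z) \<zeta> = 1"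
    using unit by simp_all
  obtain W \<phi> where W: "(W, \<phi>) \<in> A" "p \<in> W" by (rule chart_exists[OF RS])
  obtain l lh where "tangent_pair (df V z p) (dfh V z p) (fh p - f p) l lh"
    using coordinate_change_at[OF z p(1) W] by metis
  then show "\<exists>l lh. tangent_pair (frechet_derivative (f \<circ> inv_into V z) (at \<zeta>))
      (frechet_derivative (fh \<circ> inv_into V z) (at \<zeta>)) ((fh \<circ> inv_into V z) \<zeta> - (f \<circ> inv_into V z) \<zeta>) l lh"
    unfolding p(2) diff_at_def using inj p(1) by auto
qed

definition is_frame :: "'m set \<Rightarrow> ('m \<Rightarrow> complex) \<Rightarrow> (complex \<Rightarrow> (real, 'n) mink_vec) \<Rightarrow>
    (complex \<Rightarrow> (real, 'n) mink_vec) \<Rightarrow> bool" where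
  "is_frame V z Y Z \<longleftrightarrow> enveloped_pair (z ` V) Y Z \<and>
     (\<forall>p\<in>V. lift_pair.rho Y Z (z p) = of_real (speed V z p / (2 * gapM p)) * rhoM p \<and>
            lift_pair.theta Y Z (z p) = tn V z p / of_real (2 * gapM p)) \<and>
     (\<forall>p\<in>V. \<exists>r>0. r\<^sup>2 * speed V z p = 1 \<and> Y (z p) = r *\<^sub>R (f p, 1) \<and>
            Z (z p) = inverse (r * gapM p) *\<^sub>R (fh p, 1))"

text \<open>The disjunction covers two uses: a prescribed canonical lift, needed because the
  Willmore condition quantifies over all lift data, and a scale constructed from the metric.\<close>

lemma frame_of_scale:
  assumes z: "coordinate A V z" and r: "smooth_on (z ` V) r" "\<And>p. p \<in> V \<Longrightarrow> 0 < r (z p)"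
    and Y: "\<And>p. p \<in> V \<Longrightarrow> Y (z p) = r (z p) *\<^sub>R (f p, 1)"
    and s: "lift (z ` V) Y \<or> (\<forall>p\<in>V. (r (z p))\<^sup>2 * speed V z p = 1)"
  obtains Z where "is_frame V z Y Z"
proof -
  have inj: "inj_on z V" using z by (simp add: coordinate_def)
  interpret SP: sphere_pair "z ` V" "f \<circ> inv_into V z" "fh \<circ> inv_into V z"
    by (rule sphere_pair_in_coordinate[OF z])
  have r': "\<And>\<zeta>. \<zeta> \<in> z ` V \<Longrightarrow> 0 < r \<zeta>" using r(2) by auto
  define Y' where "Y' \<zeta> = r \<zeta> *\<^sub>R ((f \<circ> inv_into V z) \<zeta>, 1 :: real)" for \<zeta>
  have YY: "Y' \<zeta> = Y \<zeta>" if "\<zeta> \<in> z ` V" for \<zeta>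
    using that Y inj by (auto simp: Y'_def)
  have iff: "lift (z ` V) Y' \<longleftrightarrow> (\<forall>p\<in>V. (r (z p))\<^sup>2 * speed V z p = 1)"
  proof -
    have "lift (z ` V) Y' \<longleftrightarrow> (\<forall>\<zeta>\<in>z ` V. (r \<zeta>)\<^sup>2 * (SP.DF \<zeta> 1 \<bullet> SP.DF \<zeta> 1) = 1)"
      unfolding Y'_def[abs_def] by (rule SP.lift_iff_canonical[OF r(1) r'])
    then show ?thesis by (simp add: diff_at_def)
  qed
  have L: "lift (z ` V) Y'"
    using s lift_cong[of "z ` V" Y Y'] YY iff by auto
  define Z where "Z \<zeta> = SP.t r \<zeta> *\<^sub>R ((fh \<circ> inv_into V z) \<zeta>, 1 :: real)" for \<zeta>
  have E: "enveloped_pair (z ` V) Y' Z"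
    and E2: "\<forall>\<zeta>\<in>z ` V. lift_pair.rho Y' Z \<zeta> = tangent_pair.rho_num (SP.DF \<zeta>) (SP.DG \<zeta>)
      ((fh \<circ> inv_into V z) \<zeta> - (f \<circ> inv_into V z) \<zeta>) / of_real (2 * SP.gap \<zeta>)"
    and E3: "\<forall>\<zeta>\<in>z ` V. lift_pair.theta Y' Z \<zeta> = tangent_pair.theta_num (SP.DF \<zeta>) (SP.DG \<zeta>)
      ((fh \<circ> inv_into V z) \<zeta> - (f \<circ> inv_into V z) \<zeta>) / of_real (2 * SP.gap \<zeta>)"
    using SP.enveloped_pair_of_lift[OF r(1) r' L[unfolded Y'_def[abs_def]]]
    unfolding Y'_def[abs_def] Z_def[abs_def] by blast+
  have E': "enveloped_pair (z ` V) Y Z"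
    and E'2: "\<forall>\<zeta>\<in>z ` V. lift_pair.rho Y Z \<zeta> = lift_pair.rho Y' Z \<zeta>"
    and E'3: "\<forall>\<zeta>\<in>z ` V. lift_pair.theta Y Z \<zeta> = lift_pair.theta Y' Z \<zeta>"
    using enveloped_pair_cong[OF E YY] by blast+
  have "is_frame V z Y Z"
    unfolding is_frame_def
  proof (intro conjI ballI)
    show "enveloped_pair (z ` V) Y Z" by (rule E')
  next
    fix p assume p: "p \<in> V"
    have iv: "inv_into V z (z p) = p" using inj p by simp
    have gap: "SP.gap (z p) = gapM p" by (simp add: SP.gap_def gapM_def iv)
    have zp: "z p \<in> z ` V" using p by simp
    show "lift_pair.rho Y Z (z p) = of_real (speed V z p / (2 * gapM p)) * rhoM p"
      unfolding bspec[OF E'2 zp] bspec[OF E2 zp] gap o_apply iv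
      using invariants(1)[OF z p] by (simp add: diff_at_def o_def)
    show "lift_pair.theta Y Z (z p) = tn V z p / of_real (2 * gapM p)"
      unfolding bspec[OF E'3 zp] bspec[OF E3 zp] gap o_apply iv by (simp add: diff_at_def o_def)
    show "\<exists>r>0. r\<^sup>2 * speed V z p = 1 \<and> Y (z p) = r *\<^sub>R (f p, 1) \<and>
            Z (z p) = inverse (r * gapM p) *\<^sub>R (fh p, 1)"
      using r(2)[OF p] Y[OF p] L iff p
      by (intro exI[of _ "r (z p)"]) (auto simp: Z_def SP.t_def[OF r(1) r'] gap iv)
  qed
  then show ?thesis by (rule that)
qed

text \<open>The scale of the given lift is recovered as its last component, since that of (f p, 1)
  is 1.\<close>

lemma frame_of_lift:
  assumes z: "coordinate A V z" and Y: "canonical_lift f V z Y"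
  obtains Z where "is_frame V z Y Z"
proof (rule frame_of_scale[OF z, of "\<lambda>\<zeta>. snd (Y \<zeta>)" Y])
  have op: "open (z ` V)" by (rule coordinate_open_image[OF RS z])
  show "smooth_on (z ` V) (\<lambda>\<zeta>. snd (Y \<zeta>))"
    using Y by (intro smooth_intros op) (simp add: canonical_lift_def)
  show "0 < snd (Y (z p))" "Y (z p) = snd (Y (z p)) *\<^sub>R (f p, 1)" if "p \<in> V" for p
  proof -
    obtain l where "l > 0" "Y (z p) = l *\<^sub>R (f p, 1)"
      using Y \<open>p \<in> V\<close> unfolding canonical_lift_def by blast
    then show "0 < snd (Y (z p))" "Y (z p) = snd (Y (z p)) *\<^sub>R (f p, 1)" by simp_all
  qed
  show "lift (z ` V) Y \<or> (\<forall>p\<in>V. (snd (Y (z p)))\<^sup>2 * speed V z p = 1)"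
    using canonical_lift_imp_lift[OF Y op] unit by blast
qed (rule that)

lemma frame_exists:
  assumes z: "coordinate A V z"
  obtains Y Z where "is_frame V z Y Z"
proof -
  interpret SP: sphere_pair "z ` V" "f \<circ> inv_into V z" "fh \<circ> inv_into V z"
    by (rule sphere_pair_in_coordinate[OF z])
  have inj: "inj_on z V" using z by (simp add: coordinate_def)
  let ?r = "\<lambda>\<zeta>. inverse (sqrt (SP.DF \<zeta> 1 \<bullet> SP.DF \<zeta> 1))"
  note c = SP.canonical_scale
  show ?thesis
    by (rule frame_of_scale[OF z c(1), of "\<lambda>\<zeta>. ?r \<zeta> *\<^sub>R ((f \<circ> inv_into V z) \<zeta>, 1)"])
      (use c(2,3) inj that in \<open>auto simp: diff_at_def\<close>)
qed

lemma is_frame_canonical: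
  assumes "is_frame V z Y Z"
  shows "canonical_lift f V z Y"
proof -
  interpret enveloped_pair "z ` V" Y Z using assms by (simp add: is_frame_def)
  show ?thesis
    using assms sY conformal metric unfolding canonical_lift_def is_frame_def by blast
qed

end

context surface_pair
begin

lemma frame_pair: "is_frame V z Y Z \<Longrightarrow> enveloped_pair (z ` V) Y Z"
  by (simp add: is_frame_def)

lemma frame_rho: "is_frame V z Y Z \<Longrightarrow> p \<in> V \<Longrightarrow>
    lift_pair.rho Y Z (z p) = of_real (speed V z p / (2 * gapM p)) * rhoM p"
  and frame_theta: "is_frame V z Y Z \<Longrightarrow> p \<in> V \<Longrightarrow>
    lift_pair.theta Y Z (z p) = tn V z p / of_real (2 * gapM p)"
  by (simp_all add: is_frame_def)

lemma frame_scale: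
  assumes "is_frame V z Y Z" "p \<in> V"
  obtains r where "0 < r" "r\<^sup>2 * speed V z p = 1" "Y (z p) = r *\<^sub>R (f p, 1)"
    "Z (z p) = inverse (r * gapM p) *\<^sub>R (fh p, 1)"
  using assms unfolding is_frame_def by blast

lemma frame_rho_iff:
  assumes "coordinate A V z" "is_frame V z Y Z" "p \<in> V"
  shows "lift_pair.rho Y Z (z p) = 0 \<longleftrightarrow> rhoM p = 0"
    "cnj (lift_pair.rho Y Z (z p)) = lift_pair.rho Y Z (z p) \<longleftrightarrow> cnj (rhoM p) = rhoM p"
    "lift_pair.theta Y Z (z p) = 0 \<longleftrightarrow> thetaM p = 0"
proof -
  define k where "k = speed V z p / (2 * gapM p)"
  have "k \<noteq> 0"
    using invariants(3)[OF assms(1,3)] gapM_pos[of p] by (simp add: k_def)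
  then show "lift_pair.rho Y Z (z p) = 0 \<longleftrightarrow> rhoM p = 0"
    "cnj (lift_pair.rho Y Z (z p)) = lift_pair.rho Y Z (z p) \<longleftrightarrow> cnj (rhoM p) = rhoM p"
    unfolding frame_rho[OF assms(2,3)] k_def[symmetric] by simp_all
  show "lift_pair.theta Y Z (z p) = 0 \<longleftrightarrow> thetaM p = 0"
    unfolding frame_theta[OF assms(2,3)] using invariants(2)[OF assms(1,3)] gapM_pos[of p] by simp
qed

lemma open_coordinate_preimage:
  assumes "coordinate A V z" "open O'"
  shows "open {q \<in> V. z q \<in> O'}"
proof -
  have "open (V \<inter> z -` O')"
    using assms continuous_open_preimage[OF coordinate_continuous[OF RS assms(1)]]
    by (simp add: coordinate_def)
  also have "V \<inter> z -` O' = {q \<in> V. z q \<in> O'}" by auto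
  finally show ?thesis .
qed

lemma open_image_coordinate:
  assumes z: "coordinate A V z" and "open N" "N \<subseteq> V"
  shows "open (z ` N)"
proof -
  have "coordinate A N z"
    unfolding coordinate_def
  proof (intro conjI ballI, goal_cases)
    case 2
    then show ?case using z assms(3) by (auto simp: coordinate_def intro: inj_on_subset)
  next
    case (3 c)
    have "\<forall>c\<in>A. (z \<circ> inv_into (fst c) (snd c)) holomorphic_on snd c ` (fst c \<inter> V)"
      using z unfolding coordinate_def case_prod_beta by blast
    from bspec[OF this 3] show ?case
      unfolding case_prod_beta by (rule holomorphic_on_subset) (use assms(3) in auto)
  qed fact
  then show ?thesis by (rule coordinate_open_image[OF RS])
qed

text \<open>The definitions choose a chart at each point, so continuity is not evident. Locally,
  however, the zeros are those of the smooth functions \<open>rho\<close> and \<open>theta\<close>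
  of a frame.\<close>

lemma open_rhoM_thetaM: "open {p. rhoM p \<noteq> 0}" "open {p. thetaM p \<noteq> 0}"
proof -
  have "\<exists>T. open T \<and> p \<in> T \<and> T \<subseteq> {p. h p \<noteq> 0}"
    if h: "h p \<noteq> 0" and H: "\<And>W \<phi> Y Z. (W, \<phi>) \<in> A \<Longrightarrow> is_frame W \<phi> Y Z \<Longrightarrow>
        \<exists>k :: complex \<Rightarrow> complex. smooth_on (\<phi> ` W) k \<and> (\<forall>q\<in>W. k (\<phi> q) = 0 \<longleftrightarrow> h q = 0)"
    for h :: "'m \<Rightarrow> complex" and p
  proof -
    obtain W \<phi> where W: "(W, \<phi>) \<in> A" "p \<in> W" by (rule chart_exists[OF RS])
    note cc = chart_coordinate[OF RS W(1)]
    obtain Y Z where "is_frame W \<phi> Y Z" by (rule frame_exists[OF cc])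
    from H[OF W(1) this] obtain k :: "complex \<Rightarrow> complex" where k: "smooth_on (\<phi> ` W) k"
      "\<And>q. q \<in> W \<Longrightarrow> k (\<phi> q) = 0 \<longleftrightarrow> h q = 0" by blast
    have "open (\<phi> ` W \<inter> k -` (- {0}))"
      by (rule continuous_open_preimage[OF smooth_on_imp_continuous_on[OF k(1)] coordinate_open_image[OF RS cc]])
        auto
    from open_coordinate_preimage[OF cc this] show ?thesis
      by (intro exI[of _ "{q \<in> W. \<phi> q \<in> \<phi> ` W \<inter> k -` (- {0})}"]) (use k(2) W(2) h in auto)
  qed
  note key = this
  show "open {p. rhoM p \<noteq> 0}"
  proof (subst open_subopen, safe, rule key)
    fix W \<phi> Y Z assume W: "(W, \<phi>) \<in> A" and F: "is_frame W \<phi> Y Z"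
    interpret enveloped_pair "\<phi> ` W" Y Z by (rule frame_pair[OF F])
    show "\<exists>k :: complex \<Rightarrow> complex. smooth_on (\<phi> ` W) k \<and> (\<forall>q\<in>W. k (\<phi> q) = 0 \<longleftrightarrow> rhoM q = 0)"
      by (intro exI[of _ rho] conjI smooth_rho ballI frame_rho_iff(1)[OF chart_coordinate[OF RS W] F])
  qed
  show "open {p. thetaM p \<noteq> 0}"
  proof (subst open_subopen, safe, rule key)
    fix W \<phi> Y Z assume W: "(W, \<phi>) \<in> A" and F: "is_frame W \<phi> Y Z"
    interpret enveloped_pair "\<phi> ` W" Y Z by (rule frame_pair[OF F])
    show "\<exists>k :: complex \<Rightarrow> complex. smooth_on (\<phi> ` W) k \<and> (\<forall>q\<in>W. k (\<phi> q) = 0 \<longleftrightarrow> thetaM q = 0)"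
      by (intro exI[of _ theta] conjI smooth_theta ballI frame_rho_iff(3)[OF chart_coordinate[OF RS W] F])
  qed
qed

lemma connected: "connected (UNIV :: 'm set)"
  using RS by (simp add: riemann_surface_def)

lemma dichotomy: "(\<forall>p. thetaM p = 0) \<or> (\<forall>p. rhoM p = 0)"
proof -
  have "{p. rhoM p \<noteq> 0} \<inter> {p. thetaM p \<noteq> 0} \<inter> UNIV = {}" "UNIV \<subseteq> {p. rhoM p \<noteq> 0} \<union> {p. thetaM p \<noteq> 0}"
    using exclusive by auto
  from connectedD[OF connected open_rhoM_thetaM this] show ?thesis by auto
qed

text \<open>The outward radii at the two points of contact differ by fh p - f p, the vector of the
  reflection; this provides the hypotheses of \<open>change_of_basis\<close>.\<close>

lemma orientation:
  assumes W: "(W, \<phi>) \<in> A" "p \<in> W"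
  obtains P where "base_change P (adapted_basis S W \<phi> f p) (adapted_basis S W \<phi> fh p)"
    "thetaM p = 0 \<longrightarrow> det P < 0" "rhoM p = 0 \<longrightarrow> det P > 0"
proof -
  note cc = chart_coordinate[OF RS W(1)]
  obtain l lh where "tangent_pair (df W \<phi> p) (dfh W \<phi> p) (fh p - f p) l lh"
    by (rule chart_tangent_pair[OF W])
  then interpret T: tangent_pair "df W \<phi> p" "dfh W \<phi> p" "fh p - f p" l lh .
  let ?x0 = "f p - centre (S p)"
  have pts: "norm ?x0 = radius (S p)" "norm (fh p - centre (S p)) = radius (S p)" "?x0 \<in> dirs (S p)"
    "fh p - centre (S p) \<in> dirs (S p)"
    using on_sphere(2,3)[of p] by (auto simp: points_def)
  have sub: "subspace (dirs (S p))" and pos: "0 < radius (S p)"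
    using on_sphere(1)[of p] by (auto simp: round_2sphere_in_Sn_def)
  have eq: "?x0 + (fh p - f p) = fh p - centre (S p)" by simp
  have 1: "refl (fh p - f p) ?x0 = ?x0 + (fh p - f p)"
    unfolding eq by (rule refl_radius) (use pts distinct in auto)
  have 2: "?x0 \<noteq> 0" using pts(1) pos by auto
  have m: "fh p - f p \<in> dirs (S p)"
    using subspace_diff[OF sub pts(4,3)] by simp
  have 3: "fh p - f p - k *\<^sub>R ?x0 \<in> range (df W \<phi> p)" if "(fh p - f p - k *\<^sub>R ?x0) \<bullet> ?x0 = 0" for k
    unfolding chart_range(1)[OF W] tangent_plane_def
    using that subspace_diff[OF sub m subspace_scale[OF sub pts(3)]] by simp
  obtain P where P: "base_change P (vector [?x0, df W \<phi> p 1, df W \<phi> p \<i>])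
      (vector [?x0 + (fh p - f p), dfh W \<phi> p 1, dfh W \<phi> p \<i>])"
    "T.theta_num = 0 \<longrightarrow> det P < 0" "T.rho_num = 0 \<longrightarrow> det P > 0"
    by (rule T.change_of_basis[OF 1 2 3])
  show ?thesis
  proof (rule that[of P])
    show "base_change P (adapted_basis S W \<phi> f p) (adapted_basis S W \<phi> fh p)"
      using P(1) unfolding eq adapted_basis_def .
    show "thetaM p = 0 \<longrightarrow> det P < 0"
      using P(2) invariants(2)[OF cc W(2)] by simp
    show "rhoM p = 0 \<longrightarrow> det P > 0"
      using P(3) invariants(1)[OF cc W(2)] by simp
  qed
qed

subsection \<open>Trivial pairs\<close>

lemma reversing_frame:
  assumes th: "\<And>p. thetaM p = 0" and z: "coordinate A V z" and F: "is_frame V z Y Z"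
  shows "reversing_pair (z ` V) Y Z"
proof -
  interpret enveloped_pair "z ` V" Y Z by (rule frame_pair[OF F])
  show ?thesis
    by unfold_locales (use frame_rho_iff(3)[OF z F] th in auto)
qed

text \<open>The interior of the real locus is also closed: near a limit point, a square around some
  interior point covers a whole neighbourhood, and reality spreads over it by
  \<open>rho_real_propagates\<close>.\<close>

lemma real_locus_dichotomy:
  assumes th: "\<And>p. thetaM p = 0"
  shows "(\<forall>p. cnj (rhoM p) = rhoM p) \<or> interior {p. cnj (rhoM p) = rhoM p} = {}"
proof -
  let ?R = "{p. cnj (rhoM p) = rhoM p}"
  have "open (- interior ?R)"
  proof (subst open_subopen, safe)
    fix p assume p: "p \<notin> interior ?R"
    obtain W \<phi> where W: "(W, \<phi>) \<in> A" "p \<in> W" by (rule chart_exists[OF RS])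
    note cc = chart_coordinate[OF RS W(1)]
    obtain Y Z where F: "is_frame W \<phi> Y Z" by (rule frame_exists[OF cc])
    interpret reversing_pair "\<phi> ` W" Y Z by (rule reversing_frame[OF th cc F])
    obtain e where e: "0 < e" "ball (\<phi> p) e \<subseteq> \<phi> ` W"
      using openE[OF op] W(2) by blast
    \<comment> \<open>A square of half side e/3 around a point within e/7 of \<open>\<phi> p\<close>
      stays in the ball of radius e, because 2e/3 + e/7 < e, and two points of N are closer than
      2e/7 < e/3.\<close>
    define N where "N = {q \<in> W. \<phi> q \<in> ball (\<phi> p) (e/7)}"
    have N: "open N" "p \<in> N"
      using open_coordinate_preimage[OF cc, of "ball (\<phi> p) (e/7)"] W(2) e by (auto simp: N_def)
    have "N \<inter> interior ?R = {}"
    proof (rule ccontr)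
      assume "N \<inter> interior ?R \<noteq> {}"
      then obtain q where q: "q \<in> N" "q \<in> interior ?R" by blast
      then have qW: "q \<in> W" and dq: "cmod (\<phi> p - \<phi> q) < e/7" by (auto simp: N_def dist_norm)
      have sq: "csquare (\<phi> q) (e/3) \<subseteq> \<phi> ` W"
      proof
        fix \<zeta> assume "\<zeta> \<in> csquare (\<phi> q) (e/3)"
        then have "\<bar>Re (\<zeta> - \<phi> q)\<bar> \<le> e/3" "\<bar>Im (\<zeta> - \<phi> q)\<bar> \<le> e/3" by (auto simp: mem_csquare)
        then have "cmod (\<zeta> - \<phi> q) \<le> 2*e/3" using cmod_le[of "\<zeta> - \<phi> q"] by linarith
        then have "cmod (\<phi> p - \<zeta>) < e"
          using dq norm_triangle_ineq4[of "\<phi> p - \<phi> q" "\<zeta> - \<phi> q"] e(1) by (simp add: algebra_simps)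
        then show "\<zeta> \<in> \<phi> ` W" using e(2) by (auto simp: dist_norm)
      qed
      have "open (\<phi> ` (interior ?R \<inter> W))"
        by (rule open_image_coordinate[OF cc]) (use chart_homeomorphism(1)[OF RS W(1)] in auto)
      then obtain r where r: "0 < r" "ball (\<phi> q) r \<subseteq> \<phi> ` (interior ?R \<inter> W)"
        using openE q(2) qW by blast
      have rr: "cnj (rho \<zeta>) = rho \<zeta>" if "\<zeta> \<in> \<phi> ` W" "cmod (\<zeta> - \<phi> q) < r" for \<zeta>
      proof -
        have "\<zeta> \<in> ball (\<phi> q) r" using that(2) by (simp add: dist_norm norm_minus_commute)
        then obtain q' where q': "q' \<in> interior ?R" "q' \<in> W" "\<zeta> = \<phi> q'" using r(2) by blast
        then have "cnj (rhoM q') = rhoM q'" using interior_subset by blast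
        then show ?thesis unfolding q'(3) using frame_rho_iff(2)[OF cc F q'(2)] by simp
      qed
      have "N \<subseteq> ?R"
      proof
        fix q' assume "q' \<in> N"
        then have q': "q' \<in> W" "cmod (\<phi> p - \<phi> q') < e/7" by (auto simp: N_def dist_norm)
        have "cmod (\<phi> q' - \<phi> q) < e/3"
          using q'(2) dq norm_triangle_ineq4[of "\<phi> p - \<phi> q" "\<phi> p - \<phi> q'"] e(1) by simp
        from rho_real_propagates[OF sq r(1) rr this] have "cnj (rho (\<phi> q')) = rho (\<phi> q')" .
        then show "q' \<in> ?R" using frame_rho_iff(2)[OF cc F q'(1)] by simp
      qed
      then have "p \<in> interior ?R"
        using N interiorI by blast
      then show False using p by blast
    qed
    then show "\<exists>T. open T \<and> p \<in> T \<and> T \<subseteq> - interior ?R"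
      using N by blast
  qed
  then have "interior ?R = {} \<or> interior ?R = UNIV"
    using connectedD[OF connected open_interior, of "- interior ?R" ?R] by auto
  then show ?thesis
    using interior_subset[of ?R] by auto
qed

text \<open>For real \<open>rhoM\<close>, \<open>rho0\<close> and \<open>axis0\<close> are
  \<open>Re rho\<close> and \<open>axis\<close> of any frame freed of the scale r of its lift,
  namely multiplied by r^2 and by r. In \<open>axis_part\<close> the scale cancels.\<close>

definition rho0 :: "'m \<Rightarrow> real" where
  "rho0 p = Re (rhoM p) / (2 * gapM p)"

definition axis0 :: "'m \<Rightarrow> (real, 'n) mink_vec" where
  "axis0 p = rho0 p *\<^sub>R (f p, 1) - (1 / gapM p) *\<^sub>R (fh p, 1)"

definition axis_part :: "(real, 'n) mink_vec \<Rightarrow> 'm \<Rightarrow> (real, 'n) mink_vec" where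
  "axis_part v p = (mink v (axis0 p) / rho0 p) *\<^sub>R axis0 p"

context
  assumes th: "\<And>p. thetaM p = 0" and real: "\<And>p. cnj (rhoM p) = rhoM p"
begin

lemma rho0_nz: "rho0 p \<noteq> 0"
proof -
  have "rhoM p \<noteq> 0" using exclusive[of p] th by simp
  moreover have "Im (rhoM p) = 0" using arg_cong[OF real, of Im] by simp
  ultimately have "Re (rhoM p) \<noteq> 0" by (simp add: complex_eq_iff)
  then show ?thesis using gapM_pos[of p] by (simp add: rho0_def)
qed

lemma axis_part_in_frame:
  assumes z: "coordinate A V z" and F: "is_frame V z Y Z" and p: "p \<in> V"
  shows "(mink v (reversing_pair.axis Y Z (z p)) * inverse (Re (lift_pair.rho Y Z (z p)))) *\<^sub>R
      reversing_pair.axis Y Z (z p) = axis_part v p"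
proof -
  interpret reversing_pair "z ` V" Y Z by (rule reversing_frame[OF th z F])
  obtain r where r: "0 < r" "r\<^sup>2 * speed V z p = 1" "Y (z p) = r *\<^sub>R (f p, 1)"
    "Z (z p) = inverse (r * gapM p) *\<^sub>R (fh p, 1)"
    by (rule frame_scale[OF F p])
  have "Re (rho (z p)) = speed V z p / (2 * gapM p) * Re (rhoM p)"
    unfolding frame_rho[OF F p] by (simp del: of_real_divide)
  also have "\<dots> = rho0 p * speed V z p" by (simp add: rho0_def)
  also have "speed V z p = 1 / r\<^sup>2" using r(1,2) by (simp add: field_simps)
  finally have R: "Re (rho (z p)) = rho0 p / r\<^sup>2" by simp
  have "axis (z p) = (1 / r) *\<^sub>R axis0 p"
  proof -
    have "rho0 p / r\<^sup>2 * r = 1 / r * rho0 p" "inverse (r * gapM p) = 1 / r * (1 / gapM p)"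
      using r(1) by (simp_all add: power2_eq_square divide_inverse)
    then show ?thesis
      by (simp only: axis_def R r(3,4) axis0_def scaleR_diff_right scaleR_scaleR)
  qed
  then show ?thesis
    unfolding R axis_part_def using r(1) rho0_nz[of p]
    by (simp add: mink_simps field_simps power2_eq_square)
qed

lemma axis_part_constant: "axis_part v p = axis_part v q"
proof (rule connected_local_const[OF connected])
  show "\<forall>p\<in>UNIV. \<forall>\<^sub>F q in at p within UNIV. axis_part v p = axis_part v q"
  proof
    fix p
    obtain W \<phi> where W: "(W, \<phi>) \<in> A" "p \<in> W" by (rule chart_exists[OF RS])
    note cc = chart_coordinate[OF RS W(1)]
    obtain Y Z where F: "is_frame W \<phi> Y Z" by (rule frame_exists[OF cc])
    interpret reversing_pair "\<phi> ` W" Y Z by (rule reversing_frame[OF th cc F])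
    obtain e where e: "0 < e" "ball (\<phi> p) e \<subseteq> \<phi> ` W"
      using openE[OF op] W(2) by blast
    let ?h = "\<lambda>\<zeta>. (mink v (axis \<zeta>) * inverse (Re (rho \<zeta>))) *\<^sub>R axis \<zeta>"
    have "cnj (rho \<zeta>) = rho \<zeta>" "rho \<zeta> \<noteq> 0" if "\<zeta> \<in> \<phi> ` W" for \<zeta>
      using that frame_rho_iff(1,2)[OF cc F] real exclusive th by auto
    then have hd: "(?h has_derivative (\<lambda>v. 0)) (at \<zeta>)" if "\<zeta> \<in> \<phi> ` W" for \<zeta>
      using axis_projection_constant that by blast
    have "\<exists>c. \<forall>\<zeta>\<in>ball (\<phi> p) e. ?h \<zeta> = c"
      by (rule has_derivative_zero_constant[OF convex_ball has_derivative_at_withinI[OF hd]])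
        (use e(2) in blast)
    then obtain c where c: "\<And>\<zeta>. \<zeta> \<in> ball (\<phi> p) e \<Longrightarrow> ?h \<zeta> = c" by blast
    have ap: "axis_part v q = c" if "q \<in> W" "\<phi> q \<in> ball (\<phi> p) e" for q
      using c[OF that(2)] axis_part_in_frame[OF cc F that(1)] by simp
    have "open {q \<in> W. \<phi> q \<in> ball (\<phi> p) e}"
      by (rule open_coordinate_preimage[OF cc]) simp
    moreover have "p \<in> {q \<in> W. \<phi> q \<in> ball (\<phi> p) e}" using W(2) e(1) by simp
    moreover have "axis_part v p = axis_part v q" if "q \<in> {q \<in> W. \<phi> q \<in> ball (\<phi> p) e}" for q
      using ap[of p] ap[of q] that W(2) e(1) by simp
    ultimately show "\<forall>\<^sub>F q in at p within UNIV. axis_part v p = axis_part v q"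
      unfolding eventually_at_topological by blast
  qed
qed auto

text \<open>L is the reflection in the hyperplane orthogonal to \<open>axis0\<close>, whose square
  is \<open>2 * rho0\<close>. By constancy it may be computed at any point p, where (f p, 1) pairs
  to 1 with \<open>axis0 p\<close> and is therefore sent to a multiple of (fh p, 1).\<close>

lemma trivial: "trivial_pair f fh"
proof -
  obtain p0 :: 'm where True by simp
  define L where "L v = v - axis_part v p0" for v :: "(real, 'n) mink_vec"
  have aa: "mink (axis0 p) (axis0 p) = 2 * rho0 p" for p
  proof -
    have "mink (f p, 1) (fh p, 1) = - gapM p" "mink (fh p, 1) (f p, 1) = - gapM p"
      by (simp_all add: mink_real gapM_def inner_commute)
    moreover have "mink (f p, 1 :: real) (f p, 1) = 0" "mink (fh p, 1 :: real) (fh p, 1) = 0"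
      using unit[of p] by (simp_all add: mink_real)
    ultimately show ?thesis
      using gapM_pos[of p] unfolding axis0_def mink_simps by simp
  qed
  have lin: "linear L"
    by (rule linearI) (simp_all add: L_def axis_part_def mink_simps add_divide_distrib scaleR_add_left algebra_simps)
  have iso: "mink (L v) (L w) = mink v w" for v w
  proof -
    have "mink (L v) (L w) = mink v w - 2 * (mink v (axis0 p0) * mink w (axis0 p0) / rho0 p0)
        + mink v (axis0 p0) * mink w (axis0 p0) / (rho0 p0 * rho0 p0) * mink (axis0 p0) (axis0 p0)"
      unfolding L_def axis_part_def mink_simps
      by (simp add: mink_sym[of "axis0 p0" w] algebra_simps)
    then show ?thesis
      unfolding aa using rho0_nz[of p0] by simp
  qed
  have image: "L (f p, 1) = (1 / (gapM p * rho0 p)) *\<^sub>R (fh p, 1)" for p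
  proof -
    have "mink (f p, 1) (axis0 p) = 1"
      unfolding axis0_def mink_simps using unit[of p] gapM_pos[of p]
      by (simp add: mink_real gapM_def field_simps)
    then have ap: "axis_part (f p, 1) p0 = (1 / rho0 p) *\<^sub>R axis0 p"
      unfolding axis_part_constant[of _ p0 p] by (simp add: axis_part_def)
    show ?thesis
      unfolding L_def ap axis0_def scaleR_diff_right scaleR_scaleR using rho0_nz[of p]
      by (simp add: mult.commute)
  qed
  define T where "T x = (1 / snd (L (x, 1))) *\<^sub>R fst (L (x, 1))" for x :: "real^'n"
  have T: "T x \<in> sphere 0 1 \<and> (\<exists>c. c \<noteq> 0 \<and> L (x, 1) = c *\<^sub>R (T x, 1))" if "x \<in> sphere 0 1" for x
  proof -
    have xx: "x \<bullet> x = 1" using that by (simp add: dot_square_norm)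
    have nul: "fst (L (x, 1)) \<bullet> fst (L (x, 1)) = snd (L (x, 1)) * snd (L (x, 1))"
      using iso[of "(x, 1)" "(x, 1)"] xx by (simp add: mink_real)
    \<comment> \<open>A null vector with last component 0 is 0, but L preserves the nonzero pairing
      of (x, 1) with (0, 1).\<close>
    have s0: "snd (L (x, 1)) \<noteq> 0"
    proof
      assume "snd (L (x, 1)) = 0"
      with nul have "L (x, 1) = 0" by (simp add: prod_eq_iff)
      then have "mink (x, 1 :: real) (0, 1) = 0"
        using iso[of "(x, 1)" "(0, 1)"] by (simp add: mink_simps)
      then show False by (simp add: mink_real)
    qed
    have "T x \<bullet> T x = 1"
      unfolding T_def using nul s0 by simp
    then have "norm (T x) = 1" by (simp add: norm_eq_sqrt_inner)
    moreover have "L (x, 1) = snd (L (x, 1)) *\<^sub>R (T x, 1)"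
      using s0 by (simp add: T_def prod_eq_iff)
    ultimately show ?thesis using s0 by auto
  qed
  have "moebius T"
    unfolding moebius_def using lin iso T by blast
  moreover have "fh p = T (f p)" for p
    unfolding T_def image using gapM_pos[of p] rho0_nz[of p] by simp
  ultimately show ?thesis
    unfolding trivial_pair_def by blast
qed

end

subsection \<open>The two classes\<close>

context
  assumes th: "\<And>p. thetaM p = 0" and thin: "interior {p. cnj (rhoM p) = rhoM p} = {}"
begin

text \<open>A nonzero normal part makes \<open>rho\<close> real and persists nearby by continuity,
  which would put an open set into the real locus.\<close>

lemma dual_frame:
  assumes z: "coordinate A V z" and F: "is_frame V z Y Z"
  shows "dual_pair (z ` V) Y Z"
proof -
  interpret reversing_pair "z ` V" Y Z by (rule reversing_frame[OF th z F])
  have "normal_part (z p) = 0" if p: "p \<in> V" for p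
  proof (rule ccontr)
    assume "normal_part (z p) \<noteq> 0"
    have "open (z ` V \<inter> normal_part -` (- {0}))"
      by (rule continuous_open_preimage[OF smooth_on_imp_continuous_on[OF smooth_normal_part] op]) auto
    from open_coordinate_preimage[OF z this]
    have o: "open {q \<in> V. z q \<in> z ` V \<inter> normal_part -` (- {0})}" .
    have "{q \<in> V. z q \<in> z ` V \<inter> normal_part -` (- {0})} \<subseteq> {p. cnj (rhoM p) = rhoM p}"
      using normal_part_rho_real frame_rho_iff(2)[OF z F] by force
    then have "p \<in> interior {p. cnj (rhoM p) = rhoM p}"
      using o p \<open>normal_part (z p) \<noteq> 0\<close> by (intro interiorI[OF o]) auto
    then show False using thin by simp
  qed
  then show ?thesis
    by unfold_locales auto
qed

lemma lift_data_dual_pair: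
  assumes D: "lift_data A f V z Y s \<kappa>"
  obtains Z where "dual_pair (z ` V) Y Z"
    "\<And>\<zeta>. \<zeta> \<in> z ` V \<Longrightarrow> \<kappa> \<zeta> \<in> VC_perp Y \<zeta>"
    "\<And>\<zeta>. \<zeta> \<in> z ` V \<Longrightarrow> dz (dz (cpx \<circ> Y)) \<zeta> + (s \<zeta> / 2) *\<^sub>C cpx (Y \<zeta>) = \<kappa> \<zeta>"
proof -
  have z: "coordinate A V z" and Y: "canonical_lift f V z Y"
    and k: "\<And>\<zeta>. \<zeta> \<in> z ` V \<Longrightarrow> \<kappa> \<zeta> \<in> VC_perp Y \<zeta> \<and> dz (dz (cpx \<circ> Y)) \<zeta> + (s \<zeta> / 2) *\<^sub>C cpx (Y \<zeta>) = \<kappa> \<zeta>"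
    using D by (auto simp: lift_data_def)
  obtain Z where "is_frame V z Y Z" by (rule frame_of_lift[OF z Y])
  from dual_frame[OF z this] show ?thesis
    by (rule that) (use k in auto)
qed

lemma s_willmore: "s_willmore_on A f UNIV"
  unfolding s_willmore_on_def willmore_on_def
proof (intro conjI allI impI ballI)
  fix V z Y s \<kappa> \<zeta>
  assume D: "lift_data A f V z Y s \<kappa>" and \<zeta>: "\<zeta> \<in> z ` V"
  obtain Z where Z: "dual_pair (z ` V) Y Z" and k: "\<And>\<zeta>. \<zeta> \<in> z ` V \<Longrightarrow> \<kappa> \<zeta> \<in> VC_perp Y \<zeta>"
    "\<And>\<zeta>. \<zeta> \<in> z ` V \<Longrightarrow> dz (dz (cpx \<circ> Y)) \<zeta> + (s \<zeta> / 2) *\<^sub>C cpx (Y \<zeta>) = \<kappa> \<zeta>"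
    by (rule lift_data_dual_pair[OF D]) blast
  interpret dual_pair "z ` V" Y Z by (rule Z)
  show "Dzbar Y (Dzbar Y \<kappa>) \<zeta> + (cnj (s \<zeta>) / 2) *\<^sub>C \<kappa> \<zeta> = 0"
    by (rule willmore_equation[OF k \<zeta>])
  have "Dzbar Y \<kappa> \<zeta> = (- cnj (mu \<zeta>) / 2) *\<^sub>C \<kappa> \<zeta>"
    by (rule Dzbar_kappa[OF k \<zeta>])
  then have "(cnj (mu \<zeta>) / 2) *\<^sub>C \<kappa> \<zeta> + 1 *\<^sub>C Dzbar Y \<kappa> \<zeta> = 0"
    by (simp add: cscale_minus_left)
  then show "\<exists>a b. (a, b) \<noteq> (0, 0) \<and> a *\<^sub>C \<kappa> \<zeta> + b *\<^sub>C Dzbar Y \<kappa> \<zeta> = 0"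
    by (intro exI[of _ "cnj (mu \<zeta>) / 2"] exI[of _ 1]) simp
qed

lemma dual_surface: "dual_surface_on A f fh UNIV"
  unfolding dual_surface_on_def
proof
  fix p
  obtain W \<phi> where W: "(W, \<phi>) \<in> A" "p \<in> W" by (rule chart_exists[OF RS])
  note cc = chart_coordinate[OF RS W(1)]
  obtain Y Z where F: "is_frame W \<phi> Y Z" by (rule frame_exists[OF cc])
  interpret dual_pair "\<phi> ` W" Y Z by (rule dual_frame[OF cc F])
  obtain s \<kappa> where D: "lift_data A f W \<phi> Y s \<kappa>"
    by (rule lift_data_exists[OF cc is_frame_canonical[OF F] refl])
  then have k: "\<And>\<zeta>. \<zeta> \<in> \<phi> ` W \<Longrightarrow> \<kappa> \<zeta> \<in> VC_perp Y \<zeta>"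
    "\<And>\<zeta>. \<zeta> \<in> \<phi> ` W \<Longrightarrow> dz (dz y) \<zeta> + (s \<zeta> / 2) *\<^sub>C cpx (Y \<zeta>) = \<kappa> \<zeta>"
    by (auto simp: lift_data_def)
  have "\<exists>N. is_N Y \<zeta> N \<and> complex_of_real ((cmod (mu \<zeta>))\<^sup>2 / 2) *\<^sub>C cpx (Y \<zeta>) + cnj (mu \<zeta>) *\<^sub>C dz y \<zeta>
      + mu \<zeta> *\<^sub>C dzbar y \<zeta> + cpx N = cpx (Z \<zeta>)" if "\<zeta> \<in> \<phi> ` W" for \<zeta>
    using dual_surface_formula[OF that] by metis
  then obtain N where N: "\<And>\<zeta>. \<zeta> \<in> \<phi> ` W \<Longrightarrow> is_N Y \<zeta> (N \<zeta>)"
    "\<And>\<zeta>. \<zeta> \<in> \<phi> ` W \<Longrightarrow> complex_of_real ((cmod (mu \<zeta>))\<^sup>2 / 2) *\<^sub>C cpx (Y \<zeta>) + cnj (mu \<zeta>) *\<^sub>C dz y \<zeta>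
      + mu \<zeta> *\<^sub>C dzbar y \<zeta> + cpx (N \<zeta>) = cpx (Z \<zeta>)"
    by metis
  show "\<exists>V z Y s \<kappa> N \<mu>. p \<in> V \<and> V \<subseteq> UNIV \<and> lift_data A f V z Y s \<kappa> \<and>
        (\<forall>\<zeta>\<in>z ` V. is_N Y \<zeta> (N \<zeta>) \<and> Dzbar Y \<kappa> \<zeta> + (cnj (\<mu> \<zeta>) / 2) *\<^sub>C \<kappa> \<zeta> = 0) \<and>
        (\<forall>q\<in>V. \<exists>c::real. c \<noteq> 0 \<and>
           complex_of_real ((cmod (\<mu> (z q)))\<^sup>2 / 2) *\<^sub>C cpx (Y (z q))
             + cnj (\<mu> (z q)) *\<^sub>C dz (cpx \<circ> Y) (z q) + \<mu> (z q) *\<^sub>C dzbar (cpx \<circ> Y) (z q)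
             + cpx (N (z q))
           = cpx (c *\<^sub>R (fh q, 1)))"
  proof (intro exI conjI)
    show "p \<in> W" by (rule W(2))
    show "lift_data A f W \<phi> Y s \<kappa>" by (rule D)
    show "\<forall>\<zeta>\<in>\<phi> ` W. is_N Y \<zeta> (N \<zeta>) \<and> Dzbar Y \<kappa> \<zeta> + (cnj (mu \<zeta>) / 2) *\<^sub>C \<kappa> \<zeta> = 0"
      using N(1) Dzbar_kappa[OF k] by (simp add: cscale_minus_left)
    show "\<forall>q\<in>W. \<exists>c::real. c \<noteq> 0 \<and>
           complex_of_real ((cmod (mu (\<phi> q)))\<^sup>2 / 2) *\<^sub>C cpx (Y (\<phi> q))
             + cnj (mu (\<phi> q)) *\<^sub>C dz (cpx \<circ> Y) (\<phi> q) + mu (\<phi> q) *\<^sub>C dzbar (cpx \<circ> Y) (\<phi> q)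
             + cpx (N (\<phi> q))
           = cpx (c *\<^sub>R (fh q, 1))"
    proof
      fix q assume q: "q \<in> W"
      obtain r where r: "0 < r" "Z (\<phi> q) = inverse (r * gapM q) *\<^sub>R (fh q, 1)"
        using frame_scale[OF F q] by metis
      have "inverse (r * gapM q) \<noteq> 0" using r(1) gapM_pos[of q] by simp
      then show "\<exists>c::real. c \<noteq> 0 \<and>
           complex_of_real ((cmod (mu (\<phi> q)))\<^sup>2 / 2) *\<^sub>C cpx (Y (\<phi> q))
             + cnj (mu (\<phi> q)) *\<^sub>C dz (cpx \<circ> Y) (\<phi> q) + mu (\<phi> q) *\<^sub>C dzbar (cpx \<circ> Y) (\<phi> q)
             + cpx (N (\<phi> q))
           = cpx (c *\<^sub>R (fh q, 1))"
        using N(2)[of "\<phi> q"] q unfolding r(2) by blast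
    qed
  qed simp
qed

end

section \<open>Orientation, and Darboux pairs in a normalising coordinate\<close>

lemma anticonformal:
  assumes th: "\<And>p. thetaM p = 0"
  shows "anticonformal_on A UNIV S f fh"
  unfolding anticonformal_on_def
proof (clarify)
  fix W \<phi> p assume W: "(W, \<phi>) \<in> A" "p \<in> W"
  show "\<exists>P. base_change P (adapted_basis S W \<phi> f p) (adapted_basis S W \<phi> fh p) \<and> det P < 0"
    by (rule orientation[OF W]) (use th in blast)
qed

lemma orientation_preserving:
  assumes rh: "\<And>p. rhoM p = 0"
  shows "orientation_preserving_on A UNIV S f fh"
  unfolding orientation_preserving_on_def
proof (clarify)
  fix W \<phi> p assume W: "(W, \<phi>) \<in> A" "p \<in> W"
  show "\<exists>P. base_change P (adapted_basis S W \<phi> f p) (adapted_basis S W \<phi> fh p) \<and> det P > 0"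
    by (rule orientation[OF W]) (use rh in blast)
qed

context
  assumes rh: "\<And>p. rhoM p = 0"
begin

lemma preserving_frame:
  assumes z: "coordinate A V z" and F: "is_frame V z Y Z"
  shows "preserving_pair (z ` V) Y Z"
proof -
  interpret enveloped_pair "z ` V" Y Z by (rule frame_pair[OF F])
  show ?thesis
    by unfold_locales (use frame_rho_iff(1)[OF z F] rh in auto)
qed

text \<open>The new coordinate is a primitive of a square root of \<open>theta\<close>, restricted
  to a disc on which it is injective. As \<open>theta\<close> transforms like a quadratic
  differential, it is divided by the square of that derivative and becomes 1.\<close>

lemma normalising_coordinate:
  obtains V z where "coordinate A V z" "p \<in> V"
    "\<And>Y Z q. is_frame V z Y Z \<Longrightarrow> q \<in> V \<Longrightarrow> lift_pair.theta Y Z (z q) = 1"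
proof -
  obtain W \<phi> where W: "(W, \<phi>) \<in> A" "p \<in> W" by (rule chart_exists[OF RS])
  note cc = chart_coordinate[OF RS W(1)]
  note hm = chart_homeomorphism[OF RS W(1)]
  obtain Y Z where F: "is_frame W \<phi> Y Z" by (rule frame_exists[OF cc])
  interpret preserving_pair "\<phi> ` W" Y Z by (rule preserving_frame[OF cc F])
  obtain e where e: "0 < e" "ball (\<phi> p) e \<subseteq> \<phi> ` W"
    using openE[OF op] W(2) by blast
  have "theta \<zeta> \<noteq> 0" if \<zeta>: "\<zeta> \<in> ball (\<phi> p) e" for \<zeta>
  proof -
    obtain q where q: "q \<in> W" "\<zeta> = \<phi> q" using \<zeta> e(2) by blast
    then show ?thesis using frame_rho_iff(3)[OF cc F q(1)] exclusive[of q] rh by simp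
  qed
  then obtain g where g: "g holomorphic_on ball (\<phi> p) e" "\<And>\<zeta>. \<zeta> \<in> ball (\<phi> p) e \<Longrightarrow> theta \<zeta> = g \<zeta> ^ 2"
    "\<And>\<zeta>. \<zeta> \<in> ball (\<phi> p) e \<Longrightarrow> g \<zeta> \<noteq> 0"
    using contractible_imp_holomorphic_sqrt[OF holomorphic_on_subset[OF theta_holomorphic e(2)]
        convex_imp_contractible[OF convex_ball]] by (metis zero_power2)
  obtain w where w: "\<And>\<zeta>. \<zeta> \<in> ball (\<phi> p) e \<Longrightarrow> (w has_field_derivative g \<zeta>) (at \<zeta> within ball (\<phi> p) e)"
    using holomorphic_convex_primitive'[OF convex_ball open_ball g(1)] by metis
  then have wd: "(w has_field_derivative g \<zeta>) (at \<zeta>)" if "\<zeta> \<in> ball (\<phi> p) e" for \<zeta>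
    using that at_within_open[OF that open_ball] by metis
  then have hw: "w holomorphic_on ball (\<phi> p) e"
    unfolding holomorphic_on_open[OF open_ball] using wd by blast
  have pe: "\<phi> p \<in> ball (\<phi> p) e" using e(1) by simp
  have "deriv w (\<phi> p) \<noteq> 0"
    using DERIV_imp_deriv[OF wd[OF pe]] g(3)[OF pe] by simp
  from has_complex_derivative_locally_injective[OF hw pe open_ball this]
  obtain r where r: "0 < r" "ball (\<phi> p) r \<subseteq> ball (\<phi> p) e" "inj_on w (ball (\<phi> p) r)" by metis
  define V where "V = {q \<in> W. \<phi> q \<in> ball (\<phi> p) r}"
  define z where "z = w \<circ> \<phi>"
  have VW: "V \<subseteq> W" by (auto simp: V_def)
  have z: "coordinate A V z"
    unfolding coordinate_def
  proof (intro conjI)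
    show "open V"
      unfolding V_def by (rule open_coordinate_preimage[OF cc]) simp
    show "inj_on z V"
      using r(3) hm(4) unfolding z_def V_def inj_on_def by auto
    show "\<forall>(W', \<psi>)\<in>A. (z \<circ> inv_into W' \<psi>) holomorphic_on \<psi> ` (W' \<inter> V)"
    proof (clarify)
      fix W' \<psi> assume W': "(W', \<psi>) \<in> A"
      have "\<forall>c\<in>A. (\<phi> \<circ> inv_into (fst c) (snd c)) holomorphic_on snd c ` (fst c \<inter> W)"
        using cc unfolding coordinate_def case_prod_beta by blast
      from bspec[OF this W'] have h: "(\<phi> \<circ> inv_into W' \<psi>) holomorphic_on \<psi> ` (W' \<inter> V)"
        using VW by (auto elim!: holomorphic_on_subset)
      have "(\<phi> \<circ> inv_into W' \<psi>) ` \<psi> ` (W' \<inter> V) \<subseteq> ball (\<phi> p) e"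
        using r(2) chart_homeomorphism(4)[OF RS W'] by (auto simp: V_def)
      from holomorphic_on_compose_gen[OF h hw this]
      show "(z \<circ> inv_into W' \<psi>) holomorphic_on \<psi> ` (W' \<inter> V)"
        by (simp add: z_def o_assoc)
    qed
  qed
  show ?thesis
  proof (rule that[OF z])
    show "p \<in> V" using W(2) r(1) by (simp add: V_def)
    fix Y1 Z1 q assume F1: "is_frame V z Y1 Z1" and q: "q \<in> V"
    have qW: "q \<in> W" and qr: "\<phi> q \<in> ball (\<phi> p) r" using q by (auto simp: V_def)
    then have qe: "\<phi> q \<in> ball (\<phi> p) e" using r(2) by blast
    obtain c where c: "deriv (z \<circ> inv_into W \<phi>) (\<phi> q) * c = 1" "tn V z q = c\<^sup>2 * tn W \<phi> q"
      using coordinate_change_at[OF z q W(1) qW] by metis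
    have "deriv (z \<circ> inv_into W \<phi>) (\<phi> q) = deriv w (\<phi> q)"
    proof (rule deriv_cong_ev)
      have "(z \<circ> inv_into W \<phi>) \<zeta> = w \<zeta>" if "\<zeta> \<in> ball (\<phi> p) e" for \<zeta>
      proof -
        have "\<zeta> \<in> \<phi> ` W" using that e(2) by blast
        then show ?thesis by (simp add: z_def f_inv_into_f)
      qed
      then show "\<forall>\<^sub>F \<zeta> in nhds (\<phi> q). (z \<circ> inv_into W \<phi>) \<zeta> = w \<zeta>"
        using qe unfolding eventually_nhds by (intro exI[of _ "ball (\<phi> p) e"]) auto
    qed simp
    also have "\<dots> = g (\<phi> q)" by (rule DERIV_imp_deriv[OF wd[OF qe]])
    finally have gc: "g (\<phi> q) * c = 1" using c(1) by simp
    have "lift_pair.theta Y1 Z1 (z q) = c\<^sup>2 * theta (\<phi> q)"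
      unfolding frame_theta[OF F1 q] frame_theta[OF F qW] c(2) by simp
    also have "\<dots> = (g (\<phi> q) * c)\<^sup>2"
      unfolding g(2)[OF qe] by (simp add: power_mult_distrib)
    finally show "lift_pair.theta Y1 Z1 (z q) = 1" using gc by simp
  qed
qed

text \<open>In the normalising coordinate the lift Z of the frame is itself canonical and supplies
  lift data for \<open>fh\<close>. Both Hopf differentials are thus real in one coordinate, as
  corresponding curvature lines demand.\<close>

lemma darboux: "darboux_pair_on A f fh UNIV"
  unfolding darboux_pair_on_def
proof (intro conjI)
  show "\<exists>S. sphere_congruence_on A UNIV S \<and> envelops_on A UNIV f S \<and> envelops_on A UNIV fh S"
    using sph env by blast
  show "\<forall>p\<in>UNIV. \<exists>V z Y s \<kappa> Yh sh \<kappa>h. p \<in> V \<and> V \<subseteq> UNIV \<and>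
        lift_data A f V z Y s \<kappa> \<and> lift_data A fh V z Yh sh \<kappa>h \<and>
        (\<forall>\<zeta>\<in>z ` V. \<kappa> \<zeta> \<in> range cpx \<and> \<kappa>h \<zeta> \<in> range cpx)"
  proof
    fix p
    obtain V z where z: "coordinate A V z" and p: "p \<in> V"
      and t1: "\<And>Y Z q. is_frame V z Y Z \<Longrightarrow> q \<in> V \<Longrightarrow> lift_pair.theta Y Z (z q) = 1"
      by (rule normalising_coordinate) blast
    obtain Y Z where F: "is_frame V z Y Z" by (rule frame_exists[OF z])
    interpret preserving_pair "z ` V" Y Z by (rule preserving_frame[OF z F])
    have th1: "theta \<zeta> = 1" if "\<zeta> \<in> z ` V" for \<zeta>
      using that t1[OF F] by auto
    note LZ = lift_Z[OF th1]
    obtain s \<kappa> where D: "lift_data A f V z Y s \<kappa>"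
      by (rule lift_data_exists[OF z is_frame_canonical[OF F] refl])
    interpret Z: lift "z ` V" Z by (rule LZ)
    have "canonical_lift fh V z Z"
      unfolding canonical_lift_def
    proof (intro conjI ballI)
      fix q assume "q \<in> V"
      then obtain r where r: "0 < r" "Z (z q) = inverse (r * gapM q) *\<^sub>R (fh q, 1)"
        using frame_scale[OF F] by metis
      then show "\<exists>l>0. Z (z q) = l *\<^sub>R (fh q, 1)"
        using gapM_pos[of q] by (intro exI[of _ "inverse (r * gapM q)"]) simp
    qed (use Z.sY Z.conformal Z.metric in auto)
    then obtain sh \<kappa>h where Dh: "lift_data A fh V z Z sh \<kappa>h"
      by (rule Z.lift_data_exists[OF z _ refl])
    have "\<kappa> \<zeta> \<in> range cpx \<and> \<kappa>h \<zeta> \<in> range cpx" if "\<zeta> \<in> z ` V" for \<zeta>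
      using hopf_real_Y[OF th1 that, of "\<kappa> \<zeta>" "s \<zeta>"] hopf_real_Z[OF th1 that, of "\<kappa>h \<zeta>" "sh \<zeta>"]
        D Dh that unfolding lift_data_def by blast
    then show "\<exists>V z Y s \<kappa> Yh sh \<kappa>h. p \<in> V \<and> V \<subseteq> UNIV \<and>
        lift_data A f V z Y s \<kappa> \<and> lift_data A fh V z Yh sh \<kappa>h \<and>
        (\<forall>\<zeta>\<in>z ` V. \<kappa> \<zeta> \<in> range cpx \<and> \<kappa>h \<zeta> \<in> range cpx)"
      using p D Dh by blast
  qed
qed (fact imm conf)+

end

text \<open>Both alternatives hold on the whole surface, since connectedness decides both which
  coefficient vanishes and whether \<open>rhoM\<close> is real everywhere or on no open set. Every
  point may then take the surface itself as its neighbourhood.\<close>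

lemma classification:
  assumes "\<not> trivial_pair f fh"
  shows "darboux_pair_on A f fh UNIV \<and> orientation_preserving_on A UNIV S f fh \<or>
     s_willmore_on A f UNIV \<and> dual_surface_on A f fh UNIV \<and> anticonformal_on A UNIV S f fh"
proof (cases "\<forall>p. rhoM p = 0")
  case True
  then show ?thesis using darboux orientation_preserving by blast
next
  case False
  then have th: "\<And>p. thetaM p = 0" using dichotomy by blast
  have "\<not> (\<forall>p. cnj (rhoM p) = rhoM p)"
    using trivial[OF th] assms by blast
  then have "interior {p. cnj (rhoM p) = rhoM p} = {}"
    using real_locus_dichotomy[OF th] by blast
  then show ?thesis
    using s_willmore[OF th] dual_surface[OF th] anticonformal[OF th] by blast
qed

end

theorem theorem2:
  fixes n :: nat
    and A :: "('m::t2_space) atlas"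
    and f fh :: "'m \<Rightarrow> real^('n::finite)"
    and S :: "'m \<Rightarrow> 'n sphere2"
  assumes "n \<ge> 3" and "CARD('n) = n + 1"
    and "riemann_surface A"
    and "immersion_on A UNIV f" and "immersion_on A UNIV fh"
    and "\<And>p. f p \<noteq> fh p"
    and "sphere_congruence_on A UNIV S"
    and "envelops_on A UNIV f S" and "envelops_on A UNIV fh S"
    and "induces_conformal_structure_on A UNIV f" and "induces_conformal_structure_on A UNIV fh"
    and "\<not> trivial_pair f fh"
  shows "\<forall>p. \<exists>U. open U \<and> p \<in> U \<and>
           (darboux_pair_on A f fh U \<and> orientation_preserving_on A U S f fh \<or>
            s_willmore_on A f U \<and> dual_surface_on A f fh U \<and> anticonformal_on A U S f fh)"
proof -
  interpret surface_pair A f fh S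
    by (rule surface_pair.intro) fact+
  show ?thesis
    using classification[OF assms(12)] by (intro allI exI[of _ UNIV]) auto
qed

end
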